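(* Suppose that the family $\mathscr T(\ell,\mathscr M)$ satisfies Assumption 2 (recalled in the context) with positive constants $a_0,a_1,a_2$. Let $\xi>0$, $\epsilon>0$ and let $\overline{\mathbf P}$ be an arbitrary element of $\mathbf M$. Then any $\ell$-estimator $\widehat{\mathbf P}$ satisfies, whatever the true distribution $\mathbf P^\star=(P_1^\star,\ldots,P_n^\star)\in\mathscr P^n$, with probability at least $1-e^{-\xi}$, $$\boldsymbol\ell(\mathbf P^\star,\widehat{\mathbf P})\le\left[\frac{4a_0}{a_1}+1\right]\boldsymbol\ell(\mathbf P^\star,\overline{\mathbf P})-\boldsymbol\ell(\mathbf P^\star,\mathbf M)+2D(\overline{\mathbf P})+\left[\frac{4a_2}{a_1}+1\right]\frac{8\xi}{a_1}+\frac{2\epsilon}{a_1}.$$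
   Context: Framework. $(E,\mathcal E)$ is a measurable space with a $\sigma$-finite measure $\mu$, and $n\ge1$. $\mathscr P$ is a set of probability measures on $(E,\mathcal E)$; $\mathscr M$ is an at most countable set of finite, possibly signed, measures of the form $P=p\cdot\mu$. $\ell:\mathscr P\times\mathscr M\to[0,+\infty)$ is a loss function, not identically $0$. The observation is $\boldsymbol X=(X_1,\ldots,X_n)$ with $X_1,\ldots,X_n$ independent, $X_i\sim P_i^\star\in\mathscr P$; we write $\mathbf P^\star=(P_1^\star,\ldots,P_n^\star)$ (identified with the product measure). $\mathbb P,\mathbb E$ refer to this true distribution; $\mathbb E_S,\operatorname{Var}_S$ are expectation and variance when $X\sim S$. The model $\mathbf M$ is a nonempty subset of $\mathscr M^n$. For $\mathbf P\in\mathscr P^n$, $\mathbf Q\in\mathbf M$: $\boldsymbol\ell(\mathbf P,\mathbf Q)=\sum_{i=1}^n\ell(P_i,Q_i)$ and $\boldsymbol\ell(\mathbf P,\mathbf M)=\inf_{\mathbf Q\in\mathbf M}\boldsymbol\ell(\mathbf P,\mathbf Q)$. Assumption 2. $\mathscr T(\ell,\mathscr M)=\{t_{(P,Q)},\ (P,Q)\in\mathscr M^2\}$ is a family of real-valued measurable functions on $E$ and $a_0,a_1,a_2$ are positive numbers (necessarily $a_1\le a_0$) such that, for all $S\in\mathscr P$ and $P,Q\in\mathscr M$: (i) $t_{(P,Q)}=-t_{(Q,P)}$; (ii) $\mathbb E_S[t_{(P,Q)}(X)]\le a_0\ell(S,P)-a_1\ell(S,Q)$; (iii) $\sup_{x\in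 E}t_{(P,Q)}(x)-\inf_{x\in E}t_{(P,Q)}(x)\le1$; (iv) $\operatorname{Var}_S[t_{(P,Q)}(X)]\le a_2[\ell(S,P)+\ell(S,Q)]$. Estimator. For $\mathbf P,\mathbf Q\in\mathbf M$, $\mathbf T(\boldsymbol X,\mathbf P,\mathbf Q)=\sum_{i=1}^n t_{(P_i,Q_i)}(X_i)$ and $\mathbf T(\boldsymbol X,\mathbf P)=\sup_{\mathbf Q\in\mathbf M}\mathbf T(\boldsymbol X,\mathbf P,\mathbf Q)$. Given $\epsilon>0$, an $\ell$-estimator is any (measurable) random element $\widehat{\mathbf P}=\widehat{\mathbf P}(\boldsymbol X)$ of $\mathbf M$ such that $\mathbf T(\boldsymbol X,\widehat{\mathbf P})\le\inf_{\mathbf P'\in\mathbf M}\mathbf T(\boldsymbol X,\mathbf P')+\epsilon$. Local complexity. For $y\ge0$ let $\mathbf B(\mathbf P^\star,y)=\{\mathbf Q\in\mathbf M:\ \boldsymbol\ell(\mathbf P^\star,\mathbf Q)\le y\}$ and $$\mathbf w(\overline{\mathbf P},y)=\mathbb E\left[\sup_{\mathbf Q\in\mathbf B(\mathbf P^\star,y)}\left|\mathbf T(\boldsymbol X,\overline{\mathbf P},\mathbf Q)-\mathbb E[\mathbf T(\boldsymbol X,\overline{\mathbf P},\mathbf Q)]\right|\right]$$ (with value $0$ if the ball is empty). Set $$c_1=\frac{a_1}{2}\left[2(1+\log4)+\frac{4a_1}{a_2}+\frac{16a_2\log2}{a_1}\right]^{-1},\qquad D(\overline{\mathbf P})=\max\left\{\sup\{y>0:\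 \mathbf w(\overline{\mathbf P},y)>c_1y\},\ c_1^{-1}\right\},$$ where the supremum of the empty set is $0$. *)

theory Defs
  imports "HOL-Probability.Probability"
begin

(* A signed measure is represented by its real-valued set function, normalised to 0 off the
   sigma-algebra of \<mu> so that equal measures are equal as HOL functions.
   signed_density \<mu> p is the measure p . \<mu>; it is finite exactly when p is integrable. *)
definition signed_density :: "'a measure \<Rightarrow> ('a \<Rightarrow> real) \<Rightarrow> 'a set \<Rightarrow> real" where
  "signed_density \<mu> p A = (if A \<in> sets \<mu> then set_lebesgue_integral \<mu> A p else 0)"

definition finite_signed_densities :: "'a measure \<Rightarrow> ('a set \<Rightarrow> real) set" where
  "finite_signed_densities \<mu> = {signed_density \<mu> p | p. integrable \<mu> p}"

definition total_loss ::
    "('a measure \<Rightarrow> ('a set \<Rightarrow> real) \<Rightarrow> real) \<Rightarrow> nat \<Rightarrow> (nat \<Rightarrow> 'a measure) \<Rightarrow>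
     (nat \<Rightarrow> 'a set \<Rightarrow> real) \<Rightarrow> real" where
  "total_loss loss n P Q = (\<Sum>i=1..n. loss (P i) (Q i))"

(* The index set is always nonempty and the loss nonnegative, so the real infimum is genuine. *)
definition model_loss ::
    "('a measure \<Rightarrow> ('a set \<Rightarrow> real) \<Rightarrow> real) \<Rightarrow> nat \<Rightarrow> (nat \<Rightarrow> 'a measure) \<Rightarrow>
     (nat \<Rightarrow> 'a set \<Rightarrow> real) set \<Rightarrow> real" where
  "model_loss loss n P Model = (INF Q\<in>Model. total_loss loss n P Q)"

(* The oscillation bound is stated in ereal: on real, Sup and Inf of an unbounded
   set are unspecified. *)
definition test_family ::
    "'a measure \<Rightarrow> 'a measure set \<Rightarrow> ('a set \<Rightarrow> real) set \<Rightarrow>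
     ('a measure \<Rightarrow> ('a set \<Rightarrow> real) \<Rightarrow> real) \<Rightarrow> real \<Rightarrow> real \<Rightarrow> real \<Rightarrow>
     (('a set \<Rightarrow> real) \<Rightarrow> ('a set \<Rightarrow> real) \<Rightarrow> 'a \<Rightarrow> real) \<Rightarrow> bool" where
  "test_family \<mu> \<P> \<M> loss a0 a1 a2 t \<longleftrightarrow>
     0 < a0 \<and> 0 < a1 \<and> 0 < a2 \<and>
     (\<forall>P\<in>\<M>. \<forall>Q\<in>\<M>.
        t P Q \<in> borel_measurable \<mu> \<and>
        (\<forall>x\<in>space \<mu>. t P Q x = - t Q P x) \<and>
        (SUP x\<in>space \<mu>. ereal (t P Q x)) - (INF x\<in>space \<mu>. ereal (t P Q x)) \<le> 1 \<and>
        (\<forall>S\<in>\<P>.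
           prob_space.expectation S (t P Q) \<le> a0 * loss S P - a1 * loss S Q \<and>
           prob_space.variance S (t P Q) \<le> a2 * (loss S P + loss S Q)))"

definition T_pair ::
    "(('a set \<Rightarrow> real) \<Rightarrow> ('a set \<Rightarrow> real) \<Rightarrow> 'a \<Rightarrow> real) \<Rightarrow> nat \<Rightarrow> (nat \<Rightarrow> 'a) \<Rightarrow>
     (nat \<Rightarrow> 'a set \<Rightarrow> real) \<Rightarrow> (nat \<Rightarrow> 'a set \<Rightarrow> real) \<Rightarrow> real" where
  "T_pair t n x P Q = (\<Sum>i=1..n. t (P i) (Q i) (x i))"

definition T_sup ::
    "(('a set \<Rightarrow> real) \<Rightarrow> ('a set \<Rightarrow> real) \<Rightarrow> 'a \<Rightarrow> real) \<Rightarrow> nat \<Rightarrow>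
     (nat \<Rightarrow> 'a set \<Rightarrow> real) set \<Rightarrow> (nat \<Rightarrow> 'a) \<Rightarrow> (nat \<Rightarrow> 'a set \<Rightarrow> real) \<Rightarrow> ereal" where
  "T_sup t n Model x P = (SUP Q\<in>Model. ereal (T_pair t n x P Q))"

(* The model is countable, hence the discrete sigma-algebra on it. *)
definition l_estimator ::
    "'a measure \<Rightarrow> (('a set \<Rightarrow> real) \<Rightarrow> ('a set \<Rightarrow> real) \<Rightarrow> 'a \<Rightarrow> real) \<Rightarrow> nat \<Rightarrow>
     (nat \<Rightarrow> 'a set \<Rightarrow> real) set \<Rightarrow> real \<Rightarrow> ((nat \<Rightarrow> 'a) \<Rightarrow> nat \<Rightarrow> 'a set \<Rightarrow> real) \<Rightarrow> bool" where
  "l_estimator \<mu> t n Model \<epsilon> Phat \<longleftrightarrow>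
     Phat \<in> measurable (PiM {1..n} (\<lambda>_. \<mu>)) (count_space Model) \<and>
     (\<forall>x\<in>space (PiM {1..n} (\<lambda>_. \<mu>)).
        T_sup t n Model x (Phat x) \<le> (INF P\<in>Model. T_sup t n Model x P) + ereal \<epsilon>)"

definition observation :: "nat \<Rightarrow> (nat \<Rightarrow> 'b \<Rightarrow> 'a) \<Rightarrow> 'b \<Rightarrow> nat \<Rightarrow> 'a" where
  "observation n X \<omega> = (\<lambda>i\<in>{1..n}. X i \<omega>)"

definition loss_ball ::
    "('a measure \<Rightarrow> ('a set \<Rightarrow> real) \<Rightarrow> real) \<Rightarrow> nat \<Rightarrow> (nat \<Rightarrow> 'a set \<Rightarrow> real) set \<Rightarrow>
     (nat \<Rightarrow> 'a measure) \<Rightarrow> real \<Rightarrow> (nat \<Rightarrow> 'a set \<Rightarrow> real) set" where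
  "loss_ball loss n Model P y = {Q \<in> Model. total_loss loss n P Q \<le> y}"

(* Over an empty ball the ennreal supremum, hence the expectation, is 0. *)
definition local_complexity ::
    "'b measure \<Rightarrow> (nat \<Rightarrow> 'b \<Rightarrow> 'a) \<Rightarrow>
     (('a set \<Rightarrow> real) \<Rightarrow> ('a set \<Rightarrow> real) \<Rightarrow> 'a \<Rightarrow> real) \<Rightarrow>
     ('a measure \<Rightarrow> ('a set \<Rightarrow> real) \<Rightarrow> real) \<Rightarrow> nat \<Rightarrow> (nat \<Rightarrow> 'a set \<Rightarrow> real) set \<Rightarrow>
     (nat \<Rightarrow> 'a measure) \<Rightarrow> (nat \<Rightarrow> 'a set \<Rightarrow> real) \<Rightarrow> real \<Rightarrow> ennreal" where
  "local_complexity \<Omega> X t loss n Model Pstar Pbar y =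
     (\<integral>\<^sup>+ \<omega>. (SUP Q\<in>loss_ball loss n Model Pstar y.
        ennreal \<bar>T_pair t n (observation n X \<omega>) Pbar Q
          - prob_space.expectation \<Omega> (\<lambda>\<omega>'. T_pair t n (observation n X \<omega>') Pbar Q)\<bar>) \<partial>\<Omega>)"

definition c1 :: "real \<Rightarrow> real \<Rightarrow> real" where
  "c1 a1 a2 = a1 / 2 * inverse (2 * (1 + ln 4) + 4 * a1 / a2 + 16 * a2 * ln 2 / a1)"

(* The inserted 0 implements the convention that the supremum of the empty set is 0. *)
definition D_bound ::
    "'b measure \<Rightarrow> (nat \<Rightarrow> 'b \<Rightarrow> 'a) \<Rightarrow>
     (('a set \<Rightarrow> real) \<Rightarrow> ('a set \<Rightarrow> real) \<Rightarrow> 'a \<Rightarrow> real) \<Rightarrow>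
     ('a measure \<Rightarrow> ('a set \<Rightarrow> real) \<Rightarrow> real) \<Rightarrow> nat \<Rightarrow> (nat \<Rightarrow> 'a set \<Rightarrow> real) set \<Rightarrow>
     real \<Rightarrow> real \<Rightarrow> (nat \<Rightarrow> 'a measure) \<Rightarrow> (nat \<Rightarrow> 'a set \<Rightarrow> real) \<Rightarrow> ereal" where
  "D_bound \<Omega> X t loss n Model a1 a2 Pstar Pbar =
     max (Sup (insert 0 {ereal y | y. 0 < y \<and>
            local_complexity \<Omega> X t loss n Model Pstar Pbar y > ennreal (c1 a1 a2 * y)}))
         (ereal (inverse (c1 a1 a2)))"

end

theory Submission
  imports Defs
begin

(* Entropy method with peeling. Let S(Q) = T(Pbar, Q) - E T(Pbar, Q). If with large probability
     |S(Q)| <= (a1/2) l(Q) + R   for all Q in the model,   R = (a1/4) l(Pbar) + (a1/2) D + (8 a2/a1 + 2) xi,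
   then comparing T(X, Phat) >= -T(X, Pbar, Phat) with T(X, Pbar) + eps gives the oracle inequality.
   The uniform bound is obtained on the balls l(Q) <= 2^j D, each with failure probability
   exp(-xi) 2^-(j+1), from a Talagrand-type inequality for Z, the supremum of |S| over a ball:
     ln E exp(s (Z - EZ)) <= s^2 / (1 - 2 s) (5/4 v + 11/2 EZ),   0 < s < 1/2,
   where v bounds the variances. It follows from the tensorization of entropy and the Herbst argument:
   Ent exp(sZ) is controlled by E[(W + v) exp(sZ)], with W the supremum of the sums of squares;
   W is self-bounding, hence has a good Laplace transform, and EW <= v + 8 EZ by symmetrization
   and contraction. With s = r / (8 + 2 r) and r = a1 / a2 the constants fit the definition of c1. *)

section \<open>Bounded measurable functions\<close>

text \<open>The claimed constants shape the proof. In the final inequality the deviation terms are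
  multiplied by \<open>4 / a1\<close>, so the coefficient \<open>(4 * a2 / a1 + 1) * 8 / a1\<close>
  of \<xi> leaves \<open>8 / r + 2\<close> for the Chernoff step, where it is \<open>1 / s\<close>:
  this fixes \<open>s\<close>. What remains is the pair 5/4, 11/2. With \<open>N = 2 ^ j\<close> and
  \<open>K = a1 / (2 * c1)\<close>, the rings \<open>j \<ge> 1\<close> require \<open>N * (1 + 11 /
  16 * r) + (8 / r + 2) * (j + 1) * ln 2 \<le> K * (1 + 3 / 16 * N)\<close>, which holds with little
  slack. A cruder Laplace bound would not fit, so the entropy inequality for \<open>Z\<close> is
  solved for the entropy and its coefficients are estimated by polynomials. All functions involved
  are bounded, and pointwise rather than almost everywhere, so that sections and one-coordinate
  updates are bounded too; integrability, Fubini and differentiation under the integral then come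
  for free. Finite families come first because their maxima are attained.\<close>

definition bdd_meas :: "'a measure \<Rightarrow> ('a \<Rightarrow> real) \<Rightarrow> bool" where
  "bdd_meas N f \<longleftrightarrow> f \<in> borel_measurable N \<and> (\<exists>B. \<forall>x\<in>space N. \<bar>f x\<bar> \<le> B)"

lemma bdd_measI: "f \<in> borel_measurable N \<Longrightarrow> (\<And>x. x \<in> space N \<Longrightarrow> \<bar>f x\<bar> \<le> B) \<Longrightarrow> bdd_meas N f"
  by (auto simp: bdd_meas_def)

lemma bdd_meas_measurable: "bdd_meas N f \<Longrightarrow> f \<in> borel_measurable N"
  by (auto simp: bdd_meas_def)

lemma bdd_measD:
  assumes "bdd_meas N f"
  shows "\<exists>B\<ge>0. \<forall>x\<in>space N. \<bar>f x\<bar> \<le> B"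
proof -
  obtain B where "\<forall>x\<in>space N. \<bar>f x\<bar> \<le> B" using assms by (auto simp: bdd_meas_def)
  then show ?thesis by (intro exI[of _ "max 0 B"]) (auto simp: le_max_iff_disj)
qed

lemma bdd_meas_const [simp]: "bdd_meas N (\<lambda>x. c)"
  by (rule bdd_measI[of _ _ "\<bar>c\<bar>"]) auto

lemma bdd_meas_add:
  assumes "bdd_meas N f" "bdd_meas N g" shows "bdd_meas N (\<lambda>x. f x + g x)"
proof -
  obtain B C where "\<And>x. x \<in> space N \<Longrightarrow> \<bar>f x\<bar> \<le> B" "\<And>x. x \<in> space N \<Longrightarrow> \<bar>g x\<bar> \<le> C"
    using bdd_measD[OF assms(1)] bdd_measD[OF assms(2)] by metis
  then show ?thesis using assms[THEN bdd_meas_measurable]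
    by (intro bdd_measI[where B="B + C"]) (auto intro: order_trans[OF abs_triangle_ineq] add_mono)
qed

lemma bdd_meas_mult:
  assumes "bdd_meas N f" "bdd_meas N g" shows "bdd_meas N (\<lambda>x. f x * g x)"
proof -
  obtain B C where "B \<ge> 0" "C \<ge> 0"
    "\<And>x. x \<in> space N \<Longrightarrow> \<bar>f x\<bar> \<le> B" "\<And>x. x \<in> space N \<Longrightarrow> \<bar>g x\<bar> \<le> C"
    using bdd_measD[OF assms(1)] bdd_measD[OF assms(2)] by metis
  then show ?thesis using assms[THEN bdd_meas_measurable]
    by (intro bdd_measI[where B="B * C"]) (auto simp: abs_mult intro!: mult_mono)
qed

lemma bdd_meas_uminus: "bdd_meas N f \<Longrightarrow> bdd_meas N (\<lambda>x. - f x)"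
  by (auto simp: bdd_meas_def)

lemma bdd_meas_diff: "bdd_meas N f \<Longrightarrow> bdd_meas N g \<Longrightarrow> bdd_meas N (\<lambda>x. f x - g x)"
  using bdd_meas_add[OF _ bdd_meas_uminus, of N f g] by simp

lemma bdd_meas_divide: "bdd_meas N f \<Longrightarrow> bdd_meas N (\<lambda>x. f x / c)"
  using bdd_meas_mult[of N f "\<lambda>_. inverse c"] by (simp add: divide_inverse)

lemma bdd_meas_power2: "bdd_meas N f \<Longrightarrow> bdd_meas N (\<lambda>x. (f x)\<^sup>2)"
  using bdd_meas_mult[of N f f] by (simp add: power2_eq_square)

lemma bdd_meas_sum: "(\<And>i. i \<in> I \<Longrightarrow> bdd_meas N (f i)) \<Longrightarrow> bdd_meas N (\<lambda>x. \<Sum>i\<in>I. f i x)"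
  by (induction I rule: infinite_finite_induct) (auto intro: bdd_meas_add)

lemma bdd_meas_exp:
  assumes "bdd_meas N f" shows "bdd_meas N (\<lambda>x. exp (f x))"
proof -
  obtain B where "\<And>x. x \<in> space N \<Longrightarrow> \<bar>f x\<bar> \<le> B" using bdd_measD[OF assms] by blast
  then show ?thesis using bdd_meas_measurable[OF assms]
    by (intro bdd_measI[where B="exp B"]) (auto simp: abs_le_iff)
qed

lemma bdd_meas_comp:
  assumes "bdd_meas N f" "g \<in> measurable K N" shows "bdd_meas K (\<lambda>x. f (g x))"
proof -
  obtain B where "\<And>x. x \<in> space N \<Longrightarrow> \<bar>f x\<bar> \<le> B" using bdd_measD[OF assms(1)] by blast
  moreover have "(\<lambda>x. f (g x)) \<in> borel_measurable K"
    using measurable_compose[OF assms(2) bdd_meas_measurable[OF assms(1)]] .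
  ultimately show ?thesis using measurable_space[OF assms(2)] by (auto intro!: bdd_measI)
qed

lemma bdd_meas_max0:
  assumes "bdd_meas N f" shows "bdd_meas N (\<lambda>x. max 0 (f x))"
proof -
  obtain B where "\<And>x. x \<in> space N \<Longrightarrow> \<bar>f x\<bar> \<le> B" "B \<ge> 0" using bdd_measD[OF assms] by blast
  then show ?thesis using bdd_meas_measurable[OF assms]
    by (intro bdd_measI[where B="B"]) (auto simp: max_def dest: abs_le_D1)
qed

lemma bdd_meas_Max:
  assumes "finite F" "F \<noteq> {}" "\<And>q. q \<in> F \<Longrightarrow> bdd_meas N (f q)"
  shows "bdd_meas N (\<lambda>x. Max ((\<lambda>q. f q x) ` F))"
proof -
  have "\<exists>B. \<forall>q\<in>F. \<forall>x\<in>space N. \<bar>f q x\<bar> \<le> B q"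
    using bdd_measD[OF assms(3)] by (intro bchoice) blast
  then obtain B where B: "\<And>q x. q \<in> F \<Longrightarrow> x \<in> space N \<Longrightarrow> \<bar>f q x\<bar> \<le> B q" by blast
  have "\<bar>Max ((\<lambda>q. f q x) ` F)\<bar> \<le> Max (B ` F)" if "x \<in> space N" for x
  proof -
    have "Max ((\<lambda>q. f q x) ` F) \<in> (\<lambda>q. f q x) ` F" using assms by (intro Max_in) auto
    then obtain q where "q \<in> F" "Max ((\<lambda>q. f q x) ` F) = f q x" by auto
    moreover have "B q \<le> Max (B ` F)" using assms \<open>q \<in> F\<close> by auto
    ultimately show ?thesis using B[OF \<open>q \<in> F\<close> that] by simp
  qed
  then show ?thesis using assms(1) bdd_meas_measurable[OF assms(3)]
    by (intro bdd_measI borel_measurable_Max) auto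
qed

lemma bdd_meas_integrable: "prob_space N \<Longrightarrow> bdd_meas N f \<Longrightarrow> integrable N f"
proof -
  assume "prob_space N" "bdd_meas N f"
  then interpret prob_space N by simp
  obtain B where "\<And>x. x \<in> space N \<Longrightarrow> \<bar>f x\<bar> \<le> B" using bdd_measD[OF \<open>bdd_meas N f\<close>] by blast
  then show ?thesis using \<open>bdd_meas N f\<close>
    by (intro integrable_const_bound[of _ B]) (auto dest: bdd_meas_measurable)
qed

lemma bdd_meas_section:
  assumes "bdd_meas (N1 \<Otimes>\<^sub>M N2) (\<lambda>(x, y). f x y)" "x \<in> space N1"
  shows "bdd_meas N2 (f x)"
  using bdd_meas_comp[OF assms(1), of "\<lambda>y. (x, y)" N2] assms(2) by simp

lemma bdd_meas_swap:
  assumes "bdd_meas (N1 \<Otimes>\<^sub>M N2) (\<lambda>(x, y). f x y)"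
  shows "bdd_meas (N2 \<Otimes>\<^sub>M N1) (\<lambda>(y, x). f x y)"
  using bdd_meas_comp[OF assms, of "\<lambda>(y, x). (x, y)" "N2 \<Otimes>\<^sub>M N1"] by (simp add: case_prod_unfold)

lemma bdd_meas_mono:
  assumes "prob_space N" "bdd_meas N f" "bdd_meas N g" "\<And>x. x \<in> space N \<Longrightarrow> f x \<le> g x"
  shows "(\<integral>x. f x \<partial>N) \<le> (\<integral>x. g x \<partial>N)"
  using assms by (intro integral_mono bdd_meas_integrable)

lemma bdd_meas_abs_integral_le:
  assumes "prob_space N" "bdd_meas N f" "\<And>x. x \<in> space N \<Longrightarrow> \<bar>f x\<bar> \<le> B"
  shows "\<bar>\<integral>x. f x \<partial>N\<bar> \<le> B"
proof -
  interpret prob_space N by fact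
  have "(\<integral>x. f x \<partial>N) \<le> B" "- B \<le> (\<integral>x. f x \<partial>N)"
    using assms(3) by (intro integral_le_const integral_ge_const bdd_meas_integrable assms AE_I2; force simp: abs_le_iff)+
  then show ?thesis by simp
qed

lemma bdd_meas_integral:
  assumes "prob_space N2" "bdd_meas (N1 \<Otimes>\<^sub>M N2) (\<lambda>(x, y). f x y)"
  shows "bdd_meas N1 (\<lambda>x. \<integral>y. f x y \<partial>N2)"
proof -
  interpret N2: prob_space N2 by fact
  obtain B where B: "\<And>z. z \<in> space (N1 \<Otimes>\<^sub>M N2) \<Longrightarrow> \<bar>(\<lambda>(x, y). f x y) z\<bar> \<le> B"
    using bdd_measD[OF assms(2)] by blast
  have [measurable]: "(\<lambda>(x, y). f x y) \<in> borel_measurable (N1 \<Otimes>\<^sub>M N2)"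
    using bdd_meas_measurable[OF assms(2)] .
  show ?thesis
  proof (rule bdd_measI[of _ _ B])
    show "(\<lambda>x. \<integral>y. f x y \<partial>N2) \<in> borel_measurable N1" by measurable
    show "\<bar>\<integral>y. f x y \<partial>N2\<bar> \<le> B" if "x \<in> space N1" for x
      using that B by (intro bdd_meas_abs_integral_le assms bdd_meas_section[OF assms(2)])
        (auto simp: space_pair_measure)
  qed
qed

lemma bdd_meas_integral': "prob_space N1 \<Longrightarrow> bdd_meas (N1 \<Otimes>\<^sub>M N2) (\<lambda>(x, y). f x y) \<Longrightarrow>
   bdd_meas N2 (\<lambda>y. \<integral>x. f x y \<partial>N1)"
  by (rule bdd_meas_integral[OF _ bdd_meas_swap])

lemma bdd_meas_Fubini:
  assumes "prob_space N1" "prob_space N2" "bdd_meas (N1 \<Otimes>\<^sub>M N2) (\<lambda>(x, y). f x y)"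
  shows "(\<integral>x. (\<integral>y. f x y \<partial>N2) \<partial>N1) = (\<integral>y. (\<integral>x. f x y \<partial>N1) \<partial>N2)"
proof -
  interpret N1: prob_space N1 by fact
  interpret N2: prob_space N2 by fact
  interpret P: pair_prob_space N1 N2 ..
  show ?thesis
    by (rule P.Fubini_integral[symmetric]) (intro bdd_meas_integrable assms(3), unfold_locales)
qed

lemma integral_exp_bounds:
  assumes "prob_space N" "bdd_meas N h" "\<And>x. x \<in> space N \<Longrightarrow> \<bar>h x\<bar> \<le> B"
  shows "(\<integral>x. exp (h x) \<partial>N) \<ge> exp (- B)" "(\<integral>x. exp (h x) \<partial>N) \<le> exp B"
proof -
  interpret prob_space N by fact
  show "(\<integral>x. exp (h x) \<partial>N) \<ge> exp (- B)" "(\<integral>x. exp (h x) \<partial>N) \<le> exp B"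
    using assms(3)
    by (intro integral_le_const integral_ge_const bdd_meas_integrable bdd_meas_exp assms AE_I2; force simp: abs_le_iff)+
qed

lemma bdd_meas_integral_exp_pos:
  assumes "prob_space N" "bdd_meas N h"
  shows "(\<integral>x. exp (h x) \<partial>N) > 0"
  using integral_exp_bounds(1)[OF assms] assms(2)
  by (metis bdd_measD exp_gt_zero less_le_trans)

text \<open>The integral lies between \<open>exp (- B)\<close> and \<open>exp B\<close>, so the
  bound \<open>B\<close> survives the logarithm. This keeps the class closed under passing to the
  marginal of a density given by its logarithm, as the induction for tensorization requires.\<close>

lemma bdd_meas_ln_integral_exp:
  assumes "prob_space N2" "bdd_meas (N1 \<Otimes>\<^sub>M N2) (\<lambda>(x, y). h x y)"
  shows "bdd_meas N1 (\<lambda>x. ln (\<integral>y. exp (h x y) \<partial>N2))"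
proof -
  obtain B where B: "\<And>z. z \<in> space (N1 \<Otimes>\<^sub>M N2) \<Longrightarrow> \<bar>(\<lambda>(x, y). h x y) z\<bar> \<le> B"
    using bdd_measD[OF assms(2)] by blast
  have "bdd_meas N1 (\<lambda>x. \<integral>y. exp (h x y) \<partial>N2)"
    using bdd_meas_exp[OF assms(2)] by (intro bdd_meas_integral assms) (simp add: case_prod_unfold)
  then have [measurable]: "(\<lambda>x. \<integral>y. exp (h x y) \<partial>N2) \<in> borel_measurable N1" by (rule bdd_meas_measurable)
  show ?thesis
  proof (rule bdd_measI[of _ _ B])
    show "(\<lambda>x. ln (\<integral>y. exp (h x y) \<partial>N2)) \<in> borel_measurable N1" by measurable
    fix x assume x: "x \<in> space N1"
    have "\<And>y. y \<in> space N2 \<Longrightarrow> \<bar>h x y\<bar> \<le> B" using B x by (auto simp: space_pair_measure)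
    note * = integral_exp_bounds[OF assms(1) bdd_meas_section[OF assms(2) x] this]
    have pos: "(\<integral>y. exp (h x y) \<partial>N2) > 0" using *(1) by (simp add: less_le_trans[OF exp_gt_zero])
    have "ln (\<integral>y. exp (h x y) \<partial>N2) \<le> B" "- B \<le> ln (\<integral>y. exp (h x y) \<partial>N2)"
      using * pos ln_le_cancel_iff[of "\<integral>y. exp (h x y) \<partial>N2" "exp B"]
        ln_le_cancel_iff[of "exp (-B)" "\<integral>y. exp (h x y) \<partial>N2"] by simp_all
    then show "\<bar>ln (\<integral>y. exp (h x y) \<partial>N2)\<bar> \<le> B" by simp
  qed
qed

lemmas bdd_meas_intros = bdd_meas_const bdd_meas_add bdd_meas_mult bdd_meas_uminus bdd_meas_diff bdd_meas_divide
  bdd_meas_power2 bdd_meas_sum bdd_meas_exp bdd_meas_max0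

section \<open>Entropy and its tensorization\<close>

text \<open>
  \<open>ent N h\<close> is the entropy of \<open>exp h\<close>: writing a positive function through its logarithm makes
  positivity and boundedness away from 0 automatic.
\<close>

definition ent :: "'a measure \<Rightarrow> ('a \<Rightarrow> real) \<Rightarrow> real" where
  "ent N h = (\<integral>x. h x * exp (h x) \<partial>N) - (\<integral>x. exp (h x) \<partial>N) * ln (\<integral>x. exp (h x) \<partial>N)"

text \<open>The Gibbs variational principle: \<open>ln z \<le> z - 1\<close> is applied to the ratio
  of the normalised densities \<open>exp u / v\<close> and \<open>exp h / m\<close>, and the
  right-hand side integrates to 0. It serves three times: for nonnegativity, for convexity of the
  entropy, and to separate \<open>W\<close> from \<open>exp (s * Z)\<close>.\<close>

lemma ent_duality:
  assumes N: "prob_space N" and h: "bdd_meas N h" and u: "bdd_meas N u"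
  shows "(\<integral>x. exp (h x) * u x \<partial>N) \<le> ent N h + (\<integral>x. exp (h x) \<partial>N) * ln (\<integral>x. exp (u x) \<partial>N)"
proof -
  interpret prob_space N by fact
  define m where "m = (\<integral>x. exp (h x) \<partial>N)"
  define v where "v = (\<integral>x. exp (u x) \<partial>N)"
  have pos: "m > 0" "v > 0" unfolding m_def v_def using assms by (auto intro: bdd_meas_integral_exp_pos)
  note int[simp] = bdd_meas_integrable[OF N]
  have "exp (h x) * u x - h x * exp (h x) + exp (h x) * (ln m - ln v) \<le> m / v * exp (u x) - exp (h x)" for x
  proof -
    have "ln (m * exp (u x - h x) / v) \<le> m * exp (u x - h x) / v - 1"
      using pos by (intro ln_le_minus_one) auto
    moreover have "ln (m * exp (u x - h x) / v) = ln m + (u x - h x) - ln v"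
      using pos by (simp add: ln_div ln_mult)
    ultimately have "exp (h x) * (ln m + (u x - h x) - ln v) \<le> exp (h x) * (m * exp (u x - h x) / v - 1)"
      by (intro mult_left_mono) auto
    also have "\<dots> = m / v * exp (u x) - exp (h x)"
      by (simp add: exp_diff algebra_simps)
    finally show ?thesis by (simp add: algebra_simps)
  qed
  then have "(\<integral>x. exp (h x) * u x - h x * exp (h x) + exp (h x) * (ln m - ln v) \<partial>N)
     \<le> (\<integral>x. m / v * exp (u x) - exp (h x) \<partial>N)"
    by (intro bdd_meas_mono N bdd_meas_intros h u)
  moreover have "(\<integral>x. exp (h x) * u x - h x * exp (h x) + exp (h x) * (ln m - ln v) \<partial>N)
     = (\<integral>x. exp (h x) * u x \<partial>N) - (\<integral>x. h x * exp (h x) \<partial>N) + m * (ln m - ln v)"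
    using h u by (simp add: bdd_meas_intros m_def)
  moreover have "(\<integral>x. m / v * exp (u x) - exp (h x) \<partial>N) = m / v * v - m"
    unfolding m_def v_def using h u by (subst Bochner_Integration.integral_diff) (auto intro!: int bdd_meas_intros)
  ultimately show ?thesis using pos unfolding ent_def m_def[symmetric] v_def[symmetric]
    by (simp add: algebra_simps)
qed

lemma ent_nonneg:
  assumes "prob_space N" "bdd_meas N h" shows "ent N h \<ge> 0"
  using ent_duality[OF assms, of "\<lambda>_. 0"] prob_space.prob_space[OF assms(1)] by simp

text \<open>The matching upper bound: the right-hand side is minimal at \<open>c = ln m\<close>,
  where it equals the entropy. As \<open>c\<close> is free, it can be set to anything that is
  constant in the coordinate at hand.\<close>

lemma ent_le:
  assumes N: "prob_space N" and h: "bdd_meas N h"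
  shows "ent N h \<le> (\<integral>x. exp (h x) * (h x - c) - exp (h x) + exp c \<partial>N)"
proof -
  interpret prob_space N by fact
  define m where "m = (\<integral>x. exp (h x) \<partial>N)"
  have pos: "m > 0" unfolding m_def using assms by (auto intro: bdd_meas_integral_exp_pos)
  note int[simp] = bdd_meas_integrable[OF N]
  have "(\<integral>x. exp (h x) * (h x - c) - exp (h x) + exp c \<partial>N)
    = (\<integral>x. h x * exp (h x) - c * exp (h x) - exp (h x) + exp c \<partial>N)"
    by (simp add: algebra_simps)
  also have "\<dots> = (\<integral>x. h x * exp (h x) \<partial>N) - c * m - m + exp c"
    using h by (simp add: bdd_meas_intros m_def prob_space)
  finally have eq: "(\<integral>x. exp (h x) * (h x - c) - exp (h x) + exp c \<partial>N)
    = (\<integral>x. h x * exp (h x) \<partial>N) - c * m - m + exp c" .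
  have "m * (1 + (c - ln m)) \<le> m * exp (c - ln m)"
    using pos by (intro mult_left_mono exp_ge_add_one_self) auto
  also have "\<dots> = exp c" using pos by (simp add: exp_diff)
  finally show ?thesis unfolding eq ent_def m_def[symmetric] by (simp add: algebra_simps)
qed

lemma bdd_meas_ent:
  assumes "prob_space N1" "bdd_meas (N1 \<Otimes>\<^sub>M N2) (\<lambda>(x, y). h x y)"
  shows "bdd_meas N2 (\<lambda>y. ent N1 (\<lambda>x. h x y))"
proof -
  have *: "bdd_meas (N1 \<Otimes>\<^sub>M N2) (\<lambda>(x, y). exp (h x y))"
    "bdd_meas (N1 \<Otimes>\<^sub>M N2) (\<lambda>(x, y). h x y * exp (h x y))"
    using bdd_meas_exp[OF assms(2)] bdd_meas_mult[OF assms(2) bdd_meas_exp[OF assms(2)]]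
    by (simp_all add: case_prod_unfold)
  show ?thesis unfolding ent_def
    by (intro bdd_meas_intros bdd_meas_integral'[OF assms(1)] * bdd_meas_ln_integral_exp[OF assms(1) bdd_meas_swap[OF assms(2)]])
qed

text \<open>Convexity of entropy, read off from its variational formula.\<close>

lemma ent_mixture:
  assumes N: "prob_space N1" "prob_space N2" and h: "bdd_meas (N1 \<Otimes>\<^sub>M N2) (\<lambda>(x, y). h x y)"
  shows "ent N1 (\<lambda>x. ln (\<integral>y. exp (h x y) \<partial>N2)) \<le> (\<integral>y. ent N1 (\<lambda>x. h x y) \<partial>N2)"
proof -
  define L where "L = (\<lambda>x. ln (\<integral>y. exp (h x y) \<partial>N2))"
  have L: "bdd_meas N1 L" unfolding L_def by (rule bdd_meas_ln_integral_exp[OF N(2) h])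
  have expL: "exp (L x) = (\<integral>y. exp (h x y) \<partial>N2)" if "x \<in> space N1" for x
    unfolding L_def using bdd_meas_integral_exp_pos[OF N(2) bdd_meas_section[OF h that]] by simp
  define m where "m = (\<integral>x. exp (L x) \<partial>N1)"
  have m: "m > 0" unfolding m_def by (intro bdd_meas_integral_exp_pos N L)
  \<comment> \<open>The optimal \<open>u\<close> for \<open>L\<close> in \<open>ent_duality\<close>,
    normalised so that \<open>exp u\<close> integrates to 1. For this fixed \<open>u\<close> the
    variational formula is linear in the density, and Fubini moves the average over \<open>y\<close>
    outside.\<close>
  define u where "u = (\<lambda>x. L x - ln m)"
  have u: "bdd_meas N1 u" unfolding u_def by (intro bdd_meas_intros L)
  have expu: "(\<integral>x. exp (u x) \<partial>N1) = 1"
  proof -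
    have "(\<integral>x. exp (u x) \<partial>N1) = (\<integral>x. exp (L x) / m \<partial>N1)"
      using m by (simp add: u_def exp_diff)
    then show ?thesis using m by (simp add: m_def)
  qed
  have hu: "bdd_meas (N1 \<Otimes>\<^sub>M N2) (\<lambda>(x, y). exp (h x y) * u x)"
    using bdd_meas_mult[OF bdd_meas_exp[OF h] bdd_meas_comp[OF u measurable_fst]] by (simp add: case_prod_unfold)
  have "ent N1 L = (\<integral>x. L x * exp (L x) - ln m * exp (L x) \<partial>N1)"
    unfolding ent_def m_def[symmetric]
    by (subst Bochner_Integration.integral_diff) (auto intro!: bdd_meas_integrable[OF N(1)] bdd_meas_intros L simp: m_def)
  also have "\<dots> = (\<integral>x. (\<integral>y. exp (h x y) * u x \<partial>N2) \<partial>N1)"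
  proof (intro Bochner_Integration.integral_cong refl)
    fix x assume "x \<in> space N1"
    then have "(\<integral>y. exp (h x y) * u x \<partial>N2) = exp (L x) * u x" by (simp add: expL)
    then show "L x * exp (L x) - ln m * exp (L x) = (\<integral>y. exp (h x y) * u x \<partial>N2)"
      by (simp add: u_def algebra_simps)
  qed
  also have "\<dots> = (\<integral>y. (\<integral>x. exp (h x y) * u x \<partial>N1) \<partial>N2)"
    by (rule bdd_meas_Fubini[OF N hu])
  also have "\<dots> \<le> (\<integral>y. ent N1 (\<lambda>x. h x y) \<partial>N2)"
  proof (rule bdd_meas_mono[OF N(2)])
    show "bdd_meas N2 (\<lambda>y. ent N1 (\<lambda>x. h x y))" by (rule bdd_meas_ent[OF N(1) h])
    show "bdd_meas N2 (\<lambda>y. \<integral>x. exp (h x y) * u x \<partial>N1)" by (rule bdd_meas_integral'[OF N(1) hu])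
    show "(\<integral>x. exp (h x y) * u x \<partial>N1) \<le> ent N1 (\<lambda>x. h x y)" if "y \<in> space N2" for y
      using ent_duality[OF N(1) bdd_meas_section[OF bdd_meas_swap[OF h] that] u] expu by simp
  qed
  finally show ?thesis by (simp add: L_def)
qed

section \<open>Coordinate updates on finite products, and tensorization\<close>

lemma bdd_meas_PiM_upd:
  assumes "bdd_meas (PiM (insert i I) M) h"
  shows "bdd_meas (PiM I M \<Otimes>\<^sub>M M i) (\<lambda>(x, y). h (x(i := y)))"
  using bdd_meas_comp[OF assms measurable_add_dim] by (simp add: case_prod_unfold)

lemma bdd_meas_PiM_upd_in:
  assumes "bdd_meas (PiM I M) h" "i \<in> I"
  shows "bdd_meas (PiM I M \<Otimes>\<^sub>M M i) (\<lambda>(x, y). h (x(i := y)))"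
  using bdd_meas_PiM_upd[of i I M h] assms by (simp add: insert_absorb)

lemma bdd_meas_PiM_insert:
  assumes M: "\<And>i. prob_space (M i)" and "finite I" "i \<notin> I" "bdd_meas (PiM (insert i I) M) h"
  shows "(\<integral>x. h x \<partial>PiM (insert i I) M) = (\<integral>x. (\<integral>y. h (x(i := y)) \<partial>M i) \<partial>PiM I M)"
proof -
  interpret product_sigma_finite M by (rule product_sigma_finite.intro) (rule prob_space_imp_sigma_finite[OF M])
  show ?thesis
    by (rule product_integral_insert[OF assms(2,3) bdd_meas_integrable[OF prob_space_PiM[where M=M and I="insert i I", OF M] assms(4)]])
qed

text \<open>Chain rule: integrating out coordinate \<open>j\<close> leaves a marginal with logarithm
  \<open>L\<close>, and the entropy splits into the mean entropy in coordinate \<open>j\<close> plus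
  the entropy of \<open>L\<close>. The induction hypothesis handles \<open>L\<close>; as
  \<open>exp L\<close> is a mixture, \<open>ent_mixture\<close> bounds its one-coordinate entropies
  by averages of those of \<open>h\<close>.\<close>

lemma ent_tensorization:
  assumes M: "\<And>i. prob_space (M i)" and "finite I" and "bdd_meas (PiM I M) h"
  shows "ent (PiM I M) h \<le> (\<Sum>i\<in>I. \<integral>x. ent (M i) (\<lambda>y. h (x(i := y))) \<partial>PiM I M)"
  using assms(2,3)
proof (induction I arbitrary: h rule: finite_induct)
  case empty
  have "h x = h (\<lambda>_. undefined)" if "x \<in> space (PiM {} M)" for x
    using that by (simp add: space_PiM)
  then have "ent (PiM {} M) h = ent (PiM {} M) (\<lambda>_. h (\<lambda>_. undefined))"
    unfolding ent_def
    by (intro arg_cong2[where f="(-)"] arg_cong2[where f="(*)"] arg_cong[where f=ln] Bochner_Integration.integral_cong refl)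
      (simp_all only:)
  then show ?case using prob_space.prob_space[OF prob_space_PiM[where M=M and I="{}", OF M]] by (simp add: ent_def)
next
  case (insert j I)
  note P = prob_space_PiM[where M=M and I=I, OF M]
  have h2: "bdd_meas (PiM I M \<Otimes>\<^sub>M M j) (\<lambda>(x, y). h (x(j := y)))" by (rule bdd_meas_PiM_upd) fact
  define L where "L = (\<lambda>x. ln (\<integral>y. exp (h (x(j := y))) \<partial>M j))"
  have L: "bdd_meas (PiM I M) L" unfolding L_def by (rule bdd_meas_ln_integral_exp[OF M h2])
  have expL: "exp (L x) = (\<integral>y. exp (h (x(j := y))) \<partial>M j)" if "x \<in> space (PiM I M)" for x
    unfolding L_def using bdd_meas_integral_exp_pos[OF M bdd_meas_section[OF h2 that]] by simp
  have lnL: "L x = ln (\<integral>y. exp (h (x(j := y))) \<partial>M j)" for x by (simp add: L_def)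
  note ins = bdd_meas_PiM_insert[of M, OF M insert(1,2)]
  note intI = bdd_meas_integrable[OF P]
  have bent: "bdd_meas (PiM I M) (\<lambda>x. ent (M j) (\<lambda>y. h (x(j := y))))"
    by (rule bdd_meas_ent[OF M bdd_meas_swap[OF h2]])
  have m: "(\<integral>x. exp (h x) \<partial>PiM (insert j I) M) = (\<integral>x. exp (L x) \<partial>PiM I M)"
    by (subst ins[OF bdd_meas_exp[OF insert(4)]]) (intro Bochner_Integration.integral_cong refl expL[symmetric])
  have entj: "ent (M j) (\<lambda>y. h (x(j := y))) = (\<integral>y. h (x(j := y)) * exp (h (x(j := y))) \<partial>M j) - L x * exp (L x)"
    if "x \<in> space (PiM I M)" for x
    unfolding ent_def using expL[OF that] by (simp add: lnL[symmetric])
  have "(\<integral>x. h x * exp (h x) \<partial>PiM (insert j I) M) = (\<integral>x. ent (M j) (\<lambda>y. h (x(j := y))) + L x * exp (L x) \<partial>PiM I M)"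
    by (subst ins[OF bdd_meas_mult[OF insert(4) bdd_meas_exp[OF insert(4)]]], intro Bochner_Integration.integral_cong refl)
      (simp only: entj diff_add_cancel)
  also have "\<dots> = (\<integral>x. ent (M j) (\<lambda>y. h (x(j := y))) \<partial>PiM I M) + (\<integral>x. L x * exp (L x) \<partial>PiM I M)"
    by (intro Bochner_Integration.integral_add intI bent bdd_meas_intros L)
  finally have chain: "ent (PiM (insert j I) M) h
      = (\<integral>x. ent (M j) (\<lambda>y. h (x(j := y))) \<partial>PiM I M) + ent (PiM I M) L"
    unfolding ent_def[of "PiM I M"] ent_def[of "PiM (insert j I) M"] m by simp
  \<comment> \<open>The integrand overwrites coordinate \<open>j\<close>, so integrating it over
    that coordinate as well changes nothing.\<close>
  have first: "(\<integral>x. ent (M j) (\<lambda>y. h (x(j := y))) \<partial>PiM I M)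
     = (\<integral>x. ent (M j) (\<lambda>y. h (x(j := y))) \<partial>PiM (insert j I) M)"
  proof (subst ins)
    show "bdd_meas (PiM (insert j I) M) (\<lambda>x. ent (M j) (\<lambda>y. h (x(j := y))))"
      by (rule bdd_meas_ent[OF M bdd_meas_swap[OF bdd_meas_PiM_upd_in[OF insert(4)]]]) simp
    show "(\<integral>x. ent (M j) (\<lambda>y. h (x(j := y))) \<partial>PiM I M) =
      (\<integral>x. (\<integral>z. ent (M j) (\<lambda>y. h (x(j := z, j := y))) \<partial>M j) \<partial>PiM I M)"
      unfolding fun_upd_upd using prob_space.prob_space[OF M] by (simp del: fun_upd_apply)
  qed
  have rest: "(\<integral>x. ent (M i) (\<lambda>y. L (x(i := y))) \<partial>PiM I M)
     \<le> (\<integral>x. ent (M i) (\<lambda>y. h (x(i := y))) \<partial>PiM (insert j I) M)" if i: "i \<in> I" for i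
  proof -
    have b: "bdd_meas (PiM (insert j I) M) (\<lambda>x. ent (M i) (\<lambda>y. h (x(i := y))))"
      by (rule bdd_meas_ent[OF M bdd_meas_swap[OF bdd_meas_PiM_upd_in[OF insert(4)]]]) (use i in simp)
    have ij: "i \<noteq> j" using i insert by auto
    have "(\<integral>x. ent (M i) (\<lambda>y. L (x(i := y))) \<partial>PiM I M)
      \<le> (\<integral>x. (\<integral>z. ent (M i) (\<lambda>y. h (x(j := z, i := y))) \<partial>M j) \<partial>PiM I M)"
    proof (rule bdd_meas_mono[OF P])
      show "bdd_meas (PiM I M) (\<lambda>x. ent (M i) (\<lambda>y. L (x(i := y))))"
        by (rule bdd_meas_ent[OF M bdd_meas_swap[OF bdd_meas_PiM_upd_in[OF L i]]])
      show "bdd_meas (PiM I M) (\<lambda>x. \<integral>z. ent (M i) (\<lambda>y. h (x(j := z, i := y))) \<partial>M j)"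
        by (rule bdd_meas_integral[OF M bdd_meas_PiM_upd[OF b]])
      fix x assume x: "x \<in> space (PiM I M)"
      have upd: "(\<lambda>y. x(i := y)) \<in> measurable (M i) (PiM I M)"
        using x i by (intro measurable_fun_upd[where J=I]) auto
      have "bdd_meas (M i \<Otimes>\<^sub>M M j) (\<lambda>(y, z). h (x(i := y, j := z)))"
        using bdd_meas_comp[OF h2 measurable_Pair[OF measurable_compose[OF measurable_fst upd] measurable_snd]]
        by (simp add: case_prod_unfold)
      from ent_mixture[OF M M this]
      show "ent (M i) (\<lambda>y. L (x(i := y))) \<le> (\<integral>z. ent (M i) (\<lambda>y. h (x(j := z, i := y))) \<partial>M j)"
        using ij by (simp add: L_def fun_upd_twist)
    qed
    also have "\<dots> = (\<integral>x. ent (M i) (\<lambda>y. h (x(i := y))) \<partial>PiM (insert j I) M)"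
      by (rule ins[OF b, symmetric])
    finally show ?thesis .
  qed
  show ?case unfolding chain first sum.insert[OF insert(1,2)]
    by (intro add_left_mono order_trans[OF insert.IH[OF L] sum_mono[OF rest]])
qed

section \<open>Laplace transforms and the Herbst argument\<close>

lemma exp_Taylor1_bound:
  fixes x :: real
  shows "\<bar>exp x - 1 - x\<bar> \<le> x\<^sup>2 * exp \<bar>x\<bar>"
proof -
  have 1: "1 + x \<le> exp x" by (rule exp_ge_add_one_self)
  have "1 - x \<le> exp (- x)" using exp_ge_add_one_self[of "-x"] by simp
  then have "(1 - x) * exp x \<le> 1" using mult_right_mono[of "1 - x" "exp (-x)" "exp x"] by (simp add: exp_minus)
  then have 2: "exp x - 1 \<le> x * exp x" by (simp add: algebra_simps)
  have "exp x - 1 - x \<le> x * (exp x - 1)" using 2 by (simp add: algebra_simps)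
  also have "\<dots> \<le> x\<^sup>2 * exp \<bar>x\<bar>"
  proof (cases "x \<ge> 0")
    case True
    then have "x * (exp x - 1) \<le> x * (x * exp x)" using 2 by (intro mult_left_mono)
    then show ?thesis using True by (simp add: power2_eq_square)
  next
    case False
    then have "x * (exp x - 1) \<le> x * x" by (intro mult_left_mono_neg) (use 1 in linarith)+
    also have "\<dots> \<le> x\<^sup>2 * exp \<bar>x\<bar>"
      using mult_left_mono[of 1 "exp \<bar>x\<bar>" "x\<^sup>2"] by (simp add: power2_eq_square)
    finally show ?thesis .
  qed
  finally show ?thesis using abs_of_nonneg[of "exp x - 1 - x"] 1 by linarith
qed

text \<open>Boundedness of \<open>Z\<close> makes the Taylor remainder of order
  \<open>h\<^sup>2\<close> uniformly in \<open>x\<close>, so the difference quotient is controlled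
  directly under the integral.\<close>

lemma has_derivative_integral_exp:
  assumes N: "prob_space N" and Z: "bdd_meas N Z"
  shows "((\<lambda>s. \<integral>x. exp (s * Z x) \<partial>N) has_real_derivative (\<integral>x. Z x * exp (s * Z x) \<partial>N)) (at s)"
proof -
  obtain B where B: "B \<ge> 0" "\<And>x. x \<in> space N \<Longrightarrow> \<bar>Z x\<bar> \<le> B" using bdd_measD[OF Z] by blast
  define m where "m = (\<lambda>s. \<integral>x. exp (s * Z x) \<partial>N)"
  define d where "d = (\<integral>x. Z x * exp (s * Z x) \<partial>N)"
  define C where "C = B\<^sup>2 * exp B * exp (\<bar>s\<bar> * B)"
  note int = bdd_meas_integrable[OF N]
  have bound: "\<bar>m (s + h) - m s - h * d\<bar> \<le> C * h\<^sup>2" if "\<bar>h\<bar> \<le> 1" for h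
  proof -
    have "m (s + h) - m s - h * d = (\<integral>x. exp ((s + h) * Z x) - exp (s * Z x) - h * (Z x * exp (s * Z x)) \<partial>N)"
      unfolding m_def d_def
      by (subst Bochner_Integration.integral_diff Bochner_Integration.integral_mult_right_zero,
          auto intro!: int bdd_meas_intros Z)+
    also have "\<dots> = (\<integral>x. exp (s * Z x) * (exp (h * Z x) - 1 - h * Z x) \<partial>N)"
      by (simp add: algebra_simps exp_add)
    also have "\<bar>\<dots>\<bar> \<le> C * h\<^sup>2"
    proof (rule bdd_meas_abs_integral_le[OF N])
      show "bdd_meas N (\<lambda>x. exp (s * Z x) * (exp (h * Z x) - 1 - h * Z x))" by (intro bdd_meas_intros Z)
      fix x assume x: "x \<in> space N"
      have "\<bar>s * Z x\<bar> \<le> \<bar>s\<bar> * B" using B(2)[OF x] by (simp add: abs_mult mult_left_mono)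
      then have "s * Z x \<le> \<bar>s\<bar> * B" by simp
      moreover have hB: "\<bar>h * Z x\<bar> \<le> B"
        using mult_mono[of "\<bar>h\<bar>" 1 "\<bar>Z x\<bar>" B] B x that by (simp add: abs_mult)
      moreover have "(h * Z x)\<^sup>2 \<le> h\<^sup>2 * B\<^sup>2"
        using power_mono[OF B(2)[OF x], of 2] by (simp add: power_mult_distrib mult_left_mono)
      ultimately have "exp (s * Z x) * ((h * Z x)\<^sup>2 * exp \<bar>h * Z x\<bar>) \<le> exp (\<bar>s\<bar> * B) * ((h\<^sup>2 * B\<^sup>2) * exp B)"
        by (intro mult_mono) auto
      moreover have "exp (s * Z x) * \<bar>exp (h * Z x) - 1 - h * Z x\<bar> \<le> exp (s * Z x) * ((h * Z x)\<^sup>2 * exp \<bar>h * Z x\<bar>)"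
        by (intro mult_left_mono exp_Taylor1_bound) auto
      ultimately have "exp (s * Z x) * \<bar>exp (h * Z x) - 1 - h * Z x\<bar>
          \<le> exp (\<bar>s\<bar> * B) * ((h\<^sup>2 * B\<^sup>2) * exp B)" by (rule order_trans[rotated])
      then show "\<bar>exp (s * Z x) * (exp (h * Z x) - 1 - h * Z x)\<bar> \<le> C * h\<^sup>2"
        unfolding abs_mult[of "exp (s * Z x)"] abs_exp_cancel by (simp add: C_def mult_ac)
    qed
    finally show ?thesis .
  qed
  have "((\<lambda>h. (m (s + h) - m s) / h) \<longlongrightarrow> d) (at 0)"
  proof (rule Lim_transform)
    show "((\<lambda>h. d) \<longlongrightarrow> d) (at 0)" by simp
    have "((\<lambda>h. (m (s + h) - m s) / h - d) \<longlongrightarrow> 0) (at 0)"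
    proof (rule Lim_null_comparison)
      show "((\<lambda>h. C * \<bar>h\<bar>) \<longlongrightarrow> 0) (at 0)" by (intro tendsto_eq_intros) auto
      show "\<forall>\<^sub>F h in at 0. norm ((m (s + h) - m s) / h - d) \<le> C * \<bar>h\<bar>"
        unfolding eventually_at
      proof (intro exI[of _ 1] conjI ballI impI)
        fix h :: real assume h: "h \<noteq> 0 \<and> dist h 0 < 1"
        then have "\<bar>(m (s + h) - m s) / h - d\<bar> = \<bar>m (s + h) - m s - h * d\<bar> / \<bar>h\<bar>"
          by (simp add: field_simps flip: abs_divide)
        also have "\<dots> \<le> C * h\<^sup>2 / \<bar>h\<bar>" using bound[of h] h by (intro divide_right_mono) auto
        also have "\<dots> = C * \<bar>h\<bar>" using h by (cases "h \<ge> 0") (auto simp: power2_eq_square)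
        finally show "norm ((m (s + h) - m s) / h - d) \<le> C * \<bar>h\<bar>" by simp
      qed simp
    qed
    then show "((\<lambda>h. (m (s + h) - m s) / h - d) \<longlongrightarrow> 0) (at 0)" .
  qed
  then show ?thesis by (simp add: DERIV_def m_def d_def)
qed

definition lmgf :: "'a measure \<Rightarrow> ('a \<Rightarrow> real) \<Rightarrow> real \<Rightarrow> real" where
  "lmgf N Z s = ln (\<integral>x. exp (s * Z x) \<partial>N)"

lemma lmgf_deriv:
  assumes N: "prob_space N" and Z: "bdd_meas N Z"
  shows "(lmgf N Z has_real_derivative (\<integral>x. Z x * exp (s * Z x) \<partial>N) / (\<integral>x. exp (s * Z x) \<partial>N)) (at s)"
  unfolding lmgf_def
  using bdd_meas_integral_exp_pos[OF N bdd_meas_mult[OF bdd_meas_const Z]]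
  by (auto intro!: derivative_eq_intros has_derivative_integral_exp[OF N Z])

text \<open>Since \<open>lmgf N Z 0 = 0\<close>, the quotient is the difference quotient at 0. It
  supplies the boundary value from which the differential inequalities below are integrated.\<close>

lemma lmgf_quotient_tendsto:
  assumes N: "prob_space N" and Z: "bdd_meas N Z"
  shows "((\<lambda>s. lmgf N Z s / s) \<longlongrightarrow> (\<integral>x. Z x \<partial>N)) (at_right 0)"
proof -
  have "(lmgf N Z has_real_derivative (\<integral>x. Z x \<partial>N)) (at 0)"
    using lmgf_deriv[OF N Z, of 0] prob_space.prob_space[OF N] by simp
  then have "((\<lambda>s. lmgf N Z s / s) \<longlongrightarrow> (\<integral>x. Z x \<partial>N)) (at 0)"
    using prob_space.prob_space[OF N] by (simp add: DERIV_def lmgf_def)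
  then show ?thesis by (rule tendsto_mono[rotated]) (simp add: at_le)
qed

text \<open>Divided by \<open>s\<^sup>2\<close> and by the moment generating function, this entropy
  is the derivative of \<open>lmgf N Z s / s\<close>; an entropy bound thus becomes a differential
  inequality.\<close>

lemma ent_eq_lmgf:
  "ent N (\<lambda>x. s * Z x) = s * (\<integral>x. Z x * exp (s * Z x) \<partial>N) - (\<integral>x. exp (s * Z x) \<partial>N) * lmgf N Z s"
  unfolding ent_def lmgf_def by (simp add: mult.assoc)

lemma decreasing_le_limit:
  fixes \<phi> \<phi>' :: "real \<Rightarrow> real"
  assumes l: "0 < l" and lim: "(\<phi> \<longlongrightarrow> c) (at_right 0)"
    and d: "\<And>s. 0 < s \<Longrightarrow> s \<le> l \<Longrightarrow> (\<phi> has_real_derivative \<phi>' s) (at s)"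
    and le: "\<And>s. 0 < s \<Longrightarrow> s \<le> l \<Longrightarrow> \<phi>' s \<le> 0"
  shows "\<phi> l \<le> c"
proof (rule tendsto_lowerbound[OF lim])
  have "\<phi> l \<le> \<phi> s" if "0 < s" "s < l" for s
    using that by (intro DERIV_nonpos_imp_nonincreasing[of s l]) (use d le in force)+
  then show "\<forall>\<^sub>F s in at_right 0. \<phi> l \<le> \<phi> s"
    using l by (intro eventually_at_rightI[of 0 l]) auto
qed simp

text \<open>The hypothesis bounds the derivative of \<open>lmgf N Z s / s\<close> by
  \<open>C\<close>, so \<open>lmgf N Z s / s - C * s\<close> never rises above its limit at 0, the
  mean.\<close>

lemma herbst:
  assumes N: "prob_space N" and Z: "bdd_meas N Z" and l: "0 < l"
    and E: "\<And>s. 0 < s \<Longrightarrow> s \<le> l \<Longrightarrow> ent N (\<lambda>x. s * Z x) \<le> C * s\<^sup>2 * (\<integral>x. exp (s * Z x) \<partial>N)"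
  shows "lmgf N Z l \<le> l * (\<integral>x. Z x \<partial>N) + C * l\<^sup>2"
proof -
  define m where "m = (\<lambda>s. \<integral>x. exp (s * Z x) \<partial>N)"
  define d where "d = (\<lambda>s. \<integral>x. Z x * exp (s * Z x) \<partial>N)"
  have m: "m s > 0" for s unfolding m_def by (intro bdd_meas_integral_exp_pos N bdd_meas_intros Z)
  have "lmgf N Z l / l - C * l \<le> (\<integral>x. Z x \<partial>N)"
  proof (rule decreasing_le_limit[OF l])
    show "((\<lambda>s. lmgf N Z s / s - C * s) \<longlongrightarrow> (\<integral>x. Z x \<partial>N)) (at_right 0)"
      by (rule tendsto_eq_intros lmgf_quotient_tendsto[OF N Z] tendsto_ident_at | simp)+
    fix s :: real assume s: "0 < s" "s \<le> l"
    show "((\<lambda>s. lmgf N Z s / s - C * s) has_real_derivative (d s / m s * s - lmgf N Z s) / (s * s) - C) (at s)"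
      using s by (auto intro!: derivative_eq_intros lmgf_deriv[OF N Z] simp: m_def d_def)
    have "s * d s - m s * lmgf N Z s \<le> C * s\<^sup>2 * m s"
      using E[OF s] by (simp add: ent_eq_lmgf m_def d_def)
    then have "(s * d s - m s * lmgf N Z s) / m s \<le> C * s\<^sup>2" using m[of s] by (simp add: field_simps)
    then have "d s / m s * s - lmgf N Z s \<le> C * s\<^sup>2" using m[of s] by (simp add: field_simps)
    then show "(d s / m s * s - lmgf N Z s) / (s * s) - C \<le> 0"
      using s by (simp add: field_simps power2_eq_square)
  qed
  then show ?thesis using l by (simp add: field_simps power2_eq_square)
qed

text \<open>The integral on the right, divided by the moment generating function, is the derivative
  of \<open>lmgf\<close> itself. Hence \<open>lmgf N W s / s - lmgf N W s / 2\<close> is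
  nonincreasing; \<open>l < 2\<close> makes the factor \<open>1 - l / 2\<close> positive.\<close>

lemma herbst_self_bounding:
  assumes N: "prob_space N" and W: "bdd_meas N W" and l: "0 < l" "l < 2"
    and E: "\<And>s. 0 < s \<Longrightarrow> s \<le> l \<Longrightarrow> ent N (\<lambda>x. s * W x) \<le> s\<^sup>2 / 2 * (\<integral>x. W x * exp (s * W x) \<partial>N)"
  shows "lmgf N W l \<le> l / (1 - l / 2) * (\<integral>x. W x \<partial>N)"
proof -
  define m where "m = (\<lambda>s. \<integral>x. exp (s * W x) \<partial>N)"
  define d where "d = (\<lambda>s. \<integral>x. W x * exp (s * W x) \<partial>N)"
  have m: "m s > 0" for s unfolding m_def by (intro bdd_meas_integral_exp_pos N bdd_meas_intros W)
  have "lmgf N W l / l * (1 - l / 2) \<le> (\<integral>x. W x \<partial>N)"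
  proof (rule decreasing_le_limit[OF l(1)])
    show "((\<lambda>s. lmgf N W s / s * (1 - s / 2)) \<longlongrightarrow> (\<integral>x. W x \<partial>N)) (at_right 0)"
      by (rule tendsto_eq_intros lmgf_quotient_tendsto[OF N W] tendsto_ident_at | simp)+
    fix s :: real assume s: "0 < s" "s \<le> l"
    have "((\<lambda>s. lmgf N W s / s) has_real_derivative (d s / m s * s - lmgf N W s) / (s * s)) (at s)"
      using s by (auto intro!: derivative_eq_intros lmgf_deriv[OF N W] simp: m_def d_def)
    moreover have "((\<lambda>s. 1 - s / 2) has_real_derivative - (1 / 2)) (at s)"
      by (auto intro!: derivative_eq_intros)
    ultimately show "((\<lambda>s. lmgf N W s / s * (1 - s / 2)) has_real_derivative
        (d s / m s * s - lmgf N W s) / (s * s) * (1 - s / 2) + lmgf N W s / s * (- (1 / 2))) (at s)"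
      using DERIV_mult by (fastforce simp: mult.commute)
    have "s * d s - m s * lmgf N W s \<le> s\<^sup>2 / 2 * d s"
      using E[OF s] by (simp add: ent_eq_lmgf m_def d_def)
    then have "(s * d s - m s * lmgf N W s) / m s \<le> (s\<^sup>2 / 2 * d s) / m s"
      using m[of s] by (intro divide_right_mono) auto
    then have "d s / m s * s - lmgf N W s \<le> s\<^sup>2 / 2 * (d s / m s)" using m[of s] by (simp add: field_simps)
    then have "(d s / m s * s - lmgf N W s - s\<^sup>2 / 2 * (d s / m s)) / (s * s) \<le> 0"
      using s by (simp add: divide_nonpos_pos)
    moreover have "(q * s - L) / (s * s) * (1 - s / 2) + L / s * (- (1 / 2))
      = (q * s - L - s\<^sup>2 / 2 * q) / (s * s)" for q L
      using s by (simp add: field_simps power2_eq_square)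
    ultimately show "(d s / m s * s - lmgf N W s) / (s * s) * (1 - s / 2) + lmgf N W s / s * (- (1 / 2)) \<le> 0"
      by (simp only:)
  qed
  then show ?thesis using l by (simp add: field_simps)
qed

section \<open>Entropy bounds on product spaces\<close>

lemma MAX_leI:
  fixes g :: "'q \<Rightarrow> real"
  shows "finite F \<Longrightarrow> F \<noteq> {} \<Longrightarrow> (\<And>q. q \<in> F \<Longrightarrow> g q \<le> B) \<Longrightarrow> (MAX q\<in>F. g q) \<le> B"
  by (subst Max_le_iff) auto

lemma MAX_geI:
  fixes g :: "'q \<Rightarrow> real"
  shows "finite F \<Longrightarrow> q \<in> F \<Longrightarrow> g q \<le> (MAX q\<in>F. g q)"
  by (intro Max_ge) auto

lemma MAX_attained:
  fixes g :: "'q \<Rightarrow> real"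
  assumes "finite F" "F \<noteq> {}"
  obtains q where "q \<in> F" "(MAX q\<in>F. g q) = g q"
proof -
  have "Max (g ` F) \<in> g ` F" using assms by (intro Max_in) auto
  then show thesis using that by auto
qed

lemma MAX_mono:
  fixes g h :: "'q \<Rightarrow> real"
  assumes "finite F" "F \<noteq> {}" "\<And>q. q \<in> F \<Longrightarrow> g q \<le> h q"
  shows "(MAX q\<in>F. g q) \<le> (MAX q\<in>F. h q)"
  by (rule MAX_leI[OF assms(1,2)]) (meson assms(1,3) MAX_geI order_trans)

lemma MAX_integral_le:
  fixes g :: "'q \<Rightarrow> 'a \<Rightarrow> real"
  assumes "finite F" "F \<noteq> {}" "prob_space N" "\<And>q. q \<in> F \<Longrightarrow> bdd_meas N (g q)"
  shows "(MAX q\<in>F. \<integral>x. g q x \<partial>N) \<le> (\<integral>x. (MAX q\<in>F. g q x) \<partial>N)"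
  using assms by (intro MAX_leI bdd_meas_mono bdd_meas_Max MAX_geI) auto

lemma bdd_meas_integral_add_const:
  assumes "prob_space N" "bdd_meas N g" shows "(\<integral>x. b + g x \<partial>N) = b + (\<integral>x. g x \<partial>N)"
  using prob_space.prob_space[OF assms(1)]
  by (subst Bochner_Integration.integral_add) (auto intro!: bdd_meas_integrable assms)

text \<open>Once coordinate \<open>i\<close> is split off, both sides are the same iterated
  integral, because the later update overwrites the earlier one. It returns bounds on sections to
  integrals over the product.\<close>

lemma bdd_meas_resample:
  assumes M: "\<And>i. prob_space (M i)" and I: "finite I" "i \<in> I" and h: "bdd_meas (PiM I M) h"
  shows "(\<integral>x. (\<integral>y. h (x(i := y)) \<partial>M i) \<partial>PiM I M) = (\<integral>x. h x \<partial>PiM I M)"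
proof -
  have ii: "insert i (I - {i}) = I" using I by auto
  have f: "finite (I - {i})" "i \<notin> I - {i}" using I by auto
  note ins = bdd_meas_PiM_insert[of M, OF M f, unfolded ii]
  have b: "bdd_meas (PiM I M) (\<lambda>x. \<integral>y. h (x(i := y)) \<partial>M i)"
    by (rule bdd_meas_integral[OF M bdd_meas_PiM_upd_in[OF h I(2)]])
  show ?thesis
    unfolding ins[OF b] ins[OF h] fun_upd_upd
    using prob_space.prob_space[OF M] by (simp del: fun_upd_apply)
qed

section \<open>Elementary exponential inequalities, and entropy in one coordinate\<close>

lemma exp_mult_minus_le:
  fixes u b :: real
  assumes "u \<le> b" "0 \<le> b"
  shows "1 + (u - 1) * exp u \<le> u\<^sup>2 / 2 * exp b"
proof -
  \<comment> \<open>The derivative of the gap is \<open>u * (exp b - exp u)\<close>, which follows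
    the sign of \<open>u\<close> as long as \<open>u \<le> b\<close>; so the gap is least at 0,
    where it vanishes. The expression \<open>1 + (u - 1) * exp u\<close> is what the integrand of
    \<open>ent_le\<close> leaves once \<open>exp c\<close> is factored out.\<close>
  define h where "h = (\<lambda>u. u\<^sup>2 / 2 * exp b - (1 + (u - 1) * exp u) :: real)"
  have d: "(h has_real_derivative (u * (exp b - exp u))) (at u)" for u
    unfolding h_def by (auto intro!: derivative_eq_intros simp: algebra_simps)
  have "h 0 \<le> h u"
  proof (cases "u \<ge> 0")
    case True
    show ?thesis
    proof (rule DERIV_nonneg_imp_nondecreasing[OF True])
      fix x assume "0 \<le> x" "x \<le> u"
      then show "\<exists>y. (h has_real_derivative y) (at x) \<and> 0 \<le> y"
        using assms d by (intro exI[of _ "x * (exp b - exp x)"]) auto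
    qed
  next
    case False
    show ?thesis
    proof (rule DERIV_nonpos_imp_nonincreasing[of u 0 h])
      show "u \<le> 0" using False by simp
      fix x assume "u \<le> x" "x \<le> 0"
      then show "\<exists>y. (h has_real_derivative y) (at x) \<and> y \<le> 0"
        using assms d by (intro exI[of _ "x * (exp b - exp x)"]) (auto intro!: mult_nonpos_nonneg)
    qed
  qed
  then show ?thesis by (simp add: h_def)
qed

lemma exp_minus_le_quadratic:
  fixes u :: real
  assumes "u \<ge> 0"
  shows "exp (- u) \<le> 1 - u + u\<^sup>2 / 2"
proof -
  have p: "0 < 1 + u + u\<^sup>2 / 2" using assms by (simp add: add_pos_nonneg)
  have "exp (- u) = inverse (exp u)" by (rule exp_minus)
  also have "\<dots> \<le> inverse (1 + u + u\<^sup>2 / 2)"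
    using exp_lower_Taylor_quadratic[OF assms] p by (intro le_imp_inverse_le)
  also have "\<dots> \<le> 1 - u + u\<^sup>2 / 2"
  proof -
    have "(1 - u + u\<^sup>2 / 2) * (1 + u + u\<^sup>2 / 2) = 1 + u ^ 4 / 4"
      by (simp add: algebra_simps power2_eq_square power4_eq_xxxx)
    then have "1 \<le> (1 - u + u\<^sup>2 / 2) * (1 + u + u\<^sup>2 / 2)" by simp
    then show ?thesis using p by (simp add: inverse_eq_divide divide_le_eq)
  qed
  finally show ?thesis .
qed

text \<open>The variance is half the mean squared difference of two independent copies, and by
  symmetry the two positive parts contribute equally. One-sided differences suit a maximum: its
  maximiser controls how far it can fall, not how far it can rise.\<close>

lemma integral_pos_part_diff_sq:
  assumes N: "prob_space N" and Z: "bdd_meas N Z"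
  shows "(\<integral>x. (Z x - (\<integral>y. Z y \<partial>N))\<^sup>2 \<partial>N) = (\<integral>x. (\<integral>y. (max 0 (Z x - Z y))\<^sup>2 \<partial>N) \<partial>N)"
proof -
  interpret prob_space N by fact
  define c where "c = (\<integral>y. Z y \<partial>N)"
  define T where "T = (\<integral>y. (Z y)\<^sup>2 \<partial>N)"
  note int = bdd_meas_integrable[OF N]
  have Z1: "bdd_meas (N \<Otimes>\<^sub>M N) (\<lambda>z. Z (fst z))" and Z2: "bdd_meas (N \<Otimes>\<^sub>M N) (\<lambda>z. Z (snd z))"
    by (auto intro!: bdd_meas_comp[OF Z])
  have b: "bdd_meas (N \<Otimes>\<^sub>M N) (\<lambda>(x, y). (max 0 (Z x - Z y))\<^sup>2)"
    unfolding case_prod_unfold by (intro bdd_meas_intros Z1 Z2)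
  have b': "bdd_meas (N \<Otimes>\<^sub>M N) (\<lambda>(x, y). (max 0 (Z y - Z x))\<^sup>2)"
    unfolding case_prod_unfold by (intro bdd_meas_intros Z1 Z2)
  have "(\<integral>y. (Z x - Z y)\<^sup>2 \<partial>N) = (Z x)\<^sup>2 - 2 * Z x * c + T" for x
  proof -
    have "(\<integral>y. (Z x - Z y)\<^sup>2 \<partial>N) = (\<integral>y. (Z x)\<^sup>2 - 2 * Z x * Z y + (Z y)\<^sup>2 \<partial>N)"
      by (simp add: power2_diff algebra_simps)
    also have "\<dots> = (Z x)\<^sup>2 - 2 * Z x * c + T"
      unfolding c_def T_def using Z by (simp add: int bdd_meas_intros prob_space)
    finally show ?thesis .
  qed
  then have "(\<integral>x. (\<integral>y. (Z x - Z y)\<^sup>2 \<partial>N) \<partial>N) = (\<integral>x. (Z x)\<^sup>2 - 2 * c * Z x + T \<partial>N)"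
    by (simp add: mult_ac)
  also have "\<dots> = T - 2 * c * c + T"
    using Z by (simp add: int bdd_meas_intros prob_space T_def[symmetric] c_def[symmetric])
  also have "\<dots> = 2 * (T - c\<^sup>2)" by (simp add: power2_eq_square)
  finally have 1: "(\<integral>x. (\<integral>y. (Z x - Z y)\<^sup>2 \<partial>N) \<partial>N) = 2 * (T - c\<^sup>2)" .
  have "(\<integral>x. (Z x - c)\<^sup>2 \<partial>N) = (\<integral>x. (Z x)\<^sup>2 - 2 * c * Z x + c\<^sup>2 \<partial>N)"
    by (simp add: power2_diff algebra_simps)
  also have "\<dots> = T - 2 * c * c + c\<^sup>2"
    using Z by (simp add: int bdd_meas_intros prob_space T_def[symmetric] c_def[symmetric])
  also have "\<dots> = T - c\<^sup>2" by (simp add: power2_eq_square)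
  finally have 2: "(\<integral>x. (Z x - c)\<^sup>2 \<partial>N) = T - c\<^sup>2" .
  have sq: "(Z x - Z y)\<^sup>2 = (max 0 (Z x - Z y))\<^sup>2 + (max 0 (Z y - Z x))\<^sup>2" for x y
    by (cases "Z x \<le> Z y") (auto simp: max_def power2_commute)
  have "(\<integral>x. (\<integral>y. (Z x - Z y)\<^sup>2 \<partial>N) \<partial>N)
    = (\<integral>x. (\<integral>y. (max 0 (Z x - Z y))\<^sup>2 \<partial>N) + (\<integral>y. (max 0 (Z y - Z x))\<^sup>2 \<partial>N) \<partial>N)"
    unfolding sq using Z by (simp add: int bdd_meas_intros)
  also have "\<dots> = (\<integral>x. (\<integral>y. (max 0 (Z x - Z y))\<^sup>2 \<partial>N) \<partial>N) + (\<integral>x. (\<integral>y. (max 0 (Z y - Z x))\<^sup>2 \<partial>N) \<partial>N)"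
    by (intro Bochner_Integration.integral_add int bdd_meas_integral[OF N b] bdd_meas_integral[OF N b'])
  also have "(\<integral>x. (\<integral>y. (max 0 (Z y - Z x))\<^sup>2 \<partial>N) \<partial>N) = (\<integral>x. (\<integral>y. (max 0 (Z x - Z y))\<^sup>2 \<partial>N) \<partial>N)"
    by (rule bdd_meas_Fubini[OF N N b'])
  finally show ?thesis using 1 2 by (simp add: c_def)
qed

text \<open>
  Centring at the mean, rather than at an independent copy, gains the factor 2 (as \<open>s\<close> tends to 0)
  without which the peeling constants would not suffice.
\<close>

lemma ent_le_pos_part:
  assumes N: "prob_space N" and Z: "bdd_meas N Z" and s: "0 < s"
    and osc: "\<And>x y. x \<in> space N \<Longrightarrow> y \<in> space N \<Longrightarrow> Z x - Z y \<le> 1"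
  shows "ent N (\<lambda>x. s * Z x) \<le> s\<^sup>2 / 2 * exp (2 * s) *
    (\<integral>x. exp (s * Z x) * (\<integral>y. (max 0 (Z x - Z y))\<^sup>2 \<partial>N) \<partial>N)"
proof -
  interpret prob_space N by fact
  define c where "c = (\<integral>y. Z y \<partial>N)"
  define V where "V = (\<lambda>x. \<integral>y. (max 0 (Z x - Z y))\<^sup>2 \<partial>N)"
  note int = bdd_meas_integrable[OF N]
  have Z1: "bdd_meas (N \<Otimes>\<^sub>M N) (\<lambda>z. Z (fst z))" and Z2: "bdd_meas (N \<Otimes>\<^sub>M N) (\<lambda>z. Z (snd z))"
    by (auto intro!: bdd_meas_comp[OF Z])
  have b: "bdd_meas (N \<Otimes>\<^sub>M N) (\<lambda>(x, y). (max 0 (Z x - Z y))\<^sup>2)"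
    unfolding case_prod_unfold by (intro bdd_meas_intros Z1 Z2)
  have V: "bdd_meas N V" unfolding V_def by (rule bdd_meas_integral[OF N b])
  have V0: "V x \<ge> 0" for x unfolding V_def by (intro Bochner_Integration.integral_nonneg) simp
  have c1: "Z x - c \<le> 1" and c2: "c - Z x \<le> 1" if "x \<in> space N" for x
  proof -
    have "Z x - c = (\<integral>y. Z x - Z y \<partial>N)" "c - Z x = (\<integral>y. Z y - Z x \<partial>N)"
      unfolding c_def using Z by (simp_all add: int bdd_meas_intros prob_space)
    moreover have "(\<integral>y. Z x - Z y \<partial>N) \<le> 1" "(\<integral>y. Z y - Z x \<partial>N) \<le> 1"
      using osc that by (intro integral_le_const int bdd_meas_intros Z AE_I2; simp)+
    ultimately show "Z x - c \<le> 1" "c - Z x \<le> 1" by simp_all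
  qed
  \<comment> \<open>With \<open>c\<close> the mean, \<open>ent_le\<close> followed by
    \<open>exp_mult_minus_le\<close> at \<open>b = s\<close> produces the variance, with the weight
    \<open>exp s * exp (s * c)\<close>.\<close>
  have "ent N (\<lambda>x. s * Z x) \<le> (\<integral>x. exp (s * Z x) * (s * Z x - s * c) - exp (s * Z x) + exp (s * c) \<partial>N)"
    by (intro ent_le N bdd_meas_intros Z)
  also have "\<dots> \<le> (\<integral>x. s\<^sup>2 / 2 * exp s * exp (s * c) * (Z x - c)\<^sup>2 \<partial>N)"
  proof (rule bdd_meas_mono[OF N])
    show "bdd_meas N (\<lambda>x. exp (s * Z x) * (s * Z x - s * c) - exp (s * Z x) + exp (s * c))"
      "bdd_meas N (\<lambda>x. s\<^sup>2 / 2 * exp s * exp (s * c) * (Z x - c)\<^sup>2)"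
      by (intro bdd_meas_intros Z)+
    fix x assume x: "x \<in> space N"
    define u where "u = s * (Z x - c)"
    have "u \<le> s" using c1[OF x] s by (simp add: u_def mult_left_le)
    then have "1 + (u - 1) * exp u \<le> u\<^sup>2 / 2 * exp s"
      using s by (intro exp_mult_minus_le) auto
    then have "exp (s * c) * (1 + (u - 1) * exp u) \<le> exp (s * c) * (u\<^sup>2 / 2 * exp s)"
      by (intro mult_left_mono) auto
    moreover have "exp (s * Z x) = exp (s * c) * exp u" "s * Z x - s * c = u"
      by (simp_all add: exp_add[symmetric] algebra_simps u_def)
    moreover have "s\<^sup>2 / 2 * exp s * exp (s * c) * (Z x - c)\<^sup>2 = exp (s * c) * (u\<^sup>2 / 2 * exp s)"
      by (simp add: u_def power_mult_distrib)
    ultimately show "exp (s * Z x) * (s * Z x - s * c) - exp (s * Z x) + exp (s * c)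
        \<le> s\<^sup>2 / 2 * exp s * exp (s * c) * (Z x - c)\<^sup>2"
      by (simp add: algebra_simps)
  qed
  also have "\<dots> = s\<^sup>2 / 2 * exp s * exp (s * c) * (\<integral>x. V x \<partial>N)"
    using integral_pos_part_diff_sq[OF N Z] by (simp add: c_def V_def)
  also have "\<dots> = (\<integral>x. s\<^sup>2 / 2 * exp s * exp (s * c) * V x \<partial>N)" by simp
  \<comment> \<open>The constant weight \<open>exp (s * c)\<close> has to become
    \<open>exp (s * Z x)\<close>, a function of the point that is common to all coordinates. As the
    mean exceeds \<open>Z x\<close> by at most 1, this costs a second factor
    \<open>exp s\<close>.\<close>
  also have "\<dots> \<le> (\<integral>x. s\<^sup>2 / 2 * exp (2 * s) * (exp (s * Z x) * V x) \<partial>N)"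
  proof (rule bdd_meas_mono[OF N])
    fix x assume x: "x \<in> space N"
    have "s * c \<le> s + s * Z x" using mult_left_mono[OF c2[OF x], of s] s by (simp add: algebra_simps)
    then have "exp (s * c) \<le> exp s * exp (s * Z x)" by (simp add: exp_add[symmetric])
    then have "(s\<^sup>2 / 2 * exp s * V x) * exp (s * c) \<le> (s\<^sup>2 / 2 * exp s * V x) * (exp s * exp (s * Z x))"
      using V0[of x] by (intro mult_left_mono) auto
    moreover have "exp (2 * s) = exp s * exp s" by (simp add: exp_add[symmetric])
    ultimately show "s\<^sup>2 / 2 * exp s * exp (s * c) * V x \<le> s\<^sup>2 / 2 * exp (2 * s) * (exp (s * Z x) * V x)"
      by (simp add: mult_ac)
  qed (intro bdd_meas_intros V Z)+
  finally show ?thesis by (simp add: V_def)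
qed

section \<open>Entropy bounds assembled from single coordinates\<close>

lemma upd_space_PiM: "x \<in> space (PiM I M) \<Longrightarrow> i \<in> I \<Longrightarrow> y \<in> space (M i) \<Longrightarrow> x(i := y) \<in> space (PiM I M)"
  by (auto simp: space_PiM PiE_def extensional_def Pi_def)

lemma bdd_meas_upd: "x \<in> space (PiM I M) \<Longrightarrow> i \<in> I \<Longrightarrow> bdd_meas (PiM I M) h \<Longrightarrow> bdd_meas (M i) (\<lambda>y. h (x(i := y)))"
  by (rule bdd_meas_section[OF bdd_meas_PiM_upd_in])

text \<open>Common frame of the next two bounds: the entropy in each coordinate only needs a
  majorant averaged over that coordinate, and after resampling only the sum of the majorants at a
  single point matters.\<close>

lemma bdd_meas_tensor_bound:
  assumes M: "\<And>i. prob_space (M i)" and I: "finite I" and h: "bdd_meas (PiM I M) h"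
    and \<phi>: "\<And>i. i \<in> I \<Longrightarrow> bdd_meas (PiM I M) (\<phi> i)" and \<psi>: "bdd_meas (PiM I M) \<psi>"
    and le: "\<And>i x. i \<in> I \<Longrightarrow> x \<in> space (PiM I M) \<Longrightarrow> ent (M i) (\<lambda>y. h (x(i := y))) \<le> (\<integral>y. \<phi> i (x(i := y)) \<partial>M i)"
    and sum: "\<And>x. x \<in> space (PiM I M) \<Longrightarrow> (\<Sum>i\<in>I. \<phi> i x) \<le> \<psi> x"
  shows "ent (PiM I M) h \<le> (\<integral>x. \<psi> x \<partial>PiM I M)"
proof -
  note P = prob_space_PiM[where M=M and I=I, OF M]
  have "ent (PiM I M) h \<le> (\<Sum>i\<in>I. \<integral>x. ent (M i) (\<lambda>y. h (x(i := y))) \<partial>PiM I M)"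
    by (rule ent_tensorization[OF M I h])
  also have "\<dots> \<le> (\<Sum>i\<in>I. \<integral>x. \<phi> i x \<partial>PiM I M)"
  proof (rule sum_mono)
    fix i assume i: "i \<in> I"
    have "(\<integral>x. ent (M i) (\<lambda>y. h (x(i := y))) \<partial>PiM I M) \<le> (\<integral>x. (\<integral>y. \<phi> i (x(i := y)) \<partial>M i) \<partial>PiM I M)"
      by (intro bdd_meas_mono[OF P] le[OF i] bdd_meas_ent[OF M bdd_meas_swap[OF bdd_meas_PiM_upd_in[OF h i]]]
        bdd_meas_integral[OF M bdd_meas_PiM_upd_in[OF \<phi>[OF i] i]])
    also have "\<dots> = (\<integral>x. \<phi> i x \<partial>PiM I M)" by (rule bdd_meas_resample[OF M I i \<phi>[OF i]])
    finally show "(\<integral>x. ent (M i) (\<lambda>y. h (x(i := y))) \<partial>PiM I M) \<le> (\<integral>x. \<phi> i x \<partial>PiM I M)" .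
  qed
  also have "\<dots> = (\<integral>x. (\<Sum>i\<in>I. \<phi> i x) \<partial>PiM I M)"
    by (subst Bochner_Integration.integral_sum) (auto intro: bdd_meas_integrable[OF P] \<phi>)
  also have "\<dots> \<le> (\<integral>x. \<psi> x \<partial>PiM I M)"
    by (intro bdd_meas_mono[OF P] bdd_meas_sum \<phi> \<psi> sum)
  finally show ?thesis .
qed

text \<open>In \<open>ent_le_pos_part\<close> the weight \<open>exp (s * Z x)\<close> is the same
  for every coordinate, so the squared decreases can be summed before they are bounded by
  \<open>V\<close>.\<close>

lemma ent_le_Efron_Stein:
  assumes M: "\<And>i. prob_space (M i)" and I: "finite I" and Z: "bdd_meas (PiM I M) Z" and V: "bdd_meas (PiM I M) V"
    and s: "0 < s"
    and osc: "\<And>i x y. i \<in> I \<Longrightarrow> x \<in> space (PiM I M) \<Longrightarrow> y \<in> space (M i) \<Longrightarrow> Z x - Z (x(i := y)) \<le> 1"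
    and le: "\<And>x. x \<in> space (PiM I M) \<Longrightarrow> (\<Sum>i\<in>I. \<integral>y. (max 0 (Z x - Z (x(i := y))))\<^sup>2 \<partial>M i) \<le> V x"
  shows "ent (PiM I M) (\<lambda>x. s * Z x) \<le> s\<^sup>2 / 2 * exp (2 * s) * (\<integral>x. exp (s * Z x) * V x \<partial>PiM I M)"
proof -
  define K where "K = s\<^sup>2 / 2 * exp (2 * s)"
  have K: "K \<ge> 0" by (simp add: K_def)
  define \<phi> where "\<phi> = (\<lambda>i x. K * (exp (s * Z x) * (\<integral>y. (max 0 (Z x - Z (x(i := y))))\<^sup>2 \<partial>M i)))"
  have "ent (PiM I M) (\<lambda>x. s * Z x) \<le> (\<integral>x. K * (exp (s * Z x) * V x) \<partial>PiM I M)"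
  proof (rule bdd_meas_tensor_bound[OF M I, where \<phi>=\<phi>])
    show "bdd_meas (PiM I M) (\<phi> i)" if i: "i \<in> I" for i
    proof -
      have "bdd_meas (PiM I M \<Otimes>\<^sub>M M i) (\<lambda>(x, y). (max 0 (Z x - Z (x(i := y))))\<^sup>2)"
        unfolding case_prod_unfold
        using bdd_meas_comp[OF Z measurable_fst] bdd_meas_PiM_upd_in[OF Z i, unfolded case_prod_unfold]
        by (intro bdd_meas_intros) auto
      then show ?thesis unfolding \<phi>_def by (intro bdd_meas_intros Z bdd_meas_integral[OF M])
    qed
    show "ent (M i) (\<lambda>y. s * Z (x(i := y))) \<le> (\<integral>y. \<phi> i (x(i := y)) \<partial>M i)"
      if i: "i \<in> I" and x: "x \<in> space (PiM I M)" for i x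
    proof -
      have "Z (x(i := y)) - Z (x(i := z)) \<le> 1" if "y \<in> space (M i)" "z \<in> space (M i)" for y z
        using osc[OF i upd_space_PiM[OF x i that(1)] that(2)] by (simp add: fun_upd_upd)
      from ent_le_pos_part[OF M bdd_meas_upd[OF x i Z] s this]
      show ?thesis by (simp add: \<phi>_def K_def fun_upd_upd del: fun_upd_apply)
    qed
    show "(\<Sum>i\<in>I. \<phi> i x) \<le> K * (exp (s * Z x) * V x)" if "x \<in> space (PiM I M)" for x
    proof -
      have "(\<Sum>i\<in>I. \<phi> i x) = K * exp (s * Z x) * (\<Sum>i\<in>I. \<integral>y. (max 0 (Z x - Z (x(i := y))))\<^sup>2 \<partial>M i)"
        by (simp add: \<phi>_def sum_distrib_left mult.assoc)
      also have "\<dots> \<le> K * exp (s * Z x) * V x" using le[OF that] K by (intro mult_left_mono) auto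
      finally show ?thesis by (simp add: mult.assoc)
    qed
  qed (intro bdd_meas_intros Z V)+
  then show ?thesis by (simp add: K_def)
qed

text \<open>\<open>W' i\<close> is constant along coordinate \<open>i\<close>, hence an admissible
  centring in \<open>ent_le\<close>. The increment \<open>W - W' i\<close> lies in [0, 1], so its
  square is at most itself, and the resulting linear bounds add up to at most
  \<open>W\<close>.\<close>

lemma ent_le_self_bounding:
  assumes M: "\<And>i. prob_space (M i)" and I: "finite I" and W: "bdd_meas (PiM I M) W"
    and Wi: "\<And>i. i \<in> I \<Longrightarrow> bdd_meas (PiM I M) (W' i)"
    and s: "0 < s"
    and inv: "\<And>i x y. i \<in> I \<Longrightarrow> W' i (x(i := y)) = W' i x"
    and bd: "\<And>i x. i \<in> I \<Longrightarrow> x \<in> space (PiM I M) \<Longrightarrow> 0 \<le> W x - W' i x \<and> W x - W' i x \<le> 1"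
    and le: "\<And>x. x \<in> space (PiM I M) \<Longrightarrow> (\<Sum>i\<in>I. W x - W' i x) \<le> W x"
  shows "ent (PiM I M) (\<lambda>x. s * W x) \<le> s\<^sup>2 / 2 * (\<integral>x. W x * exp (s * W x) \<partial>PiM I M)"
proof -
  define \<phi> where "\<phi> = (\<lambda>i x. s\<^sup>2 / 2 * (exp (s * W x) * (W x - W' i x)))"
  have "ent (PiM I M) (\<lambda>x. s * W x) \<le> (\<integral>x. s\<^sup>2 / 2 * (W x * exp (s * W x)) \<partial>PiM I M)"
  proof (rule bdd_meas_tensor_bound[OF M I, where \<phi>=\<phi>])
    show \<phi>: "bdd_meas (PiM I M) (\<phi> i)" if i: "i \<in> I" for i
      unfolding \<phi>_def by (intro bdd_meas_intros W Wi i)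
    show "ent (M i) (\<lambda>y. s * W (x(i := y))) \<le> (\<integral>y. \<phi> i (x(i := y)) \<partial>M i)"
      if i: "i \<in> I" and x: "x \<in> space (PiM I M)" for i x
    proof -
      have b: "bdd_meas (M i) (\<lambda>y. s * W (x(i := y)))" by (intro bdd_meas_intros bdd_meas_upd[OF x i W])
      show ?thesis
      proof (rule order_trans[OF ent_le[OF M b, of "s * W' i x"] bdd_meas_mono[OF M]])
        show "bdd_meas (M i) (\<lambda>y. exp (s * W (x(i := y))) * (s * W (x(i := y)) - s * W' i x)
           - exp (s * W (x(i := y))) + exp (s * W' i x))"
          by (intro bdd_meas_intros bdd_meas_upd[OF x i W])
        show "bdd_meas (M i) (\<lambda>y. \<phi> i (x(i := y)))" by (rule bdd_meas_upd[OF x i \<phi>[OF i]])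
        fix y assume y: "y \<in> space (M i)"
        define w where "w = W (x(i := y)) - W' i x"
        have w: "0 \<le> w" "w \<le> 1" using bd[OF i upd_space_PiM[OF x i y]] inv[OF i] by (auto simp: w_def)
        have eq: "exp (s * W' i x) = exp (s * W (x(i := y))) * exp (- (s * w))"
          by (simp add: w_def exp_add[symmetric] algebra_simps)
        have "w\<^sup>2 \<le> w" using w by (simp add: power2_eq_square mult_left_le)
        then have "s\<^sup>2 / 2 * w\<^sup>2 \<le> s\<^sup>2 / 2 * w" by (intro mult_left_mono) auto
        moreover have "exp (- (s * w)) \<le> 1 - s * w + s\<^sup>2 / 2 * w\<^sup>2"
          using exp_minus_le_quadratic[of "s * w"] w s by (simp add: power_mult_distrib)
        ultimately have "s * w - 1 + exp (- (s * w)) \<le> s\<^sup>2 / 2 * w" by linarith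
        then have "exp (s * W (x(i := y))) * (s * w - 1 + exp (- (s * w))) \<le> exp (s * W (x(i := y))) * (s\<^sup>2 / 2 * w)"
          by (intro mult_left_mono) auto
        moreover have "exp (s * W (x(i := y))) * (s * W (x(i := y)) - s * W' i x)
           - exp (s * W (x(i := y))) + exp (s * W' i x) = exp (s * W (x(i := y))) * (s * w - 1 + exp (- (s * w)))"
          unfolding eq by (simp add: w_def algebra_simps)
        moreover have "\<phi> i (x(i := y)) = exp (s * W (x(i := y))) * (s\<^sup>2 / 2 * w)"
          unfolding \<phi>_def inv[OF i] w_def by (simp add: mult_ac)
        ultimately show "exp (s * W (x(i := y))) * (s * W (x(i := y)) - s * W' i x)
           - exp (s * W (x(i := y))) + exp (s * W' i x) \<le> \<phi> i (x(i := y))"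
          by (simp only:)
      qed
    qed
    show "(\<Sum>i\<in>I. \<phi> i x) \<le> s\<^sup>2 / 2 * (W x * exp (s * W x))" if "x \<in> space (PiM I M)" for x
    proof -
      have "(\<Sum>i\<in>I. \<phi> i x) = (s\<^sup>2 / 2 * exp (s * W x)) * (\<Sum>i\<in>I. W x - W' i x)"
        by (simp add: \<phi>_def sum_distrib_left mult.assoc)
      also have "\<dots> \<le> (s\<^sup>2 / 2 * exp (s * W x)) * W x" using le[OF that] by (intro mult_left_mono) auto
      finally show ?thesis by (simp add: mult_ac)
    qed
  qed (intro bdd_meas_intros W)+
  then show ?thesis by simp
qed

section \<open>A Talagrand-type inequality for bounded processes\<close>

text \<open>Closure under sign, \<open>sym\<close>, makes the maximum \<open>Z\<close> also the
  maximum of the absolute values. The laws are probability measures at every index, inside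
  \<open>I\<close> or not, because the product integral theorems ask for this.\<close>

locale bounded_process =
  fixes M :: "'i \<Rightarrow> 'a measure" and I :: "'i set" and F :: "'q set"
    and f :: "'q \<Rightarrow> 'i \<Rightarrow> 'a \<Rightarrow> real" and v :: real
  assumes M: "\<And>i. prob_space (M i)"
    and I: "finite I" and F: "finite F" "F \<noteq> {}"
    and meas: "\<And>q i. q \<in> F \<Longrightarrow> i \<in> I \<Longrightarrow> f q i \<in> borel_measurable (M i)"
    and centred: "\<And>q i. q \<in> F \<Longrightarrow> i \<in> I \<Longrightarrow> (\<integral>x. f q i x \<partial>M i) = 0"
    and osc: "\<And>q i x y. q \<in> F \<Longrightarrow> i \<in> I \<Longrightarrow> x \<in> space (M i) \<Longrightarrow> y \<in> space (M i) \<Longrightarrow> f q i x - f q i y \<le> 1"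
    and var: "\<And>q. q \<in> F \<Longrightarrow> (\<Sum>i\<in>I. \<integral>x. (f q i x)\<^sup>2 \<partial>M i) \<le> v"
    and sym: "\<And>q. q \<in> F \<Longrightarrow> \<exists>q'\<in>F. \<forall>i\<in>I. \<forall>x\<in>space (M i). f q' i x = - f q i x"
begin

abbreviation P where "P \<equiv> PiM I M"

definition Z :: "('i \<Rightarrow> 'a) \<Rightarrow> real" where "Z x = (MAX q\<in>F. \<Sum>i\<in>I. f q i (x i))"
definition W :: "('i \<Rightarrow> 'a) \<Rightarrow> real" where "W x = (MAX q\<in>F. \<Sum>i\<in>I. (f q i (x i))\<^sup>2)"

lemma P: "prob_space P"
  by (rule prob_space_PiM[where M=M and I=I, OF M])

lemma bdd_meas_f: assumes "q \<in> F" "i \<in> I" shows "bdd_meas (M i) (f q i)"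
proof -
  obtain y where y: "y \<in> space (M i)" using prob_space.not_empty[OF M] by blast
  show ?thesis
  proof (rule bdd_measI[OF meas[OF assms], of "\<bar>f q i y\<bar> + 1"])
    fix x assume "x \<in> space (M i)"
    then show "\<bar>f q i x\<bar> \<le> \<bar>f q i y\<bar> + 1" using osc[OF assms, of x y] osc[OF assms, of y x] y by simp
  qed
qed

lemma abs_f_le: assumes "q \<in> F" "i \<in> I" "x \<in> space (M i)" shows "\<bar>f q i x\<bar> \<le> 1"
proof -
  interpret prob_space "M i" by (rule M)
  have "f q i x = (\<integral>y. f q i x - f q i y \<partial>M i)" "- f q i x = (\<integral>y. f q i y - f q i x \<partial>M i)"
    using bdd_meas_integrable[OF M bdd_meas_f[OF assms(1,2)]] by (simp_all add: prob_space centred assms)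
  moreover have "(\<integral>y. f q i x - f q i y \<partial>M i) \<le> 1" "(\<integral>y. f q i y - f q i x \<partial>M i) \<le> 1"
    using osc[OF assms(1,2)] assms(3)
    by (intro integral_le_const bdd_meas_integrable M bdd_meas_intros bdd_meas_f assms AE_I2; simp)+
  ultimately show ?thesis by linarith
qed

lemma bdd_meas_f_P: "q \<in> F \<Longrightarrow> i \<in> I \<Longrightarrow> bdd_meas P (\<lambda>x. f q i (x i))"
  by (rule bdd_meas_comp[OF bdd_meas_f]) auto

lemma bdd_meas_Z: "bdd_meas P Z"
  unfolding Z_def by (intro bdd_meas_Max F bdd_meas_sum bdd_meas_f_P)

lemma bdd_meas_W: "bdd_meas P W"
  unfolding W_def by (intro bdd_meas_Max F bdd_meas_sum bdd_meas_power2 bdd_meas_f_P)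

lemma space_P: "x \<in> space P \<Longrightarrow> i \<in> I \<Longrightarrow> x i \<in> space (M i)"
  by (auto simp: space_PiM)

lemma sum_upd:
  fixes g :: "'i \<Rightarrow> 'a \<Rightarrow> real"
  assumes "i \<in> I"
  shows "(\<Sum>j\<in>I. g j ((x(i := y)) j)) = (\<Sum>j\<in>I - {i}. g j (x j)) + g i y"
proof -
  have "(\<Sum>j\<in>I. g j ((x(i := y)) j)) = g i y + (\<Sum>j\<in>I - {i}. g j ((x(i := y)) j))"
    using I assms by (subst sum.remove[of I i]) auto
  also have "(\<Sum>j\<in>I - {i}. g j ((x(i := y)) j)) = (\<Sum>j\<in>I - {i}. g j (x j))"
    by (intro sum.cong) auto
  finally show ?thesis by simp
qed

text \<open>The maximiser \<open>q\<close> at \<open>x\<close> depends neither on the coordinate nor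
  on its new value, so one member of the family bounds all the one-coordinate decreases at once, and
  their squares can be summed.\<close>

lemma Z_diff_le:
  assumes x: "x \<in> space P"
  obtains q where "q \<in> F" "\<And>i y. i \<in> I \<Longrightarrow> Z x - Z (x(i := y)) \<le> f q i (x i) - f q i y"
proof -
  obtain q where q: "q \<in> F" "Z x = (\<Sum>i\<in>I. f q i (x i))"
    unfolding Z_def by (rule MAX_attained[OF F])
  have "Z x - Z (x(i := y)) \<le> f q i (x i) - f q i y" if i: "i \<in> I" for i y
  proof -
    have "(\<Sum>j\<in>I. f q j ((x(i := y)) j)) \<le> Z (x(i := y))"
      unfolding Z_def by (rule MAX_geI[OF F(1) q(1), of "\<lambda>q. \<Sum>j\<in>I. f q j ((x(i := y)) j)"])
    moreover have "Z x = (\<Sum>j\<in>I - {i}. f q j (x j)) + f q i (x i)"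
      unfolding q(2) using I i by (subst sum.remove[of I i]) auto
    ultimately show ?thesis unfolding sum_upd[OF i] by simp
  qed
  with q(1) show thesis by (rule that)
qed

text \<open>When \<open>(f q i (x i) - f q i y)\<^sup>2\<close> is integrated over \<open>y\<close>,
  the cross term vanishes by centring. Summation over \<open>i\<close> leaves a sum of squares, at
  most \<open>W x\<close>, and a sum of variances, at most \<open>v\<close>.\<close>

lemma ent_Z_le:
  assumes s: "0 < s"
  shows "ent P (\<lambda>x. s * Z x) \<le> s\<^sup>2 / 2 * exp (2 * s) * (\<integral>x. exp (s * Z x) * (W x + v) \<partial>P)"
proof (rule ent_le_Efron_Stein[OF M I bdd_meas_Z _ s])
  show "bdd_meas P (\<lambda>x. W x + v)" by (intro bdd_meas_intros bdd_meas_W)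
  show "Z x - Z (x(i := y)) \<le> 1" if "i \<in> I" "x \<in> space P" "y \<in> space (M i)" for i x y
  proof -
    obtain q where "q \<in> F" "\<And>i y. i \<in> I \<Longrightarrow> Z x - Z (x(i := y)) \<le> f q i (x i) - f q i y"
      using Z_diff_le[OF \<open>x \<in> space P\<close>] by blast
    then show ?thesis using osc[of q i "x i" y] that space_P by (meson order_trans)
  qed
  show "(\<Sum>i\<in>I. \<integral>y. (max 0 (Z x - Z (x(i := y))))\<^sup>2 \<partial>M i) \<le> W x + v" if x: "x \<in> space P" for x
  proof -
    obtain q where q: "q \<in> F" "\<And>i y. i \<in> I \<Longrightarrow> Z x - Z (x(i := y)) \<le> f q i (x i) - f q i y"
      using Z_diff_le[OF x] by blast
    have "(\<integral>y. (max 0 (Z x - Z (x(i := y))))\<^sup>2 \<partial>M i) \<le> (f q i (x i))\<^sup>2 + (\<integral>y. (f q i y)\<^sup>2 \<partial>M i)" if i: "i \<in> I" for i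
    proof -
      note b = bdd_meas_f[OF q(1) i]
      interpret prob_space "M i" by (rule M)
      have "(\<integral>y. (max 0 (Z x - Z (x(i := y))))\<^sup>2 \<partial>M i)
          \<le> (\<integral>y. (f q i (x i))\<^sup>2 - 2 * f q i (x i) * f q i y + (f q i y)\<^sup>2 \<partial>M i)"
      proof (rule bdd_meas_mono[OF M])
        show "bdd_meas (M i) (\<lambda>y. (max 0 (Z x - Z (x(i := y))))\<^sup>2)"
          by (intro bdd_meas_intros bdd_meas_upd[OF x i bdd_meas_Z])
        show "bdd_meas (M i) (\<lambda>y. (f q i (x i))\<^sup>2 - 2 * f q i (x i) * f q i y + (f q i y)\<^sup>2)"
          by (intro bdd_meas_intros b)
        fix y
        have "(max 0 (Z x - Z (x(i := y))))\<^sup>2 \<le> (max 0 (f q i (x i) - f q i y))\<^sup>2"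
          by (intro power_mono max.mono q(2)[OF i]) auto
        also have "\<dots> \<le> (f q i (x i) - f q i y)\<^sup>2" by (auto simp: max_def)
        also have "\<dots> = (f q i (x i))\<^sup>2 - 2 * f q i (x i) * f q i y + (f q i y)\<^sup>2"
          by (simp add: power2_diff)
        finally show "(max 0 (Z x - Z (x(i := y))))\<^sup>2 \<le> (f q i (x i))\<^sup>2 - 2 * f q i (x i) * f q i y + (f q i y)\<^sup>2" .
      qed
      also have "\<dots> = (f q i (x i))\<^sup>2 + (\<integral>y. (f q i y)\<^sup>2 \<partial>M i)"
        using b by (simp add: bdd_meas_integrable[OF M] bdd_meas_intros prob_space centred q i)
      finally show ?thesis .
    qed
    then have "(\<Sum>i\<in>I. \<integral>y. (max 0 (Z x - Z (x(i := y))))\<^sup>2 \<partial>M i)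
      \<le> (\<Sum>i\<in>I. (f q i (x i))\<^sup>2) + (\<Sum>i\<in>I. \<integral>y. (f q i y)\<^sup>2 \<partial>M i)"
      by (simp add: sum_mono flip: sum.distrib)
    also have "\<dots> \<le> W x + v"
      unfolding W_def by (intro add_mono var q(1) MAX_geI[OF F(1), of q "\<lambda>q. \<Sum>i\<in>I. (f q i (x i))\<^sup>2"])
    finally show ?thesis .
  qed
qed

text \<open>The reduced functions are the same maxima with the \<open>i\<close>-th term left out.
  Deleting that term lowers \<open>W\<close> by at most the corresponding square of the maximiser,
  which is at most 1, and these squares add up to \<open>W\<close>.\<close>

lemma ent_W_le:
  assumes s: "0 < s"
  shows "ent P (\<lambda>x. s * W x) \<le> s\<^sup>2 / 2 * (\<integral>x. W x * exp (s * W x) \<partial>P)"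
proof (rule ent_le_self_bounding[OF M I bdd_meas_W _ s, of "\<lambda>i x. MAX q\<in>F. \<Sum>j\<in>I - {i}. (f q j (x j))\<^sup>2"])
  have split: "(\<Sum>j\<in>I. (f q j (x j))\<^sup>2) = (\<Sum>j\<in>I - {i}. (f q j (x j))\<^sup>2) + (f q i (x i))\<^sup>2" if "i \<in> I" for q i x
    using I that by (subst sum.remove[of I i]) auto
  show "bdd_meas P (\<lambda>x. MAX q\<in>F. \<Sum>j\<in>I - {i}. (f q j (x j))\<^sup>2)" if "i \<in> I" for i
    by (intro bdd_meas_Max F bdd_meas_sum bdd_meas_power2 bdd_meas_f_P) auto
  show "(MAX q\<in>F. \<Sum>j\<in>I - {i}. (f q j ((x(i := y)) j))\<^sup>2) = (MAX q\<in>F. \<Sum>j\<in>I - {i}. (f q j (x j))\<^sup>2)" for i x y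
    by (intro arg_cong[where f=Max] image_cong refl sum.cong) auto
  have diff: "\<exists>q\<in>F. W x = (\<Sum>j\<in>I. (f q j (x j))\<^sup>2) \<and>
      (\<forall>i\<in>I. W x - (MAX q\<in>F. \<Sum>j\<in>I - {i}. (f q j (x j))\<^sup>2) \<le> (f q i (x i))\<^sup>2)" for x
  proof -
    obtain q where q: "q \<in> F" "W x = (\<Sum>i\<in>I. (f q i (x i))\<^sup>2)"
      unfolding W_def by (rule MAX_attained[OF F])
    have "W x - (MAX q\<in>F. \<Sum>j\<in>I - {i}. (f q j (x j))\<^sup>2) \<le> (f q i (x i))\<^sup>2" if i: "i \<in> I" for i
      using MAX_geI[OF F(1) q(1), of "\<lambda>q. \<Sum>j\<in>I - {i}. (f q j (x j))\<^sup>2"] q(2) split[OF i, of q x] by simp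
    with q show ?thesis by blast
  qed
  show "0 \<le> W x - (MAX q\<in>F. \<Sum>j\<in>I - {i}. (f q j (x j))\<^sup>2) \<and> W x - (MAX q\<in>F. \<Sum>j\<in>I - {i}. (f q j (x j))\<^sup>2) \<le> 1"
    if i: "i \<in> I" and x: "x \<in> space P" for i x
  proof
    show "0 \<le> W x - (MAX q\<in>F. \<Sum>j\<in>I - {i}. (f q j (x j))\<^sup>2)"
      unfolding W_def split[OF i] using MAX_mono[OF F, of "\<lambda>q. \<Sum>j\<in>I - {i}. (f q j (x j))\<^sup>2"
        "\<lambda>q. (\<Sum>j\<in>I - {i}. (f q j (x j))\<^sup>2) + (f q i (x i))\<^sup>2"] by simp
    obtain q where "q \<in> F" "W x - (MAX q\<in>F. \<Sum>j\<in>I - {i}. (f q j (x j))\<^sup>2) \<le> (f q i (x i))\<^sup>2"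
      using diff i by blast
    moreover have "(f q i (x i))\<^sup>2 \<le> 1"
      using abs_f_le[OF \<open>q \<in> F\<close> i space_P[OF x i]] by (simp add: abs_square_le_1)
    ultimately show "W x - (MAX q\<in>F. \<Sum>j\<in>I - {i}. (f q j (x j))\<^sup>2) \<le> 1" by linarith
  qed
  show "(\<Sum>i\<in>I. W x - (MAX q\<in>F. \<Sum>j\<in>I - {i}. (f q j (x j))\<^sup>2)) \<le> W x" for x
  proof -
    obtain q where q: "W x = (\<Sum>j\<in>I. (f q j (x j))\<^sup>2)"
      "\<And>i. i \<in> I \<Longrightarrow> W x - (MAX q\<in>F. \<Sum>j\<in>I - {i}. (f q j (x j))\<^sup>2) \<le> (f q i (x i))\<^sup>2"
      using diff by blast
    show ?thesis unfolding q(1) by (rule sum_mono) (use q in simp)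
  qed
qed

lemma lmgf_W_le: "0 < l \<Longrightarrow> l < 2 \<Longrightarrow> lmgf P W l \<le> l / (1 - l / 2) * (\<integral>x. W x \<partial>P)"
  by (intro herbst_self_bounding P bdd_meas_W ent_W_le)

section \<open>Mean of the maximal sum of squares\<close>

definition \<Phi> :: "('q \<Rightarrow> 'i \<Rightarrow> 'a \<Rightarrow> real) \<Rightarrow> real" where
  "\<Phi> g = (\<integral>x. (MAX q\<in>F. \<Sum>i\<in>I. g q i (x i)) \<partial>P)"

lemma bdd_meas_MAX_sum:
  assumes "\<And>q i. q \<in> F \<Longrightarrow> i \<in> A \<Longrightarrow> bdd_meas (M i) (g q i)" "A \<subseteq> I"
  shows "bdd_meas P (\<lambda>x. MAX q\<in>F. \<Sum>i\<in>A. g q i (x i))"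
  using assms by (intro bdd_meas_Max F bdd_meas_sum bdd_meas_comp[OF assms(1)]) auto

lemma bdd_meas_MAX_affine:
  assumes "\<And>q. q \<in> F \<Longrightarrow> bdd_meas N (h q)"
  shows "bdd_meas N (\<lambda>y. MAX q\<in>F. b q + h q y)"
  using assms by (intro bdd_meas_Max F bdd_meas_intros)

text \<open>
  Symmetrization and contraction one coordinate at a time: two copies of the same coordinate with
  opposite signs replace the Rademacher variables.
\<close>

lemma MAX_contraction:
  assumes i: "i \<in> I"
  shows "(\<integral>y. (MAX q\<in>F. b q + ((f q i y)\<^sup>2 - (\<integral>z. (f q i z)\<^sup>2 \<partial>M i))) \<partial>M i)
     \<le> ((\<integral>y. (MAX q\<in>F. b q + 4 * f q i y) \<partial>M i) + (\<integral>y. (MAX q\<in>F. b q + - 4 * f q i y) \<partial>M i)) / 2"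
proof -
  interpret prob_space "M i" by (rule M)
  note bf = bdd_meas_f[OF _ i]
  \<comment> \<open>With an independent copy \<open>z\<close>,
    \<open>b + (f x)\<^sup>2 - (f z)\<^sup>2\<close> is the half-sum of
    \<open>b + 2 * (f x)\<^sup>2\<close> and \<open>b - 2 * (f z)\<^sup>2\<close>. Maximising the
    halves separately decouples the copies, so both can then be evaluated at a common point.\<close>
  define A where "A = (\<lambda>y. MAX q\<in>F. b q + 2 * (f q i y)\<^sup>2)"
  define B where "B = (\<lambda>y. MAX q\<in>F. b q + - 2 * (f q i y)\<^sup>2)"
  have A: "bdd_meas (M i) A" and B: "bdd_meas (M i) B"
    unfolding A_def B_def by (intro bdd_meas_MAX_affine bdd_meas_intros bf; assumption)+
  have "(MAX q\<in>F. b q + ((f q i x)\<^sup>2 - (\<integral>z. (f q i z)\<^sup>2 \<partial>M i))) \<le> A x / 2 + (\<integral>z. B z \<partial>M i) / 2" for x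
  proof (rule MAX_leI[OF F])
    fix q assume q: "q \<in> F"
    have "b q + 2 * (f q i x)\<^sup>2 \<le> A x" unfolding A_def by (rule MAX_geI[OF F(1) q])
    moreover have "b q - 2 * (\<integral>z. (f q i z)\<^sup>2 \<partial>M i) = (\<integral>z. b q + - 2 * (f q i z)\<^sup>2 \<partial>M i)"
      using bf[OF q] by (simp add: bdd_meas_integrable[OF M] bdd_meas_intros prob_space)
    moreover have "(\<integral>z. b q + - 2 * (f q i z)\<^sup>2 \<partial>M i) \<le> (\<integral>z. B z \<partial>M i)"
      by (intro bdd_meas_mono[OF M] bdd_meas_intros bf q B) (unfold B_def, rule MAX_geI[OF F(1) q])
    ultimately show "b q + ((f q i x)\<^sup>2 - (\<integral>z. (f q i z)\<^sup>2 \<partial>M i)) \<le> A x / 2 + (\<integral>z. B z \<partial>M i) / 2" by simp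
  qed
  then have "(\<integral>y. (MAX q\<in>F. b q + ((f q i y)\<^sup>2 - (\<integral>z. (f q i z)\<^sup>2 \<partial>M i))) \<partial>M i)
      \<le> (\<integral>y. A y / 2 + (\<integral>z. B z \<partial>M i) / 2 \<partial>M i)"
    by (intro bdd_meas_mono[OF M] bdd_meas_MAX_affine bdd_meas_intros bf A)
  also have "\<dots> = (\<integral>y. (A y + B y) / 2 \<partial>M i)"
    using A B by (simp add: bdd_meas_integrable[OF M] bdd_meas_intros prob_space add_divide_distrib)
  also have "\<dots> \<le> (\<integral>y. ((MAX q\<in>F. b q + 4 * f q i y) + (MAX q\<in>F. b q + - 4 * f q i y)) / 2 \<partial>M i)"
  proof (intro bdd_meas_mono[OF M] bdd_meas_intros A B bdd_meas_MAX_affine bf divide_right_mono)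
    fix y assume y: "y \<in> space (M i)"
    obtain q where q: "q \<in> F" "A y = b q + 2 * (f q i y)\<^sup>2" unfolding A_def by (rule MAX_attained[OF F])
    obtain r where r: "r \<in> F" "B y = b r + - 2 * (f r i y)\<^sup>2" unfolding B_def by (rule MAX_attained[OF F])
    note mx = MAX_geI[OF F(1) q(1), of "\<lambda>q. b q + 4 * f q i y"] MAX_geI[OF F(1) r(1), of "\<lambda>q. b q + - 4 * f q i y"]
      MAX_geI[OF F(1) r(1), of "\<lambda>q. b q + 4 * f q i y"] MAX_geI[OF F(1) q(1), of "\<lambda>q. b q + - 4 * f q i y"]
    \<comment> \<open>The square has Lipschitz constant 2 on [-1, 1], so twice this difference is at
      most \<open>4 * \<bar>f q i y - f r i y\<bar>\<close>. The sign of
      \<open>f q i y - f r i y\<close> decides which of \<open>q\<close> and \<open>r\<close> takes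
      the coefficient 4 and which takes -4.\<close>
    have "(f q i y)\<^sup>2 - (f r i y)\<^sup>2 = (f q i y + f r i y) * (f q i y - f r i y)"
      by (simp add: algebra_simps power2_eq_square)
    also have "\<dots> \<le> \<bar>f q i y + f r i y\<bar> * \<bar>f q i y - f r i y\<bar>" by (metis abs_ge_self abs_mult)
    also have "\<dots> \<le> 2 * \<bar>f q i y - f r i y\<bar>"
      using abs_f_le[OF q(1) i y] abs_f_le[OF r(1) i y] by (intro mult_right_mono) auto
    finally show "A y + B y \<le> (MAX q\<in>F. b q + 4 * f q i y) + (MAX q\<in>F. b q + - 4 * f q i y)"
      using mx unfolding q(2) r(2) by (auto simp: abs_if split: if_splits)
  qed auto
  also have "\<dots> = ((\<integral>y. (MAX q\<in>F. b q + 4 * f q i y) \<partial>M i) + (\<integral>y. (MAX q\<in>F. b q + - 4 * f q i y) \<partial>M i)) / 2"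
    using bdd_meas_integrable[OF M[of i] bdd_meas_MAX_affine[where h="\<lambda>q y. 4 * f q i y" and b=b]]
      bdd_meas_integrable[OF M[of i] bdd_meas_MAX_affine[where h="\<lambda>q y. - 4 * f q i y" and b=b]] bf
    by (simp add: bdd_meas_intros)
  finally show ?thesis .
qed

lemma \<Phi>_resample:
  assumes i: "i \<in> I" and g: "\<And>q i. q \<in> F \<Longrightarrow> i \<in> I \<Longrightarrow> bdd_meas (M i) (g q i)"
  shows "\<Phi> g = (\<integral>x. (\<integral>y. (MAX q\<in>F. (\<Sum>j\<in>I - {i}. g q j (x j)) + g q i y) \<partial>M i) \<partial>P)"
  unfolding \<Phi>_def
  by (subst bdd_meas_resample[OF M I i bdd_meas_MAX_sum[OF g], symmetric]) (simp_all only: sum_upd[OF i] subset_refl)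

text \<open>A half-sum is at most the larger of its terms, so one fixed sign can be chosen for each
  coordinate and no random signs have to be carried along.\<close>

lemma \<Phi>_step:
  assumes i: "i \<in> I" and g: "\<And>q i. q \<in> F \<Longrightarrow> i \<in> I \<Longrightarrow> bdd_meas (M i) (g q i)"
    and gi: "\<And>q. g q i = (\<lambda>y. (f q i y)\<^sup>2 - (\<integral>z. (f q i z)\<^sup>2 \<partial>M i))"
  obtains e where "e \<in> {1, - 1}" "\<Phi> g \<le> \<Phi> (\<lambda>q j. if j = i then (\<lambda>y. 4 * e * f q i y) else g q j)"
proof -
  define h where "h = (\<lambda>e q j. if j = i then (\<lambda>y. 4 * e * f q i y) else g q j)"
  have h: "bdd_meas (M j) (h e q j)" if "q \<in> F" "j \<in> I" for e q j
    using that g i by (auto simp: h_def intro!: bdd_meas_intros bdd_meas_f)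
  have off: "(\<Sum>j\<in>I - {i}. h e q j (x j)) = (\<Sum>j\<in>I - {i}. g q j (x j))" for e q x
    by (intro sum.cong) (auto simp: h_def)
  have on: "h e q i y = 4 * e * f q i y" for e q y by (simp add: h_def)
  have \<Phi>h: "\<Phi> (h e) = (\<integral>x. (\<integral>y. (MAX q\<in>F. (\<Sum>j\<in>I - {i}. g q j (x j)) + 4 * e * f q i y) \<partial>M i) \<partial>P)" for e
  proof -
    have "\<Phi> (h e) = (\<integral>x. (\<integral>y. (MAX q\<in>F. (\<Sum>j\<in>I - {i}. h e q j (x j)) + h e q i y) \<partial>M i) \<partial>P)"
      by (rule \<Phi>_resample[OF i h])
    then show ?thesis by (simp only: off on)
  qed
  have b: "bdd_meas P (\<lambda>x. \<integral>y. (MAX q\<in>F. (\<Sum>j\<in>I - {i}. k q j (x j)) + k q i y) \<partial>M i)"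
    if "\<And>q j. q \<in> F \<Longrightarrow> j \<in> I \<Longrightarrow> bdd_meas (M j) (k q j)" for k :: "'q \<Rightarrow> 'i \<Rightarrow> 'a \<Rightarrow> real"
    using bdd_meas_integral[OF M bdd_meas_PiM_upd_in[OF bdd_meas_MAX_sum[where A=I and g=k, OF that subset_refl] i]]
    by (simp only: sum_upd[OF i])
  have \<Phi>g: "\<Phi> g = (\<integral>x. (\<integral>y. (MAX q\<in>F. (\<Sum>j\<in>I - {i}. g q j (x j)) + g q i y) \<partial>M i) \<partial>P)"
    by (rule \<Phi>_resample[OF i g])
  have bh: "bdd_meas P (\<lambda>x. \<integral>y. (MAX q\<in>F. (\<Sum>j\<in>I - {i}. g q j (x j)) + 4 * e * f q i y) \<partial>M i)" for e
    using b[where k="h e", OF h] by (simp only: off on)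
  have avg: "a \<le> b \<or> a \<le> c" if "a \<le> (b + c) / 2" for a b c :: real
    using that by (cases "b \<le> c") auto
  have "\<Phi> g \<le> (\<integral>x. ((\<integral>y. (MAX q\<in>F. (\<Sum>j\<in>I - {i}. g q j (x j)) + 4 * 1 * f q i y) \<partial>M i)
     + (\<integral>y. (MAX q\<in>F. (\<Sum>j\<in>I - {i}. g q j (x j)) + 4 * (- 1) * f q i y) \<partial>M i)) / 2 \<partial>P)"
    unfolding \<Phi>g
  proof (rule bdd_meas_mono[OF P b[where k=g, OF g]])
    show "bdd_meas P (\<lambda>x. ((\<integral>y. (MAX q\<in>F. (\<Sum>j\<in>I - {i}. g q j (x j)) + 4 * 1 * f q i y) \<partial>M i)
     + (\<integral>y. (MAX q\<in>F. (\<Sum>j\<in>I - {i}. g q j (x j)) + 4 * (- 1) * f q i y) \<partial>M i)) / 2)"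
      by (intro bdd_meas_intros bh)
    fix x
    show "(\<integral>y. (MAX q\<in>F. (\<Sum>j\<in>I - {i}. g q j (x j)) + g q i y) \<partial>M i) \<le>
      ((\<integral>y. (MAX q\<in>F. (\<Sum>j\<in>I - {i}. g q j (x j)) + 4 * 1 * f q i y) \<partial>M i)
     + (\<integral>y. (MAX q\<in>F. (\<Sum>j\<in>I - {i}. g q j (x j)) + 4 * (- 1) * f q i y) \<partial>M i)) / 2"
      using MAX_contraction[OF i, of "\<lambda>q. \<Sum>j\<in>I - {i}. g q j (x j)"] by (simp add: gi)
  qed
  also have "\<dots> = (\<Phi> (h 1) + \<Phi> (h (- 1))) / 2"
    unfolding \<Phi>h using bdd_meas_integrable[OF P bh[of 1]] bdd_meas_integrable[OF P bh[of "- 1"]]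
    by simp
  finally have "\<Phi> g \<le> \<Phi> (h 1) \<or> \<Phi> g \<le> \<Phi> (h (- 1))"
    by (rule avg)
  then show thesis using that unfolding h_def by blast
qed

lemma \<Phi>_symmetrization:
  assumes "J \<subseteq> I"
  shows "\<exists>e. (\<forall>i. e i \<in> {1, - 1 :: real}) \<and>
     \<Phi> (\<lambda>q i y. (f q i y)\<^sup>2 - (\<integral>z. (f q i z)\<^sup>2 \<partial>M i))
     \<le> \<Phi> (\<lambda>q i. if i \<in> J then (\<lambda>y. 4 * e i * f q i y) else (\<lambda>y. (f q i y)\<^sup>2 - (\<integral>z. (f q i z)\<^sup>2 \<partial>M i)))"
proof -
  have "finite J" using assms I by (rule finite_subset)
  then show ?thesis using assms
  proof (induction J rule: finite_induct)
    case empty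
    show ?case by (rule exI[of _ "\<lambda>_. 1"]) simp
  next
    case (insert i J)
    then obtain e where e: "\<And>i. e i \<in> {1, - 1 :: real}"
      "\<Phi> (\<lambda>q i y. (f q i y)\<^sup>2 - (\<integral>z. (f q i z)\<^sup>2 \<partial>M i))
       \<le> \<Phi> (\<lambda>q i. if i \<in> J then (\<lambda>y. 4 * e i * f q i y) else (\<lambda>y. (f q i y)\<^sup>2 - (\<integral>z. (f q i z)\<^sup>2 \<partial>M i)))"
      by auto
    define g where "g = (\<lambda>q i. if i \<in> J then (\<lambda>y. 4 * e i * f q i y) else (\<lambda>y. (f q i y)\<^sup>2 - (\<integral>z. (f q i z)\<^sup>2 \<partial>M i)))"
    have i: "i \<in> I" using insert by auto
    have g: "bdd_meas (M j) (g q j)" if "q \<in> F" "j \<in> I" for q j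
      using that by (auto simp: g_def intro!: bdd_meas_intros bdd_meas_f)
    have gi: "g q i = (\<lambda>y. (f q i y)\<^sup>2 - (\<integral>z. (f q i z)\<^sup>2 \<partial>M i))" for q
      using insert by (simp add: g_def)
    obtain e' where e': "e' \<in> {1, - 1}" "\<Phi> g \<le> \<Phi> (\<lambda>q j. if j = i then (\<lambda>y. 4 * e' * f q i y) else g q j)"
      by (rule \<Phi>_step[OF i g gi])
    have "(\<lambda>q j. if j = i then (\<lambda>y. 4 * e' * f q i y) else g q j) =
      (\<lambda>q j. if j \<in> insert i J then (\<lambda>y. 4 * (e(i := e')) j * f q j y) else (\<lambda>y. (f q j y)\<^sup>2 - (\<integral>z. (f q j z)\<^sup>2 \<partial>M j)))"
      by (auto simp: g_def fun_eq_iff)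
    then show ?case using e e' unfolding g_def[symmetric]
      by (intro exI[of _ "e(i := e')"]) (auto intro: order_trans)
  qed
qed

text \<open>Jensen's inequality: averaging out an independent centred coordinate inside the maximum
  gives back the shorter sum, so adding coordinates can only raise the mean of the maximum.\<close>

lemma partial_sum_le:
  assumes "A \<subseteq> I"
  shows "(\<integral>x. (MAX q\<in>F. \<Sum>i\<in>A. f q i (x i)) \<partial>P) \<le> (\<integral>x. Z x \<partial>P)"
proof -
  have "(\<integral>x. (MAX q\<in>F. \<Sum>i\<in>A. f q i (x i)) \<partial>P) \<le> (\<integral>x. (MAX q\<in>F. \<Sum>i\<in>A \<union> B. f q i (x i)) \<partial>P)"
    if "finite B" "B \<subseteq> I" for B
    using that
  proof (induction B rule: finite_induct)
    case (insert j B)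
    show ?case
    proof (cases "j \<in> A \<union> B")
      case True
      then have "A \<union> insert j B = A \<union> B" by auto
      then show ?thesis using insert by simp
    next
      case False
      have j: "j \<in> I" and AB: "A \<union> B \<subseteq> I" "A \<union> insert j B \<subseteq> I" using insert assms by auto
      have fin: "finite (A \<union> B)" using AB I by (meson finite_subset)
      have eq: "(\<Sum>i\<in>A \<union> insert j B. f q i ((x(j := y)) i)) = (\<Sum>i\<in>A \<union> B. f q i (x i)) + f q j y" for q x y
      proof -
        have "(\<Sum>i\<in>A \<union> insert j B. f q i ((x(j := y)) i)) = f q j y + (\<Sum>i\<in>A \<union> B. f q i ((x(j := y)) i))"
          using False fin by simp
        also have "(\<Sum>i\<in>A \<union> B. f q i ((x(j := y)) i)) = (\<Sum>i\<in>A \<union> B. f q i (x i))"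
          using False by (intro sum.cong) auto
        finally show ?thesis by simp
      qed
      have bm: "bdd_meas P (\<lambda>x. MAX q\<in>F. \<Sum>i\<in>A \<union> insert j B. f q i (x i))"
        using AB by (intro bdd_meas_MAX_sum bdd_meas_f) auto
      have "(\<integral>x. (MAX q\<in>F. \<Sum>i\<in>A \<union> B. f q i (x i)) \<partial>P)
        \<le> (\<integral>x. (\<integral>y. (MAX q\<in>F. \<Sum>i\<in>A \<union> insert j B. f q i ((x(j := y)) i)) \<partial>M j) \<partial>P)"
      proof (rule bdd_meas_mono[OF P])
        show "bdd_meas P (\<lambda>x. MAX q\<in>F. \<Sum>i\<in>A \<union> B. f q i (x i))"
          using AB by (intro bdd_meas_MAX_sum bdd_meas_f) auto
        show "bdd_meas P (\<lambda>x. \<integral>y. (MAX q\<in>F. \<Sum>i\<in>A \<union> insert j B. f q i ((x(j := y)) i)) \<partial>M j)"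
          by (rule bdd_meas_integral[OF M bdd_meas_PiM_upd_in[OF bm j]])
        fix x
        have "(MAX q\<in>F. \<integral>y. (\<Sum>i\<in>A \<union> B. f q i (x i)) + f q j y \<partial>M j)
          \<le> (\<integral>y. (MAX q\<in>F. (\<Sum>i\<in>A \<union> B. f q i (x i)) + f q j y) \<partial>M j)"
          by (intro MAX_integral_le F M bdd_meas_intros bdd_meas_f j)
        also have "(MAX q\<in>F. \<integral>y. (\<Sum>i\<in>A \<union> B. f q i (x i)) + f q j y \<partial>M j) = (MAX q\<in>F. \<Sum>i\<in>A \<union> B. f q i (x i))"
          by (intro arg_cong[where f=Max] image_cong refl)
            (simp add: bdd_meas_integral_add_const[OF M bdd_meas_f[OF _ j]] centred[OF _ j])
        finally show "(MAX q\<in>F. \<Sum>i\<in>A \<union> B. f q i (x i))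
          \<le> (\<integral>y. (MAX q\<in>F. \<Sum>i\<in>A \<union> insert j B. f q i ((x(j := y)) i)) \<partial>M j)"
          unfolding eq .
      qed
      also have "\<dots> = (\<integral>x. (MAX q\<in>F. \<Sum>i\<in>A \<union> insert j B. f q i (x i)) \<partial>P)"
        by (rule bdd_meas_resample[OF M I j bm])
      finally show ?thesis using insert by auto
    qed
  qed simp
  from this[of I] I assms show ?thesis by (simp add: Z_def Un_absorb1)
qed

lemma expectation_Z_nonneg: "0 \<le> (\<integral>x. Z x \<partial>P)"
  using partial_sum_le[of "{}"] F by simp

text \<open>The chosen signs split \<open>I\<close> into two blocks, and by \<open>sym\<close> the
  negated functions on the second block still belong to the family. Contraction costs a factor 4,
  and each block contributes at most the mean of \<open>Z\<close>; hence 8.\<close>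

lemma expectation_W_le: "(\<integral>x. W x \<partial>P) \<le> v + 8 * (\<integral>x. Z x \<partial>P)"
proof -
  define g where "g = (\<lambda>q i y. (f q i y)\<^sup>2 - (\<integral>z. (f q i z)\<^sup>2 \<partial>M i))"
  have g: "bdd_meas (M j) (g q j)" if "q \<in> F" "j \<in> I" for q j
    using that by (auto simp: g_def intro!: bdd_meas_intros bdd_meas_f)
  obtain e where e: "\<And>i. e i \<in> {1, - 1 :: real}" "\<Phi> g \<le> \<Phi> (\<lambda>q i. if i \<in> I then (\<lambda>y. 4 * e i * f q i y) else g q i)"
    using \<Phi>_symmetrization[of I] unfolding g_def by auto
  define A where "A = {i \<in> I. e i = 1}"
  define B where "B = {i \<in> I. e i = - 1}"
  have AB: "A \<inter> B = {}" "A \<union> B = I" "A \<subseteq> I" "B \<subseteq> I" "finite A" "finite B"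
    using e(1) I by (auto simp: A_def B_def)
  have "(\<integral>x. W x \<partial>P) \<le> (\<integral>x. v + (MAX q\<in>F. \<Sum>i\<in>I. g q i (x i)) \<partial>P)"
  proof (rule bdd_meas_mono[OF P bdd_meas_W])
    show "bdd_meas P (\<lambda>x. v + (MAX q\<in>F. \<Sum>i\<in>I. g q i (x i)))" by (intro bdd_meas_intros bdd_meas_MAX_sum g) auto
    fix x
    show "W x \<le> v + (MAX q\<in>F. \<Sum>i\<in>I. g q i (x i))"
      unfolding W_def
    proof (rule MAX_leI[OF F])
      fix q assume q: "q \<in> F"
      have "(\<Sum>i\<in>I. (f q i (x i))\<^sup>2) = (\<Sum>i\<in>I. \<integral>z. (f q i z)\<^sup>2 \<partial>M i) + (\<Sum>i\<in>I. g q i (x i))"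
        by (simp add: g_def sum.distrib[symmetric])
      also have "\<dots> \<le> v + (MAX q\<in>F. \<Sum>i\<in>I. g q i (x i))"
        by (intro add_mono var q MAX_geI[OF F(1) q, of "\<lambda>q. \<Sum>i\<in>I. g q i (x i)"])
      finally show "(\<Sum>i\<in>I. (f q i (x i))\<^sup>2) \<le> v + (MAX q\<in>F. \<Sum>i\<in>I. g q i (x i))" .
    qed
  qed
  also have "\<dots> = v + \<Phi> g"
    unfolding \<Phi>_def by (intro bdd_meas_integral_add_const P bdd_meas_MAX_sum g) auto
  also have "\<Phi> g \<le> \<Phi> (\<lambda>q i. if i \<in> I then (\<lambda>y. 4 * e i * f q i y) else g q i)" by (rule e)
  also have "\<dots> \<le> (\<integral>x. 4 * (MAX q\<in>F. \<Sum>i\<in>A. f q i (x i)) + 4 * (MAX q\<in>F. \<Sum>i\<in>B. f q i (x i)) \<partial>P)"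
    unfolding \<Phi>_def
  proof (rule bdd_meas_mono[OF P])
    show "bdd_meas P (\<lambda>x. MAX q\<in>F. \<Sum>i\<in>I. (if i \<in> I then (\<lambda>y. 4 * e i * f q i y) else g q i) (x i))"
      by (intro bdd_meas_MAX_sum) (auto intro!: bdd_meas_intros bdd_meas_f)
    show "bdd_meas P (\<lambda>x. 4 * (MAX q\<in>F. \<Sum>i\<in>A. f q i (x i)) + 4 * (MAX q\<in>F. \<Sum>i\<in>B. f q i (x i)))"
      using AB by (intro bdd_meas_intros bdd_meas_MAX_sum bdd_meas_f) auto
    fix x assume x: "x \<in> space P"
    show "(MAX q\<in>F. \<Sum>i\<in>I. (if i \<in> I then (\<lambda>y. 4 * e i * f q i y) else g q i) (x i))
      \<le> 4 * (MAX q\<in>F. \<Sum>i\<in>A. f q i (x i)) + 4 * (MAX q\<in>F. \<Sum>i\<in>B. f q i (x i))"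
    proof (rule MAX_leI[OF F])
      fix q assume q: "q \<in> F"
      obtain q' where q': "q' \<in> F" "\<And>i x. i \<in> I \<Longrightarrow> x \<in> space (M i) \<Longrightarrow> f q' i x = - f q i x"
        using sym[OF q] by blast
      have "(\<Sum>i\<in>I. (if i \<in> I then (\<lambda>y. 4 * e i * f q i y) else g q i) (x i)) = (\<Sum>i\<in>A \<union> B. 4 * e i * f q i (x i))"
        unfolding AB(2) by simp
      also have "\<dots> = (\<Sum>i\<in>A. 4 * e i * f q i (x i)) + (\<Sum>i\<in>B. 4 * e i * f q i (x i))"
        using AB by (intro sum.union_disjoint)
      also have "(\<Sum>i\<in>A. 4 * e i * f q i (x i)) = 4 * (\<Sum>i\<in>A. f q i (x i))"
        unfolding sum_distrib_left by (intro sum.cong) (auto simp: A_def)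
      also have "(\<Sum>i\<in>B. 4 * e i * f q i (x i)) = 4 * (\<Sum>i\<in>B. f q' i (x i))"
        unfolding sum_distrib_left using x by (intro sum.cong) (auto simp: B_def q' space_P)
      finally show "(\<Sum>i\<in>I. (if i \<in> I then (\<lambda>y. 4 * e i * f q i y) else g q i) (x i))
        \<le> 4 * (MAX q\<in>F. \<Sum>i\<in>A. f q i (x i)) + 4 * (MAX q\<in>F. \<Sum>i\<in>B. f q i (x i))"
        using MAX_geI[OF F(1) q, of "\<lambda>q. \<Sum>i\<in>A. f q i (x i)"] MAX_geI[OF F(1) q'(1), of "\<lambda>q. \<Sum>i\<in>B. f q i (x i)"]
        by linarith
    qed
  qed
  also have "\<dots> = 4 * (\<integral>x. (MAX q\<in>F. \<Sum>i\<in>A. f q i (x i)) \<partial>P) + 4 * (\<integral>x. (MAX q\<in>F. \<Sum>i\<in>B. f q i (x i)) \<partial>P)"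
    using bdd_meas_integrable[OF P bdd_meas_MAX_sum[of A f]] bdd_meas_integrable[OF P bdd_meas_MAX_sum[of B f]] AB bdd_meas_f
    by (subst Bochner_Integration.integral_add) auto
  also have "\<dots> \<le> 8 * (\<integral>x. Z x \<partial>P)"
    using partial_sum_le[OF AB(3)] partial_sum_le[OF AB(4)] by simp
  finally show ?thesis by simp
qed

end

section \<open>Polynomial estimates and the Laplace transform of the supremum\<close>

lemma quintic_ge:
  fixes p :: real
  assumes "0 \<le> p"
  shows "256 / 125 * p\<^sup>2 - 768 / 625 * p \<le> p ^ 5"
proof -
  \<comment> \<open>The lower bound is \<open>p\<close> times the tangent of \<open>p ^ 4\<close> at
    \<open>4 / 5\<close>, and the gap is \<open>p\<close> times a sum of squares. The tangent point
    lies close to the minima of the two quintics that it serves, where they are barely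
    positive.\<close>
  have "0 \<le> p * (p\<^sup>2 - 16 / 25)\<^sup>2 + 32 / 25 * p * (p - 4 / 5)\<^sup>2" using assms by simp
  also have "\<dots> = p ^ 5 - (256 / 125 * p\<^sup>2 - 768 / 625 * p)"
    by (simp add: algebra_simps power2_eq_square power_numeral_reduce)
  finally show ?thesis by simp
qed

text \<open>With \<open>p = 1 - l / 2\<close>, these compare the coefficients of \<open>v\<close>
  and of the mean of \<open>Z\<close> in \<open>lmgf_Z_le\<close>, after
  \<open>exp (- (2 * l))\<close> has been replaced by its lower bound \<open>p ^ 4\<close>.\<close>

lemma quintic_bounds:
  fixes p :: real
  assumes "0 \<le> p"
  shows "(4 * p - 3) * (1 + p) \<le> 5 / 4 * p * (2 * p ^ 4 - 2 * (1 - p))"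
    and "4 * p - 3 \<le> 11 / 16 * p * (2 * p ^ 4 - 2 * (1 - p))"
proof -
  \<comment> \<open>Approximate minimisers of the two quadratics that remain once
    \<open>p ^ 5\<close> is replaced by its lower bound.\<close>
  have "0 \<le> (p - 227 / 250)\<^sup>2" "0 \<le> (p - 843 / 1000)\<^sup>2" by simp_all
  then have sq: "0 \<le> p\<^sup>2 - 227 / 125 * p + (227 / 250)\<^sup>2" "0 \<le> p\<^sup>2 - 843 / 500 * p + (843 / 1000)\<^sup>2"
    by (simp_all add: power2_diff)
  have "5 / 4 * p * (2 * p ^ 4 - 2 * (1 - p)) - (4 * p - 3) * (1 + p) = 5 / 2 * p ^ 5 - 3 / 2 * p\<^sup>2 - 7 / 2 * p + 3"
    by (simp add: algebra_simps power2_eq_square power_numeral_reduce)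
  moreover have "0 \<le> 5 / 2 * p ^ 5 - 3 / 2 * p\<^sup>2 - 7 / 2 * p + 3"
    using quintic_ge[OF assms] sq(1) assms by (simp add: power2_eq_square[of "227 / 250"])
  ultimately show "(4 * p - 3) * (1 + p) \<le> 5 / 4 * p * (2 * p ^ 4 - 2 * (1 - p))" by linarith
  have "11 / 16 * p * (2 * p ^ 4 - 2 * (1 - p)) - (4 * p - 3) = 11 / 8 * p ^ 5 + 11 / 8 * p\<^sup>2 - 43 / 8 * p + 3"
    by (simp add: algebra_simps power2_eq_square power_numeral_reduce)
  moreover have "0 \<le> 11 / 8 * p ^ 5 + 11 / 8 * p\<^sup>2 - 43 / 8 * p + 3"
    using quintic_ge[OF assms] sq(2) assms by (simp add: power2_eq_square[of "843 / 1000"])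
  ultimately show "4 * p - 3 \<le> 11 / 16 * p * (2 * p ^ 4 - 2 * (1 - p))" by linarith
qed

context bounded_process
begin

lemma var_nonneg: "0 \<le> v"
proof -
  obtain r where "r \<in> F" using F by auto
  moreover have "0 \<le> (\<Sum>i\<in>I. \<integral>x. (f r i x)\<^sup>2 \<partial>M i)" by (intro sum_nonneg) simp
  ultimately show ?thesis using var[of r] by simp
qed

text \<open>\<open>ent_Z_le\<close> still contains \<open>W\<close> under the weight
  \<open>exp (s * Z)\<close>. Duality trades it for the Laplace transform of \<open>W\<close>, at
  the price of the entropy of \<open>s * Z\<close> itself; the entropy then stands on both sides,
  and the inequality is solved for it. For every \<open>s \<le> l\<close> the duality is used with
  the same multiple \<open>l * W\<close>, so the constant \<open>C\<close> does not depend on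
  \<open>s\<close>.\<close>

lemma lmgf_Z_le:
  assumes l: "0 < l" "l < 1 / 2"
  shows "lmgf P Z l \<le> l * (\<integral>x. Z x \<partial>P) + (5 / 4 * v + 11 / 2 * (\<integral>x. Z x \<partial>P)) / (1 - 2 * l) * l\<^sup>2"
proof -
  define E where "E = (\<integral>x. Z x \<partial>P)"
  define k where "k = exp (2 * l) / 2"
  define p where "p = 1 - l / 2"
  \<comment> \<open>Once the entropy terms are collected on the left, their coefficient is at least
    \<open>1 - k * l = k * d\<close>, so the inequality can be solved exactly when \<open>d\<close>
    is positive.\<close>
  define d where "d = 1 / k - l"
  have E0: "0 \<le> E" using expectation_Z_nonneg by (simp add: E_def)
  have k0: "0 < k" by (simp add: k_def)
  have p0: "3 / 4 < p" "p < 1" using l by (simp_all add: p_def)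
  have l12: "1 - 2 * l = 4 * p - 3" "l = 2 * (1 - p)" by (simp_all add: p_def)
  have EW: "(\<integral>x. W x \<partial>P) \<le> v + 8 * E" using expectation_W_le by (simp add: E_def)
  \<comment> \<open>The fourth power of \<open>1 - l / 2 \<le> exp (- (l / 2))\<close>: it bounds
    \<open>1 / k\<close>, hence \<open>d\<close>, below by a polynomial in \<open>p\<close>.\<close>
  have "p ^ 4 \<le> exp (- (l / 2)) ^ 4"
    using p0 exp_ge_add_one_self[of "- (l / 2)"] by (intro power_mono) (auto simp: p_def)
  also have "\<dots> = exp (- (2 * l))" by (simp add: exp_of_nat_mult[symmetric])
  finally have "2 * p ^ 4 \<le> 1 / k" by (simp add: k_def exp_minus field_simps)
  then have d: "2 * p ^ 4 - 2 * (1 - p) \<le> d" unfolding d_def l12(2)[symmetric] by simp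
  have a: "(4 * p - 3) * (1 + p) \<le> 5 / 4 * p * d" "4 * p - 3 \<le> 11 / 16 * p * d"
    using quintic_bounds[of p] p0 mult_left_mono[OF d, of "5 / 4 * p"] mult_left_mono[OF d, of "11 / 16 * p"]
    by linarith+
  then have "0 < 11 / 16 * p * d" using p0 by linarith
  then have d0: "0 < d" using p0 by (simp add: zero_less_mult_iff)
  have kl: "k * l = 1 - k * d" using k0 by (simp add: d_def algebra_simps)
  define C where "C = (v + (v + 8 * E) / p) / d"
  have "lmgf P Z l \<le> l * (\<integral>x. Z x \<partial>P) + C * l\<^sup>2"
  proof (rule herbst[OF P bdd_meas_Z l(1)])
    fix s assume s: "0 < s" "s \<le> l"
    define m where "m = (\<integral>x. exp (s * Z x) \<partial>P)"
    define e where "e = ent P (\<lambda>x. s * Z x)"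
    define w where "w = (\<integral>x. exp (s * Z x) * W x \<partial>P)"
    have bs: "bdd_meas P (\<lambda>x. s * Z x)" by (intro bdd_meas_intros bdd_meas_Z)
    have m0: "0 < m" unfolding m_def by (intro bdd_meas_integral_exp_pos P bs)
    have e0: "0 \<le> e" unfolding e_def by (rule ent_nonneg[OF P bs])
    have "(\<integral>x. exp (s * Z x) * (W x + v) \<partial>P) = (\<integral>x. exp (s * Z x) * W x + v * exp (s * Z x) \<partial>P)"
      by (simp add: algebra_simps)
    also have "\<dots> = w + v * m"
      unfolding w_def m_def
      by (subst Bochner_Integration.integral_add) (auto intro!: bdd_meas_integrable[OF P] bdd_meas_intros bdd_meas_Z bdd_meas_W)
    finally have wv: "(\<integral>x. exp (s * Z x) * (W x + v) \<partial>P) = w + v * m" .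
    have W0: "0 \<le> W x" for x
    proof -
      obtain q where "q \<in> F" using F by auto
      then show ?thesis unfolding W_def
        by (intro order_trans[OF _ MAX_geI[OF F(1)]] sum_nonneg) auto
    qed
    have w0: "0 \<le> w" unfolding w_def by (intro Bochner_Integration.integral_nonneg) (simp add: W0)
    have "l * w = (\<integral>x. exp (s * Z x) * (l * W x) \<partial>P)" by (simp add: w_def mult_ac flip: integral_mult_right_zero)
    also have "\<dots> \<le> e + m * lmgf P W l"
      unfolding e_def m_def lmgf_def by (intro ent_duality P bs bdd_meas_intros bdd_meas_W)
    also have "\<dots> \<le> e + m * (l / p * (v + 8 * E))"
    proof -
      have "lmgf P W l \<le> l / p * (\<integral>x. W x \<partial>P)" using lmgf_W_le[of l] l by (simp add: p_def)
      also have "\<dots> \<le> l / p * (v + 8 * E)" using EW l p0 by (intro mult_left_mono) auto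
      finally show ?thesis using m0 by (intro add_left_mono mult_left_mono) auto
    qed
    finally have lw: "l * w \<le> e + l * (m * ((v + 8 * E) / p))" by (simp add: mult.left_commute)
    have "e \<le> s\<^sup>2 / 2 * exp (2 * s) * (w + v * m)"
      using ent_Z_le[OF s(1)] by (simp add: e_def wv)
    also have "\<dots> \<le> s\<^sup>2 / 2 * exp (2 * l) * (w + v * m)"
      using s w0 var_nonneg m0 by (intro mult_right_mono mult_left_mono) auto
    also have "\<dots> = k * s\<^sup>2 * (w + v * m)" by (simp add: k_def)
    finally have e1: "e \<le> k * s\<^sup>2 * (w + v * m)" .
    have "k * s\<^sup>2 * w \<le> k * s\<^sup>2 * ((e + l * (m * ((v + 8 * E) / p))) / l)"
      using lw l k0 by (intro mult_left_mono) (auto simp: field_simps)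
    also have "\<dots> = k * s\<^sup>2 / l * e + k * s\<^sup>2 * (m * ((v + 8 * E) / p))"
      using l by (simp add: field_simps)
    also have "k * s\<^sup>2 / l * e \<le> k * l * e"
    proof (intro mult_right_mono e0)
      have "s\<^sup>2 \<le> l\<^sup>2" using s by (intro power_mono) auto
      then show "k * s\<^sup>2 / l \<le> k * l" using l k0 by (simp add: divide_le_eq power2_eq_square)
    qed
    finally have "k * s\<^sup>2 * w \<le> (1 - k * d) * e + k * s\<^sup>2 * (m * ((v + 8 * E) / p))" unfolding kl by simp
    then have "k * (d * e) \<le> k * (s\<^sup>2 * (m * (v + (v + 8 * E) / p)))"
      using e1 by (simp add: algebra_simps)
    then have "d * e \<le> s\<^sup>2 * (m * (v + (v + 8 * E) / p))" using k0 by simp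
    then have "e \<le> s\<^sup>2 * (m * (v + (v + 8 * E) / p)) / d"
      using d0 by (simp add: pos_le_divide_eq mult.commute)
    then show "ent P (\<lambda>x. s * Z x) \<le> C * s\<^sup>2 * (\<integral>x. exp (s * Z x) \<partial>P)"
      by (simp add: C_def e_def m_def mult_ac)
  qed
  moreover have "C \<le> (5 / 4 * v + 11 / 2 * E) / (4 * p - 3)"
  proof -
    have "(4 * p - 3) * (v + (v + 8 * E) / p) = ((4 * p - 3) * (1 + p) * v + (4 * p - 3) * (8 * E)) / p"
      using p0 by (simp add: field_simps)
    also have "\<dots> \<le> (5 / 4 * p * d * v + 11 / 16 * p * d * (8 * E)) / p"
      using p0 a var_nonneg E0 by (intro divide_right_mono add_mono mult_right_mono) auto
    also have "\<dots> = (5 / 4 * v + 11 / 2 * E) * d" using p0 by (simp add: field_simps)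
    finally show ?thesis unfolding C_def using d0 p0 by (simp add: field_simps)
  qed
  then have "C * l\<^sup>2 \<le> (5 / 4 * v + 11 / 2 * E) / (4 * p - 3) * l\<^sup>2" by (intro mult_right_mono) auto
  ultimately show ?thesis unfolding l12(1) E_def by linarith
qed

lemma Z_tail:
  assumes r: "0 < r" and E: "(\<integral>x. Z x \<partial>P) \<le> E"
    and u: "E + r / 8 * (5 / 4 * v + 11 / 2 * E) + (8 / r + 2) * y \<le> u"
  shows "measure P {x \<in> space P. Z x \<ge> u} \<le> exp (- y)"
proof -
  interpret P: prob_space P by (rule P)
  define l where "l = r / (8 + 2 * r)"
  have l: "0 < l" "l < 1 / 2" using r by (simp_all add: l_def field_simps)
  have lr: "l / (1 - 2 * l) = r / 8" "1 / l = 8 / r + 2" using r by (simp_all add: l_def field_simps)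
  define G where "G = 5 / 4 * v + 11 / 2 * (\<integral>x. Z x \<partial>P)"
  have int: "integrable P (\<lambda>x. exp (l * Z x))"
    by (intro bdd_meas_integrable[OF P] bdd_meas_intros bdd_meas_Z)
  have "measure P {x \<in> space P. Z x \<ge> u} \<le> exp (- l * u) * (\<integral>x\<in>space P. exp (l * Z x) \<partial>P)"
    by (rule P.Chernoff_ineq_ge[OF l(1)])
      (simp_all add: set_integrable_def integrable_mult_indicator[OF _ int, simplified])
  also have "(\<integral>x\<in>space P. exp (l * Z x) \<partial>P) = (\<integral>x. exp (l * Z x) \<partial>P)"
    by (rule set_integral_space[OF int])
  also have "\<dots> = exp (lmgf P Z l)"
    unfolding lmgf_def using bdd_meas_integral_exp_pos[OF P, of "\<lambda>x. l * Z x"] by (simp add: bdd_meas_intros bdd_meas_Z)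
  also have "exp (- l * u) * \<dots> = exp (lmgf P Z l - l * u)" by (simp add: exp_add[symmetric] algebra_simps)
  also have "\<dots> \<le> exp (- y)"
  proof -
    have "lmgf P Z l \<le> l * (\<integral>x. Z x \<partial>P) + G / (1 - 2 * l) * l\<^sup>2"
      using lmgf_Z_le[OF l] by (simp add: G_def)
    also have "\<dots> = l * ((\<integral>x. Z x \<partial>P) + l / (1 - 2 * l) * G)"
      by (simp add: power2_eq_square algebra_simps)
    also have "\<dots> \<le> l * (E + r / 8 * (5 / 4 * v + 11 / 2 * E))"
      unfolding lr G_def using l r E by (intro mult_left_mono add_mono) auto
    also have "\<dots> \<le> l * (u - 1 / l * y)"
      unfolding lr using u l by (intro mult_left_mono) auto
    also have "\<dots> = l * u - y" using l by (simp add: algebra_simps)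
    finally show ?thesis by simp
  qed
  finally show ?thesis .
qed

end

section \<open>Countable families and peeling\<close>

text \<open>By independence the observation has the product law, which carries \<open>Z_tail\<close>
  over to \<Omega>. Each function is centred and enters with both signs, the boolean component of
  the index, so that \<open>Z\<close> is the supremum of the absolute values.\<close>

lemma finite_sup_tail:
  fixes g :: "'q \<Rightarrow> 'i \<Rightarrow> 'a \<Rightarrow> real" and X :: "'i \<Rightarrow> 'b \<Rightarrow> 'a"
  defines "S \<equiv> \<lambda>\<Omega> \<mu> I Q \<omega>. \<Sum>i\<in>I. g Q i (X i \<omega>) - (\<integral>x. g Q i x \<partial>distr \<Omega> \<mu> (X i))"
  assumes \<Omega>: "prob_space \<Omega>" and fin: "finite I" and ne: "I \<noteq> {}"
    and indep: "prob_space.indep_vars \<Omega> (\<lambda>_. \<mu>) X I"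
    and B: "finite B"
    and g: "\<And>Q i. Q \<in> B \<Longrightarrow> i \<in> I \<Longrightarrow> g Q i \<in> borel_measurable \<mu>"
    and osc: "\<And>Q i x y. Q \<in> B \<Longrightarrow> i \<in> I \<Longrightarrow> x \<in> space \<mu> \<Longrightarrow> y \<in> space \<mu> \<Longrightarrow> g Q i x - g Q i y \<le> 1"
    and var: "\<And>Q. Q \<in> B \<Longrightarrow> (\<Sum>i\<in>I. \<integral>x. (g Q i x - (\<integral>x. g Q i x \<partial>distr \<Omega> \<mu> (X i)))\<^sup>2 \<partial>distr \<Omega> \<mu> (X i)) \<le> v"
    and mean: "(\<integral>\<^sup>+\<omega>. (SUP Q\<in>B. ennreal \<bar>S \<Omega> \<mu> I Q \<omega>\<bar>) \<partial>\<Omega>) \<le> ennreal E" "0 \<le> E"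
    and r: "0 < r"
    and u: "E + r / 8 * (5 / 4 * v + 11 / 2 * E) + (8 / r + 2) * y \<le> u"
  shows "measure \<Omega> {\<omega> \<in> space \<Omega>. \<exists>Q\<in>B. u < \<bar>S \<Omega> \<mu> I Q \<omega>\<bar>} \<le> exp (- y)"
proof (cases "B = {}")
  case True
  then show ?thesis by simp
next
  case False
  interpret \<Omega>: prob_space \<Omega> by fact
  obtain i0 where i0: "i0 \<in> I" using ne by auto
  \<comment> \<open>Outside \<open>I\<close> the law of \<open>X i0\<close> fills in, since the
    process needs a probability measure at every index.\<close>
  define M where "M = (\<lambda>i. distr \<Omega> \<mu> (X (if i \<in> I then i else i0)))"
  have X: "X i \<in> measurable \<Omega> \<mu>" if "i \<in> I" for i
    using indep that by (auto simp: \<Omega>.indep_vars_def)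
  have M: "prob_space (M i)" for i
    unfolding M_def using i0 by (intro \<Omega>.prob_space_distr X) auto
  have Mi: "M i = distr \<Omega> \<mu> (X i)" if "i \<in> I" for i using that by (simp add: M_def)
  define m where "m = (\<lambda>Q i. \<integral>x. g Q i x \<partial>M i)"
  define f where "f = (\<lambda>(Q, b) i x. (if b then 1 else - 1) * (g Q i x - m Q i))"
  have bg: "bdd_meas (M i) (g Q i)" if "Q \<in> B" "i \<in> I" for Q i
  proof -
    obtain y where "y \<in> space \<mu>" using prob_space.not_empty[OF M[of i]] by (auto simp: M_def)
    then show ?thesis using osc[OF that] g[OF that]
      by (intro bdd_measI[of _ _ "\<bar>g Q i y\<bar> + 1"]) (force simp: M_def abs_le_iff)+
  qed
  interpret bounded_process M I "B \<times> UNIV" f v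
  proof (rule bounded_process.intro)
    show "prob_space (M i)" for i by (rule M)
  next
    fix q i assume "q \<in> B \<times> (UNIV :: bool set)" and i: "i \<in> I"
    then obtain Q b where q: "q = (Q, b)" "Q \<in> B" by auto
    interpret prob_space "M i" by (rule M)
    show "f q i \<in> borel_measurable (M i)" using g[OF q(2) i] by (cases b) (auto simp: f_def q M_def)
    have "(\<integral>x. g Q i x - m Q i \<partial>M i) = 0"
      using bdd_meas_integrable[OF M bg[OF q(2) i]] by (simp add: m_def prob_space)
    then show "(\<integral>x. f q i x \<partial>M i) = 0" by (simp add: f_def q)
    fix x y assume "x \<in> space (M i)" "y \<in> space (M i)"
    then show "f q i x - f q i y \<le> 1"
      using osc[OF q(2) i, of x y] osc[OF q(2) i, of y x] by (auto simp: f_def q M_def)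
  next
    fix q assume "q \<in> B \<times> (UNIV :: bool set)"
    then obtain Q b where q: "q = (Q, b)" "Q \<in> B" by auto
    have "(f q i x)\<^sup>2 = (g Q i x - m Q i)\<^sup>2" for i x by (simp add: f_def q power_mult_distrib)
    then have "(\<Sum>i\<in>I. \<integral>x. (f q i x)\<^sup>2 \<partial>M i) = (\<Sum>i\<in>I. \<integral>x. (g Q i x - m Q i)\<^sup>2 \<partial>M i)" by simp
    also have "\<dots> = (\<Sum>i\<in>I. \<integral>x. (g Q i x - (\<integral>x. g Q i x \<partial>distr \<Omega> \<mu> (X i)))\<^sup>2 \<partial>distr \<Omega> \<mu> (X i))"
      by (intro sum.cong refl) (simp add: Mi m_def)
    finally show "(\<Sum>i\<in>I. \<integral>x. (f q i x)\<^sup>2 \<partial>M i) \<le> v" using var[OF q(2)] by simp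
    show "\<exists>q'\<in>B \<times> (UNIV :: bool set). \<forall>i\<in>I. \<forall>x\<in>space (M i). f q' i x = - f q i x"
      using q by (intro bexI[of _ "(Q, \<not> b)"]) (auto simp: f_def)
  qed (use fin B False in auto)
  define obs where "obs = (\<lambda>\<omega>. \<lambda>i\<in>I. X i \<omega>)"
  have obs: "obs \<in> measurable \<Omega> P"
  proof -
    have "obs \<in> measurable \<Omega> (PiM I (\<lambda>_. \<mu>))" unfolding obs_def by (intro measurable_restrict X)
    also have "sets (PiM I (\<lambda>_. \<mu>)) = sets P" by (intro sets_PiM_cong) (auto simp: M_def)
    then have "measurable \<Omega> (PiM I (\<lambda>_. \<mu>)) = measurable \<Omega> P" by (intro measurable_cong_sets) auto
    finally show ?thesis .
  qed
  have distr: "distr \<Omega> P obs = P"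
  proof -
    have "distr \<Omega> P obs = distr \<Omega> (PiM I (\<lambda>_. \<mu>)) obs"
      by (intro distr_cong refl sets_PiM_cong) (auto simp: M_def)
    also have "\<dots> = (\<Pi>\<^sub>M i\<in>I. distr \<Omega> \<mu> (X i))"
      using \<Omega>.indep_vars_iff_distr_eq_PiM'[where I=I and M'="\<lambda>_. \<mu>" and X=X, OF ne X] indep by (simp add: obs_def)
    also have "\<dots> = P" by (intro PiM_cong) (simp_all add: Mi)
    finally show ?thesis .
  qed
  have Sf: "(\<Sum>i\<in>I. f (Q, b) i (obs \<omega> i)) = (if b then 1 else - 1) * S \<Omega> \<mu> I Q \<omega>" for Q b \<omega>
    unfolding S_def sum_distrib_left by (intro sum.cong) (auto simp: f_def obs_def m_def Mi)
  have ZS: "\<bar>S \<Omega> \<mu> I Q \<omega>\<bar> \<le> Z (obs \<omega>)" if "Q \<in> B" for Q \<omega>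
    using MAX_geI[OF F(1), of "(Q, True)" "\<lambda>q. \<Sum>i\<in>I. f q i (obs \<omega> i)"]
      MAX_geI[OF F(1), of "(Q, False)" "\<lambda>q. \<Sum>i\<in>I. f q i (obs \<omega> i)"] that
    unfolding Z_def Sf by auto
  have Z_le: "\<exists>Q\<in>B. Z (obs \<omega>) \<le> \<bar>S \<Omega> \<mu> I Q \<omega>\<bar>" for \<omega>
  proof -
    obtain q where q: "q \<in> B \<times> (UNIV :: bool set)" "Z (obs \<omega>) = (\<Sum>i\<in>I. f q i (obs \<omega> i))"
      unfolding Z_def by (rule MAX_attained[OF F])
    then obtain Q b where "q = (Q, b)" "Q \<in> B" by auto
    then show ?thesis using q(2) Sf[of Q b \<omega>] by (intro bexI[of _ Q]) auto
  qed
  have "ennreal (\<integral>x. Z x \<partial>P) \<le> ennreal E"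
  proof -
    have "0 \<le> Z (obs \<omega>)" for \<omega> using False ZS abs_ge_zero by (meson all_not_in_conv order_trans)
    then have "ennreal (\<integral>\<omega>. Z (obs \<omega>) \<partial>\<Omega>) = (\<integral>\<^sup>+\<omega>. ennreal (Z (obs \<omega>)) \<partial>\<Omega>)"
      by (intro nn_integral_eq_integral[symmetric] bdd_meas_integrable[OF \<Omega>] bdd_meas_comp[OF bdd_meas_Z obs]) auto
    also have "\<dots> \<le> (\<integral>\<^sup>+\<omega>. (SUP Q\<in>B. ennreal \<bar>S \<Omega> \<mu> I Q \<omega>\<bar>) \<partial>\<Omega>)"
    proof (rule nn_integral_mono)
      fix \<omega>
      obtain Q where "Q \<in> B" "Z (obs \<omega>) \<le> \<bar>S \<Omega> \<mu> I Q \<omega>\<bar>" using Z_le by blast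
      then show "ennreal (Z (obs \<omega>)) \<le> (SUP Q\<in>B. ennreal \<bar>S \<Omega> \<mu> I Q \<omega>\<bar>)"
        by (intro SUP_upper2[of Q]) (auto intro: ennreal_leI)
    qed
    also have "(\<integral>\<omega>. Z (obs \<omega>) \<partial>\<Omega>) = (\<integral>x. Z x \<partial>P)"
      using integral_distr[OF obs bdd_meas_measurable[OF bdd_meas_Z]] by (simp add: distr)
    finally show ?thesis using mean(1) by simp
  qed
  then have EZ: "(\<integral>x. Z x \<partial>P) \<le> E" using mean(2) by simp
  have [measurable]: "Z \<in> borel_measurable P" by (rule bdd_meas_measurable[OF bdd_meas_Z])
  have "measure \<Omega> {\<omega> \<in> space \<Omega>. \<exists>Q\<in>B. u < \<bar>S \<Omega> \<mu> I Q \<omega>\<bar>}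
    \<le> measure \<Omega> (obs -` {x \<in> space P. Z x \<ge> u} \<inter> space \<Omega>)"
  proof (rule \<Omega>.finite_measure_mono)
    show "obs -` {x \<in> space P. Z x \<ge> u} \<inter> space \<Omega> \<in> sets \<Omega>"
      by (rule measurable_sets[OF obs]) measurable
    show "{\<omega> \<in> space \<Omega>. \<exists>Q\<in>B. u < \<bar>S \<Omega> \<mu> I Q \<omega>\<bar>} \<subseteq> obs -` {x \<in> space P. Z x \<ge> u} \<inter> space \<Omega>"
      using ZS measurable_space[OF obs] by (force intro: less_imp_le less_le_trans)
  qed
  also have "\<dots> = measure (distr \<Omega> P obs) {x \<in> space P. Z x \<ge> u}"
    by (rule measure_distr[symmetric, OF obs]) measurable
  also have "\<dots> \<le> exp (- y)"
    unfolding distr by (rule Z_tail[OF r EZ u])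
  finally show ?thesis .
qed

text \<open>Phrased with an existential quantifier, the event for \<open>B\<close> is the increasing
  union of the events for its finite initial segments. The mean over a segment is dominated by that
  over \<open>B\<close>, so the finite bound is uniform and passes to the limit.\<close>

lemma countable_sup_tail:
  fixes g :: "'q \<Rightarrow> 'i \<Rightarrow> 'a \<Rightarrow> real" and X :: "'i \<Rightarrow> 'b \<Rightarrow> 'a"
  defines "S \<equiv> \<lambda>\<Omega> \<mu> I Q \<omega>. \<Sum>i\<in>I. g Q i (X i \<omega>) - (\<integral>x. g Q i x \<partial>distr \<Omega> \<mu> (X i))"
  assumes \<Omega>: "prob_space \<Omega>" and I: "finite I" "I \<noteq> {}"
    and indep: "prob_space.indep_vars \<Omega> (\<lambda>_. \<mu>) X I"
    and B: "countable B"
    and g: "\<And>Q i. Q \<in> B \<Longrightarrow> i \<in> I \<Longrightarrow> g Q i \<in> borel_measurable \<mu>"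
    and osc: "\<And>Q i x y. Q \<in> B \<Longrightarrow> i \<in> I \<Longrightarrow> x \<in> space \<mu> \<Longrightarrow> y \<in> space \<mu> \<Longrightarrow> g Q i x - g Q i y \<le> 1"
    and var: "\<And>Q. Q \<in> B \<Longrightarrow> (\<Sum>i\<in>I. \<integral>x. (g Q i x - (\<integral>x. g Q i x \<partial>distr \<Omega> \<mu> (X i)))\<^sup>2 \<partial>distr \<Omega> \<mu> (X i)) \<le> v"
    and mean: "(\<integral>\<^sup>+\<omega>. (SUP Q\<in>B. ennreal \<bar>S \<Omega> \<mu> I Q \<omega>\<bar>) \<partial>\<Omega>) \<le> ennreal E" "0 \<le> E"
    and r: "0 < r"
    and u: "E + r / 8 * (5 / 4 * v + 11 / 2 * E) + (8 / r + 2) * y \<le> u"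
  shows "{\<omega> \<in> space \<Omega>. \<exists>Q\<in>B. u < \<bar>S \<Omega> \<mu> I Q \<omega>\<bar>} \<in> sets \<Omega>" (is "?A \<in> _")
    and "measure \<Omega> {\<omega> \<in> space \<Omega>. \<exists>Q\<in>B. u < \<bar>S \<Omega> \<mu> I Q \<omega>\<bar>} \<le> exp (- y)"
proof -
  interpret \<Omega>: prob_space \<Omega> by fact
  have X: "X i \<in> measurable \<Omega> \<mu>" if "i \<in> I" for i
    using indep that by (auto simp: \<Omega>.indep_vars_def)
  have S: "S \<Omega> \<mu> I Q \<in> borel_measurable \<Omega>" if "Q \<in> B" for Q
    unfolding S_def using measurable_compose[OF X g[OF that]] by (intro borel_measurable_sum borel_measurable_diff) auto
  have meas: "{\<omega> \<in> space \<Omega>. \<exists>Q\<in>C. u < \<bar>S \<Omega> \<mu> I Q \<omega>\<bar>} \<in> sets \<Omega>" if "C \<subseteq> B" for C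
  proof -
    have "countable C" using B that countable_subset by blast
    moreover have "{\<omega> \<in> space \<Omega>. u < \<bar>S \<Omega> \<mu> I Q \<omega>\<bar>} \<in> sets \<Omega>" if "Q \<in> C" for Q
    proof -
      have [measurable]: "S \<Omega> \<mu> I Q \<in> borel_measurable \<Omega>" using S that \<open>C \<subseteq> B\<close> by blast
      show ?thesis by measurable
    qed
    ultimately have "(\<Union>Q\<in>C. {\<omega> \<in> space \<Omega>. u < \<bar>S \<Omega> \<mu> I Q \<omega>\<bar>}) \<in> sets \<Omega>"
      by (intro sets.countable_UN') auto
    also have "(\<Union>Q\<in>C. {\<omega> \<in> space \<Omega>. u < \<bar>S \<Omega> \<mu> I Q \<omega>\<bar>}) = {\<omega> \<in> space \<Omega>. \<exists>Q\<in>C. u < \<bar>S \<Omega> \<mu> I Q \<omega>\<bar>}"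
      by auto
    finally show ?thesis .
  qed
  show "?A \<in> sets \<Omega>" by (rule meas) simp
  show "measure \<Omega> {\<omega> \<in> space \<Omega>. \<exists>Q\<in>B. u < \<bar>S \<Omega> \<mu> I Q \<omega>\<bar>} \<le> exp (- y)"
  proof (cases "B = {}")
    case False
    define C where "C = (\<lambda>k. from_nat_into B ` {..k})"
    define A where "A = (\<lambda>k. {\<omega> \<in> space \<Omega>. \<exists>Q\<in>C k. u < \<bar>S \<Omega> \<mu> I Q \<omega>\<bar>})"
    have C: "C k \<subseteq> B" "finite (C k)" for k
      using from_nat_into[OF False] by (auto simp: C_def)
    have "(\<Union>k. C k) = B"
      using C(1) from_nat_into_surj[OF B] by (force simp: C_def)
    then have UA: "(\<Union>k. A k) = ?A" by (auto simp: A_def)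
    have "incseq A" by (fastforce simp: incseq_def A_def C_def)
    moreover have "range A \<subseteq> sets \<Omega>" using meas[OF C(1)] by (auto simp: A_def)
    ultimately have lim: "(\<lambda>k. measure \<Omega> (A k)) \<longlonglongrightarrow> measure \<Omega> ?A"
      using \<Omega>.finite_Lim_measure_incseq[of A] UA by simp
    have "measure \<Omega> (A k) \<le> exp (- y)" for k
      unfolding A_def S_def
    proof (rule finite_sup_tail[OF \<Omega> I indep C(2) _ _ _ _ mean(2) r u])
      have "(\<integral>\<^sup>+\<omega>. (SUP Q\<in>C k. ennreal \<bar>S \<Omega> \<mu> I Q \<omega>\<bar>) \<partial>\<Omega>) \<le> (\<integral>\<^sup>+\<omega>. (SUP Q\<in>B. ennreal \<bar>S \<Omega> \<mu> I Q \<omega>\<bar>) \<partial>\<Omega>)"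
        using C(1) by (intro nn_integral_mono SUP_subset_mono) auto
      then show "(\<integral>\<^sup>+\<omega>. (SUP Q\<in>C k. ennreal \<bar>\<Sum>i\<in>I. g Q i (X i \<omega>) - (\<integral>x. g Q i x \<partial>distr \<Omega> \<mu> (X i))\<bar>) \<partial>\<Omega>) \<le> ennreal E"
        using mean(1) unfolding S_def by (rule order_trans)
    qed (use C g osc var in blast)+
    then show ?thesis using lim by (intro LIMSEQ_le_const2) auto
  qed simp
qed

text \<open>
  In the peeling lemmas below \<open>r = a1 / a2\<close>, \<open>K = a1 / (2 * c1)\<close>, \<open>L = ln 2\<close>, \<open>N = 2 ^ j\<close> and
  \<open>J = j + 1\<close>; the ring \<open>2 ^ (j - 1) * d < loss \<le> 2 ^ j * d\<close> contributes \<open>a1 / 4 * (2 ^ j * d)\<close>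
  to the threshold, and the innermost ball (\<open>j = 0\<close>) contributes nothing.
\<close>

lemma peeling_exponent_le:
  fixes j :: nat
  assumes "1 \<le> j"
  shows "4 * (real j + 1) \<le> 2 ^ j + 8" "8 * (real j + 1) \<le> 2 ^ j + 24"
proof -
  have N: "1 + real k \<le> 2 ^ k" for k using Bernoulli_inequality[of 1 k] by simp
  \<comment> \<open>Both bounds are equalities at \<open>j = 3\<close>; from there on Bernoulli's
    inequality suffices, and the two smaller values are computed.\<close>
  consider "j = 1" | "j = 2" | "3 \<le> j" using assms by linarith
  then have "4 * (real j + 1) \<le> 2 ^ j + 8 \<and> 8 * (real j + 1) \<le> 2 ^ j + 24"
  proof cases
    case 3
    then obtain k where k: "j = 3 + k" using le_Suc_ex by blast
    show ?thesis using N[of k] by (simp add: k power_add)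
  qed simp_all
  then show "4 * (real j + 1) \<le> 2 ^ j + 8" "8 * (real j + 1) \<le> 2 ^ j + 24" by simp_all
qed

lemma peeling_condition:
  fixes r L N J K :: real
  assumes r: "0 < r" and L: "2 / 3 \<le> L" "L \<le> 1" and K: "K = 2 + 4 * L + 4 * r + 16 * L / r"
    and J: "4 * J \<le> N + 8" "8 * J \<le> N + 24" and N: "0 \<le> N"
  shows "N * (1 + 11 / 16 * r) + (8 / r + 2) * (J * L) \<le> K * (1 + 3 / 16 * N)"
proof -
  define R where "R = 1 / r"
  have R: "0 < R" "r * R = 1" using r by (simp_all add: R_def)
  \<comment> \<open>The arithmetic-geometric mean inequality for \<open>r / 16\<close> and
    \<open>R\<close>, whose product is \<open>1 / 16\<close>. It has to offset the constant
    \<open>- 5 / 8\<close> in the bracket multiplying \<open>N\<close> below, for which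
    \<open>L / 2\<close> may be too small.\<close>
  have "0 \<le> R * (r / 4 - 1)\<^sup>2" using R by simp
  also have "R * (r / 4 - 1)\<^sup>2 = r * (r * R) / 16 - r * R / 2 + R"
    by (simp add: power2_eq_square algebra_simps)
  finally have am: "1 / 2 \<le> r / 16 + R" using R by simp
  have "1 / 3 \<le> (r / 16 + 2 / 3 * R)" using am r by simp
  also have "\<dots> \<le> r / 16 + L * R" using L R by simp
  finally have "0 \<le> L / 2 - 5 / 8 + (r / 16 + L * R)" using L by linarith
  then have 1: "0 \<le> N * (L / 2 - 5 / 8 + (r / 16 + L * R))" using N by simp
  have 2: "0 \<le> L * (N / 4 + 6 - 2 * J)" using L J by (intro mult_nonneg_nonneg) auto
  have 3: "0 \<le> (L * R) * (16 + 2 * N - 8 * J)" using L R J by (intro mult_nonneg_nonneg) auto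
  have "K * (1 + 3 / 16 * N) - (N * (1 + 11 / 16 * r) + (8 / r + 2) * (J * L))
    = N * (L / 2 - 5 / 8 + (r / 16 + L * R)) + L * (N / 4 + 6 - 2 * J) + (L * R) * (16 + 2 * N - 8 * J) + (2 - 2 * L) + 4 * r"
    unfolding K by (simp add: R_def algebra_simps)
  then show ?thesis using 1 2 3 L r by linarith
qed

section \<open>The oracle inequality\<close>

lemma test_family_osc:
  assumes "test_family \<mu> \<P> \<M> loss a0 a1 a2 t" "P \<in> \<M>" "Q \<in> \<M>" "x \<in> space \<mu>" "y \<in> space \<mu>"
  shows "t P Q x - t P Q y \<le> 1"
proof -
  have "ereal (t P Q x) - ereal (t P Q y) \<le> (SUP x\<in>space \<mu>. ereal (t P Q x)) - (INF x\<in>space \<mu>. ereal (t P Q x))"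
    using assms(4,5) by (intro ereal_minus_mono SUP_upper INF_lower)
  also have "\<dots> \<le> 1" using assms(1-3) unfolding test_family_def by blast
  finally show ?thesis by (simp add: one_ereal_def)
qed

lemma sum_half_powers: "(\<lambda>j. c * (1 / 2) ^ Suc j) sums (c :: real)"
  using sums_mult[OF power_half_series, of c] by simp

lemma c1_eq:
  assumes "0 < a1" "0 < a2"
  defines "K \<equiv> 2 + 4 * ln 2 + 4 * (a1 / a2) + 16 * ln 2 / (a1 / a2)"
  shows "c1 a1 a2 = a1 / (2 * K)" "0 < K" "0 < c1 a1 a2"
proof -
  have "ln (4 :: real) = 2 * ln 2" using ln_realpow[of 2 2] by simp
  then have K: "2 * (1 + ln 4) + 4 * a1 / a2 + 16 * a2 * ln 2 / a1 = K" by (simp add: K_def)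
  show eq: "c1 a1 a2 = a1 / (2 * K)" unfolding c1_def K divide_inverse[symmetric] by simp
  have "0 < ln (2 :: real)" "0 < a1 / a2" "0 < 16 * ln 2 / (a1 / a2)" using assms(1,2) by simp_all
  then show K: "0 < K" unfolding K_def by linarith
  show "0 < c1 a1 a2" unfolding eq using K assms(1,2) by simp
qed

text \<open>The left-hand side is the threshold of the tail bound on the ball of radius
  \<open>2 ^ j * d\<close>, with \<open>E\<close> the mean allowed by the definition of
  \<open>D\<close> and confidence \<open>\<xi> + (j + 1) * ln 2\<close>. Writing
  \<open>a1 = 2 * K * c1\<close> turns each term linear in \<open>d\<close> into a multiple of
  \<open>c1 * d\<close>.\<close>

lemma peeling_threshold:
  fixes a1 a2 d ls \<xi> :: real and j :: nat
  assumes a: "0 < a1" "0 < a2" and d: "1 / c1 a1 a2 \<le> d" and ls: "0 \<le> ls"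
  defines "E \<equiv> c1 a1 a2 * (2 ^ j * d)"
  shows "E + a1 / a2 / 8 * (5 / 4 * (a2 * (ls + 2 ^ j * d)) + 11 / 2 * E) + (8 / (a1 / a2) + 2) * (\<xi> + (real j + 1) * ln 2)
    \<le> (if j = 0 then 0 else a1 / 4 * (2 ^ j * d)) + (a1 / 4 * ls + a1 / 2 * d + (8 / (a1 / a2) + 2) * \<xi>)"
proof -
  define r where "r = a1 / a2"
  define K where "K = 2 + 4 * ln 2 + 4 * r + 16 * ln 2 / r"
  define c where "c = c1 a1 a2"
  define N where "N = (2 :: real) ^ j"
  define J where "J = real j + 1"
  define \<delta> where "\<delta> = c * d"
  have r: "0 < r" "a1 = r * a2" using a by (simp_all add: r_def)
  have c: "c = a1 / (2 * K)" "0 < K" "0 < c" using c1_eq[OF a] by (simp_all add: c_def K_def r_def)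
  have ca: "a1 = 2 * K * c" using c by simp
  have \<delta>: "1 \<le> \<delta>" using d c(3) by (simp add: \<delta>_def c_def[symmetric] field_simps)
  have N: "0 \<le> N" by (simp add: N_def)
  define m where "m = (8 / r + 2) * (J * ln 2)"
  have m0: "0 \<le> m" using r by (simp add: m_def J_def)
  have "N * (1 + 11 / 16 * r) + 5 / 16 * K * N + m \<le> K + (if j = 0 then 0 else K * N / 2)"
  proof (cases "j = 0")
    \<comment> \<open>The innermost ball gives no lower bound on the loss, so \<open>K\<close> alone
      has to cover everything.\<close>
    case True
    define x where "x = ln 2 / r"
    have "0 \<le> x" using r by (simp add: x_def)
    then have "1 + 11 / 16 * r + 5 / 16 * (2 + 4 * ln 2 + 4 * r + 16 * x) + (8 * x + 2 * ln 2)
        \<le> 2 + 4 * ln 2 + 4 * r + 16 * x"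
      using r(1) ln2_ge_two_thirds by argo
    moreover have "m = 8 * x + 2 * ln 2" "K = 2 + 4 * ln 2 + 4 * r + 16 * x" "N = 1"
      using True by (simp_all add: m_def J_def K_def N_def x_def algebra_simps)
    ultimately show ?thesis using True by simp
  next
    case False
    then have "N * (1 + 11 / 16 * r) + m \<le> K * (1 + 3 / 16 * N)"
      unfolding m_def
      by (intro peeling_condition[OF r(1) ln2_ge_two_thirds _ K_def _ _ N])
        (use ln_2_less_1 peeling_exponent_le[of j] in \<open>simp_all add: J_def N_def\<close>)
    then show ?thesis using False by (simp add: algebra_simps)
  qed
  \<comment> \<open>The lower bound \<open>1 / c1\<close> on \<open>d\<close> enters here: the
    union-bound cost \<open>m\<close> does not grow with \<open>d\<close>, and
    \<open>1 \<le> \<delta>\<close> lets it scale with the other terms.\<close>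
  then have "\<delta> * (N * (1 + 11 / 16 * r) + 5 / 16 * K * N + m) \<le> \<delta> * (K + (if j = 0 then 0 else K * N / 2))"
    using \<delta> by (intro mult_left_mono) auto
  moreover have "m \<le> \<delta> * m" using mult_right_mono[OF \<delta> m0] by simp
  ultimately have main: "\<delta> * N * (1 + 11 / 16 * r) + 5 / 16 * K * N * \<delta> + m \<le> K * \<delta> + (if j = 0 then 0 else K * N * \<delta> / 2)"
    by (auto simp: algebra_simps)
  have E: "E = \<delta> * N" by (simp add: E_def \<delta>_def c_def N_def)
  have eqs: "r / 8 * (5 / 4 * (a2 * (ls + N * d))) = 5 / 32 * a1 * ls + 5 / 16 * K * N * \<delta>"
    "a1 / 4 * (N * d) = K * N * \<delta> / 2" "a1 / 2 * d = K * \<delta>"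
  proof -
    have "r / 8 * (5 / 4 * (a2 * (ls + N * d))) = 5 / 32 * (r * a2) * (ls + N * d)" by simp
    also have "\<dots> = 5 / 32 * a1 * ls + 5 / 32 * a1 * (N * d)" unfolding r(2)[symmetric] by (simp add: algebra_simps)
    also have "5 / 32 * a1 * (N * d) = 5 / 16 * K * N * \<delta>" unfolding ca \<delta>_def by simp
    finally show "r / 8 * (5 / 4 * (a2 * (ls + N * d))) = 5 / 32 * a1 * ls + 5 / 16 * K * N * \<delta>" .
    show "a1 / 4 * (N * d) = K * N * \<delta> / 2" "a1 / 2 * d = K * \<delta>" unfolding ca \<delta>_def by simp_all
  qed
  have "E + r / 8 * (5 / 4 * (a2 * (ls + N * d)) + 11 / 2 * E) + (8 / r + 2) * (\<xi> + J * ln 2)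
    = (\<delta> * N * (1 + 11 / 16 * r) + 5 / 16 * K * N * \<delta> + m) + 5 / 32 * a1 * ls + (8 / r + 2) * \<xi>"
    unfolding distrib_left[of "r / 8"] eqs E m_def by (simp add: algebra_simps)
  also have "\<dots> \<le> (K * \<delta> + (if j = 0 then 0 else K * N * \<delta> / 2)) + a1 / 4 * ls + (8 / r + 2) * \<xi>"
  proof -
    \<comment> \<open>The coefficient \<open>5 / 32\<close> of \<open>a1 * ls\<close> is rounded up
      to \<open>1 / 4\<close>, the origin of the \<open>+ 1\<close> in the theorem's factor of the
      loss of \<open>Pbar\<close>.\<close>
    have "0 \<le> a1 * ls" using a ls by simp
    then show ?thesis using main by linarith
  qed
  also have "\<dots> = (if j = 0 then 0 else a1 / 4 * (N * d)) + (a1 / 4 * ls + a1 / 2 * d + (8 / r + 2) * \<xi>)"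
    unfolding eqs by simp
  finally show ?thesis unfolding N_def J_def r_def .
qed

theorem theorem2:
  fixes \<mu> :: "'a measure"
    and \<P> :: "'a measure set"
    and \<M> :: "('a set \<Rightarrow> real) set"
    and loss :: "'a measure \<Rightarrow> ('a set \<Rightarrow> real) \<Rightarrow> real"
    and t :: "('a set \<Rightarrow> real) \<Rightarrow> ('a set \<Rightarrow> real) \<Rightarrow> 'a \<Rightarrow> real"
    and a0 a1 a2 \<xi> \<epsilon> :: real
    and n :: nat
    and Model :: "(nat \<Rightarrow> 'a set \<Rightarrow> real) set"
    and Pbar :: "nat \<Rightarrow> 'a set \<Rightarrow> real"
    and Phat :: "(nat \<Rightarrow> 'a) \<Rightarrow> nat \<Rightarrow> 'a set \<Rightarrow> real"
    and Pstar :: "nat \<Rightarrow> 'a measure"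
    and \<Omega> :: "'b measure"
    and X :: "nat \<Rightarrow> 'b \<Rightarrow> 'a"
  assumes "sigma_finite_measure \<mu>"
    and "n \<ge> 1"
    and "\<And>S. S \<in> \<P> \<Longrightarrow> prob_space S \<and> sets S = sets \<mu>"
    and "countable \<M>"
    and "\<M> \<subseteq> finite_signed_densities \<mu>"
    and "\<And>S Q. S \<in> \<P> \<Longrightarrow> Q \<in> \<M> \<Longrightarrow> 0 \<le> loss S Q"
    and "\<exists>S\<in>\<P>. \<exists>Q\<in>\<M>. loss S Q \<noteq> 0"
    and "Model \<noteq> {}"
    and "Model \<subseteq> {1..n} \<rightarrow>\<^sub>E \<M>"
    and "test_family \<mu> \<P> \<M> loss a0 a1 a2 t"
    and "\<xi> > 0"
    and "\<epsilon> > 0"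
    and "Pbar \<in> Model"
    and "l_estimator \<mu> t n Model \<epsilon> Phat"
    and "Pstar \<in> {1..n} \<rightarrow>\<^sub>E \<P>"
    and "prob_space \<Omega>"
    and "prob_space.indep_vars \<Omega> (\<lambda>_. \<mu>) X {1..n}"
    and "\<And>i. i \<in> {1..n} \<Longrightarrow> distr \<Omega> \<mu> (X i) = Pstar i"
  shows "measure \<Omega> {\<omega> \<in> space \<Omega>.
      ereal (total_loss loss n Pstar (Phat (observation n X \<omega>)))
        \<le> ereal ((4 * a0 / a1 + 1) * total_loss loss n Pstar Pbar - model_loss loss n Pstar Model)
          + 2 * D_bound \<Omega> X t loss n Model a1 a2 Pstar Pbar
          + ereal ((4 * a2 / a1 + 1) * (8 * \<xi> / a1) + 2 * \<epsilon> / a1)}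
    \<ge> 1 - exp (- \<xi>)"
proof -
  interpret \<Omega>: prob_space \<Omega> by fact
  define I where "I = {1..n}"
  define L where "L = total_loss loss n Pstar"
  define g where "g = (\<lambda>Q i. t (Pbar i) (Q i))"
  define e where "e = (\<lambda>Q. \<Sum>i\<in>I. \<integral>x. g Q i x \<partial>distr \<Omega> \<mu> (X i))"
  define S where "S = (\<lambda>Q \<omega>. \<Sum>i\<in>I. g Q i (X i \<omega>) - (\<integral>x. g Q i x \<partial>distr \<Omega> \<mu> (X i)))"
  define obs where "obs = observation n X"
  note tf = \<open>test_family \<mu> \<P> \<M> loss a0 a1 a2 t\<close>
  have a: "0 < a0" "0 < a1" "0 < a2" using tf by (auto simp: test_family_def)
  have I: "finite I" "I \<noteq> {}" using \<open>n \<ge> 1\<close> by (auto simp: I_def)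
  have Pst: "Pstar i \<in> \<P>" if "i \<in> I" for i using PiE_mem[OF assms(15)] that by (simp add: I_def)
  have Mod: "Q i \<in> \<M>" if "Q \<in> Model" "i \<in> I" for Q i
    using PiE_mem[OF subsetD[OF assms(9) that(1)]] that(2) by (simp add: I_def)
  note Pb = Mod[OF \<open>Pbar \<in> Model\<close>]
  have dist: "distr \<Omega> \<mu> (X i) = Pstar i" if "i \<in> I" for i using assms(18) that by (simp add: I_def)
  have X: "X i \<in> measurable \<Omega> \<mu>" if "i \<in> I" for i
    using assms(17) that by (auto simp: \<Omega>.indep_vars_def I_def)
  have L0: "0 \<le> L Q" if "Q \<in> Model" for Q
    unfolding L_def total_loss_def using that Pst Mod assms(6) by (intro sum_nonneg) (auto simp: I_def)
  have Lsum: "L Q = (\<Sum>i\<in>I. loss (Pstar i) (Q i))" for Q by (simp add: L_def total_loss_def I_def)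
  have g: "g Q i \<in> borel_measurable \<mu>" if "Q \<in> Model" "i \<in> I" for Q i
    using tf Pb[OF that(2)] Mod[OF that] by (auto simp: g_def test_family_def)
  have osc: "g Q i x - g Q i y \<le> 1" if "Q \<in> Model" "i \<in> I" "x \<in> space \<mu>" "y \<in> space \<mu>" for Q i x y
    unfolding g_def using test_family_osc[OF tf Pb[OF that(2)] Mod[OF that(1,2)] that(3,4)] .
  have mean_le: "(\<integral>x. g Q i x \<partial>distr \<Omega> \<mu> (X i)) \<le> a0 * loss (Pstar i) (Pbar i) - a1 * loss (Pstar i) (Q i)"
    and var_le: "(\<integral>x. (g Q i x - (\<integral>x. g Q i x \<partial>distr \<Omega> \<mu> (X i)))\<^sup>2 \<partial>distr \<Omega> \<mu> (X i))
      \<le> a2 * (loss (Pstar i) (Pbar i) + loss (Pstar i) (Q i))"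
    if "Q \<in> Model" "i \<in> I" for Q i
    using tf Pb[OF that(2)] Mod[OF that] Pst[OF that(2)] unfolding dist[OF that(2)] g_def test_family_def by blast+
  have e_le: "e Q \<le> a0 * L Pbar - a1 * L Q" if "Q \<in> Model" for Q
    unfolding e_def Lsum sum_distrib_left sum_subtractf[symmetric] by (intro sum_mono mean_le that)
  have var_sum: "(\<Sum>i\<in>I. \<integral>x. (g Q i x - (\<integral>x. g Q i x \<partial>distr \<Omega> \<mu> (X i)))\<^sup>2 \<partial>distr \<Omega> \<mu> (X i)) \<le> a2 * (L Pbar + L Q)"
    if "Q \<in> Model" for Q
    unfolding Lsum sum_distrib_left sum.distrib[symmetric] by (intro sum_mono var_le that)
  have T: "T_pair t n (obs \<omega>) Pbar Q = e Q + S Q \<omega>" for Q \<omega>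
    by (simp add: T_pair_def obs_def observation_def S_def e_def g_def I_def sum.distrib[symmetric])
  have bg: "bdd_meas \<Omega> (\<lambda>\<omega>. g Q i (X i \<omega>))" if "Q \<in> Model" "i \<in> I" for Q i
  proof -
    obtain \<omega>0 where "\<omega>0 \<in> space \<Omega>" using \<Omega>.not_empty by blast
    then have y: "X i \<omega>0 \<in> space \<mu>" using measurable_space[OF X[OF that(2)]] by auto
    show ?thesis
    proof (rule bdd_measI[of _ _ "\<bar>g Q i (X i \<omega>0)\<bar> + 1"])
      show "(\<lambda>\<omega>. g Q i (X i \<omega>)) \<in> borel_measurable \<Omega>" by (rule measurable_compose[OF X[OF that(2)] g[OF that]])
      fix \<omega> assume "\<omega> \<in> space \<Omega>"
      then have "X i \<omega> \<in> space \<mu>" using measurable_space[OF X[OF that(2)]] by auto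
      then show "\<bar>g Q i (X i \<omega>)\<bar> \<le> \<bar>g Q i (X i \<omega>0)\<bar> + 1"
        using osc[OF that, of "X i \<omega>" "X i \<omega>0"] osc[OF that, of "X i \<omega>0" "X i \<omega>"] y by simp
    qed
  qed
  \<comment> \<open>Identifies the centring in \<open>local_complexity\<close>, an expectation on
    \<Omega>, with the sum of the means under the individual laws.\<close>
  have exp_T: "\<Omega>.expectation (\<lambda>\<omega>. T_pair t n (obs \<omega>) Pbar Q) = e Q" if "Q \<in> Model" for Q
  proof -
    have "\<Omega>.expectation (\<lambda>\<omega>. T_pair t n (obs \<omega>) Pbar Q) = \<Omega>.expectation (\<lambda>\<omega>. \<Sum>i\<in>I. g Q i (X i \<omega>))"
      by (simp add: T_pair_def obs_def observation_def g_def I_def)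
    also have "\<dots> = (\<Sum>i\<in>I. \<Omega>.expectation (\<lambda>\<omega>. g Q i (X i \<omega>)))"
      by (intro Bochner_Integration.integral_sum bdd_meas_integrable bg that assms)
    also have "\<dots> = e Q"
      unfolding e_def by (intro sum.cong refl integral_distr[symmetric] X g that)
    finally show ?thesis .
  qed
  define w where "w = local_complexity \<Omega> X t loss n Model Pstar Pbar"
  define ball where "ball = (\<lambda>y. {Q \<in> Model. L Q \<le> y})"
  have w: "w y = (\<integral>\<^sup>+\<omega>. (SUP Q\<in>ball y. ennreal \<bar>S Q \<omega>\<bar>) \<partial>\<Omega>)" for y
    unfolding w_def local_complexity_def loss_ball_def ball_def L_def[symmetric] obs_def[symmetric] T
    by (intro nn_integral_cong SUP_cong refl) (simp add: exp_T[unfolded T])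
  define D where "D = D_bound \<Omega> X t loss n Model a1 a2 Pstar Pbar"
  define R where "R = (4 * a0 / a1 + 1) * L Pbar - model_loss loss n Pstar Model"
  define R' where "R' = (4 * a2 / a1 + 1) * (8 * \<xi> / a1) + 2 * \<epsilon> / a1"
  let ?G = "{\<omega> \<in> space \<Omega>. ereal (L (Phat (obs \<omega>))) \<le> ereal R + 2 * D + ereal R'}"
  have c: "0 < c1 a1 a2" using c1_eq(3) a by simp
  have D0: "ereal (inverse (c1 a1 a2)) \<le> D" unfolding D_def D_bound_def by (rule max.cobounded2)
  have "1 - exp (- \<xi>) \<le> measure \<Omega> ?G"
  proof (cases D)
    case PInf
    then have "?G = space \<Omega>" by auto
    then show ?thesis using \<Omega>.prob_space by simp
  next
    case MInf
    then show ?thesis using D0 by simp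
  next
    case (real d)
    have d: "1 / c1 a1 a2 \<le> d" using D0 real by (simp add: inverse_eq_divide)
    have d0: "0 < d" using d c by (meson divide_pos_pos less_le_trans zero_less_one)
    \<comment> \<open>At \<open>y = d\<close> the supremum gives no information: \<open>d\<close>
      may itself be an exceptional radius. No larger radius is, and since \<open>w\<close> is
      monotone and the right-hand side continuous, the bound extends to \<open>d\<close> from the
      right.\<close>
    have w_le: "w y \<le> ennreal (c1 a1 a2 * y)" if "d \<le> y" for y
    proof (rule tendsto_lowerbound)
      show "((\<lambda>z. ennreal (c1 a1 a2 * z)) \<longlongrightarrow> ennreal (c1 a1 a2 * y)) (at_right y)"
        by (intro tendsto_ennrealI tendsto_intros)
      have "w y \<le> ennreal (c1 a1 a2 * z)" if z: "y < z" for z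
      proof -
        have "w z \<le> ennreal (c1 a1 a2 * z)"
        proof (rule ccontr)
          assume "\<not> ?thesis"
          then have "ereal z \<in> insert 0 {ereal y | y. 0 < y \<and> w y > ennreal (c1 a1 a2 * y)}"
            using z \<open>d \<le> y\<close> d0 by auto
          then have "ereal z \<le> D" unfolding D_def D_bound_def w_def[symmetric]
            by (intro max.coboundedI1 Sup_upper)
          then show False using z \<open>d \<le> y\<close> real by simp
        qed
        moreover have "w y \<le> w z" unfolding w ball_def using z by (intro nn_integral_mono SUP_subset_mono) auto
        ultimately show ?thesis by simp
      qed
      then show "\<forall>\<^sub>F z in at_right y. w y \<le> ennreal (c1 a1 a2 * z)"
        by (intro eventually_at_rightI[of y "y + 1"]) auto
    qed simp
    \<comment> \<open>Multiplied by \<open>4 / a1\<close>, this becomes the loss of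
      \<open>Pbar\<close>, plus \<open>2 * d\<close>, plus the whole \<xi> term of the
      claim.\<close>
    define U where "U = a1 / 4 * L Pbar + a1 / 2 * d + (8 / (a1 / a2) + 2) * \<xi>"
    define u where "u = (\<lambda>j :: nat. (if j = 0 then 0 else a1 / 4 * (2 ^ j * d)) + U)"
    define A where "A = (\<lambda>j :: nat. {\<omega> \<in> space \<Omega>. \<exists>Q\<in>ball (2 ^ j * d). u j < \<bar>S Q \<omega>\<bar>})"
    have "countable Model"
      using countable_subset[OF assms(9)] countable_PiE[of "{1..n}" "\<lambda>_. \<M>"] assms(4) by simp
    then have cb: "countable (ball y)" for y by (rule countable_subset[rotated]) (auto simp: ball_def)
    have A: "A j \<in> sets \<Omega>" "measure \<Omega> (A j) \<le> exp (- \<xi>) * (1 / 2) ^ Suc j" for j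
    proof -
      have dj: "d \<le> 2 ^ j * d" using d0 by simp
      have r: "0 < a1 / a2" using a by simp
      have E0: "0 \<le> c1 a1 a2 * (2 ^ j * d)" using c d0 by simp
      have v: "(\<Sum>i\<in>I. \<integral>x. (g Q i x - (\<integral>x. g Q i x \<partial>distr \<Omega> \<mu> (X i)))\<^sup>2 \<partial>distr \<Omega> \<mu> (X i)) \<le> a2 * (L Pbar + 2 ^ j * d)"
        if "Q \<in> ball (2 ^ j * d)" for Q
      proof -
        have "a2 * (L Pbar + L Q) \<le> a2 * (L Pbar + 2 ^ j * d)"
          using that a by (intro mult_left_mono) (auto simp: ball_def)
        then show ?thesis using var_sum[of Q] that by (auto simp: ball_def)
      qed
      have uj: "c1 a1 a2 * (2 ^ j * d) + a1 / a2 / 8 * (5 / 4 * (a2 * (L Pbar + 2 ^ j * d)) + 11 / 2 * (c1 a1 a2 * (2 ^ j * d)))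
          + (8 / (a1 / a2) + 2) * (\<xi> + (real j + 1) * ln 2) \<le> u j"
        unfolding u_def U_def by (rule peeling_threshold[OF a(2,3) d L0[OF \<open>Pbar \<in> Model\<close>]])
      have gB: "g Q i \<in> borel_measurable \<mu>" if "Q \<in> ball (2 ^ j * d)" "i \<in> I" for Q i
        using that g by (auto simp: ball_def)
      have oB: "g Q i x - g Q i y \<le> 1" if "Q \<in> ball (2 ^ j * d)" "i \<in> I" "x \<in> space \<mu>" "y \<in> space \<mu>" for Q i x y
        using that osc by (auto simp: ball_def)
      note tail = countable_sup_tail[where g=g and X=X and \<Omega>=\<Omega> and \<mu>=\<mu>, OF assms(16) I assms(17)[folded I_def] cb gB oB v
        w_le[OF dj, unfolded w S_def] E0 r uj]
      show "A j \<in> sets \<Omega>" using tail(1) unfolding A_def S_def .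
      have "measure \<Omega> (A j) \<le> exp (- (\<xi> + (real j + 1) * ln 2))" using tail(2) unfolding A_def S_def .
      also have "\<dots> = exp (- \<xi>) * exp (- ln 2) ^ Suc j"
        by (simp add: exp_of_nat_mult[symmetric] exp_add[symmetric] algebra_simps)
      also have "exp (- ln 2) = (1 / 2 :: real)" by (simp add: exp_minus)
      finally show "measure \<Omega> (A j) \<le> exp (- \<xi>) * (1 / 2) ^ Suc j" .
    qed
    define bad where "bad = (\<Union>j. A j)"
    have bad: "bad \<in> sets \<Omega>" unfolding bad_def using A(1) by auto
    have sm: "summable (\<lambda>j. exp (- \<xi>) * (1 / 2 :: real) ^ Suc j)" using sum_half_powers by (rule sums_summable)
    have smA: "summable (\<lambda>j. measure \<Omega> (A j))"
      by (rule summable_comparison_test'[OF sm, of 0]) (use A(2) in simp)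
    have "measure \<Omega> bad \<le> (\<Sum>j. measure \<Omega> (A j))"
      unfolding bad_def using A(1) smA by (intro \<Omega>.finite_measure_subadditive_countably) auto
    also have "\<dots> \<le> (\<Sum>j. exp (- \<xi>) * (1 / 2) ^ Suc j)" by (intro suminf_le A(2) sm smA)
    also have "\<dots> = exp (- \<xi>)" using sum_half_powers[of "exp (- \<xi>)"] by (rule sums_unique[symmetric])
    finally have mbad: "measure \<Omega> bad \<le> exp (- \<xi>)" .
    have le: "(INF P\<in>Model. L P) \<le> L Q" if "Q \<in> Model" for Q
      using that L0 by (intro cINF_lower bdd_belowI2[of _ 0]) auto
    have obs: "obs \<in> measurable \<Omega> (PiM {1..n} (\<lambda>_. \<mu>))"
      unfolding obs_def observation_def using X by (intro measurable_restrict) (auto simp: I_def)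
    have Ph: "Phat \<in> measurable (PiM {1..n} (\<lambda>_. \<mu>)) (count_space Model)"
      and est: "\<And>x. x \<in> space (PiM {1..n} (\<lambda>_. \<mu>)) \<Longrightarrow>
        T_sup t n Model x (Phat x) \<le> (INF P\<in>Model. T_sup t n Model x P) + ereal \<epsilon>"
      using assms(14) by (auto simp: l_estimator_def)
    have good: "L (Phat (obs \<omega>)) \<le> R + 2 * d + R'" if \<omega>: "\<omega> \<in> space \<Omega> - bad" for \<omega>
    proof -
      have ox: "obs \<omega> \<in> space (PiM {1..n} (\<lambda>_. \<mu>))" using measurable_space[OF obs] \<omega> by auto
      define Q where "Q = Phat (obs \<omega>)"
      have Q: "Q \<in> Model" unfolding Q_def using measurable_space[OF Ph ox] by simp
      have dev: "\<bar>S P \<omega>\<bar> \<le> a1 / 2 * L P + U" if P: "P \<in> Model" for P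
      proof -
        have ex: "\<exists>j. L P \<le> 2 ^ j * d"
        proof -
          obtain j where "L P / d < 2 ^ j" using real_arch_pow[of 2 "L P / d"] by auto
          then show ?thesis using d0 by (intro exI[of _ j]) (simp add: pos_divide_less_eq)
        qed
        \<comment> \<open>By minimality, unless \<open>j = 0\<close>, half the radius is smaller
          than the loss of \<open>P\<close>; the ring's share \<open>a1 / 4 * (2 ^ j * d)\<close> of
          the threshold is then at most \<open>a1 / 2 * L P\<close>.\<close>
        define j where "j = (LEAST j. L P \<le> 2 ^ j * d)"
        have j: "L P \<le> 2 ^ j * d" unfolding j_def using ex by (rule LeastI_ex)
        then have "P \<in> ball (2 ^ j * d)" using P by (simp add: ball_def)
        moreover have "\<omega> \<notin> A j" using \<omega> by (auto simp: bad_def)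
        ultimately have "\<bar>S P \<omega>\<bar> \<le> u j" using \<omega> by (auto simp: A_def not_less)
        also have "u j \<le> a1 / 2 * L P + U"
        proof (cases j)
          case 0
          then show ?thesis using L0[OF P] a by (simp add: u_def)
        next
          case (Suc k)
          then have "\<not> L P \<le> 2 ^ k * d" using not_less_Least[of k "\<lambda>j. L P \<le> 2 ^ j * d"] by (simp add: j_def)
          then have "a1 / 2 * (2 ^ k * d) \<le> a1 / 2 * L P" using a by (intro mult_left_mono) auto
          then show ?thesis using Suc by (simp add: u_def mult_ac)
        qed
        finally show ?thesis .
      qed
      have anti: "T_pair t n (obs \<omega>) Q Pbar = - T_pair t n (obs \<omega>) Pbar Q"
        unfolding T_pair_def sum_negf[symmetric]
      proof (rule sum.cong[OF refl])
        fix i assume i: "i \<in> {1..n}"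
        then have "i \<in> I" by (simp add: I_def)
        moreover have "obs \<omega> i \<in> space \<mu>" using ox i by (auto simp: space_PiM)
        ultimately show "t (Q i) (Pbar i) (obs \<omega> i) = - t (Pbar i) (Q i) (obs \<omega> i)"
          using tf Mod[OF Q] Pb unfolding test_family_def by blast
      qed
      \<comment> \<open>The estimator is tested only against \<open>Pbar\<close>, and its
        near-minimality is used only with \<open>Pbar\<close> as competitor, so every deviation
        involved has the form \<open>S P \<omega>\<close>.\<close>
      have "ereal (T_pair t n (obs \<omega>) Q Pbar) \<le> T_sup t n Model (obs \<omega>) Q"
        unfolding T_sup_def by (rule SUP_upper) fact
      also have "\<dots> \<le> (INF P\<in>Model. T_sup t n Model (obs \<omega>) P) + ereal \<epsilon>"
        unfolding Q_def by (rule est[OF ox])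
      also have "\<dots> \<le> T_sup t n Model (obs \<omega>) Pbar + ereal \<epsilon>"
        by (intro add_right_mono INF_lower) fact
      also have "\<dots> \<le> ereal (a0 * L Pbar - a1 / 2 * (INF P\<in>Model. L P) + U) + ereal \<epsilon>"
        unfolding T_sup_def
      proof (intro add_right_mono SUP_least)
        fix P assume P: "P \<in> Model"
        have "T_pair t n (obs \<omega>) Pbar P \<le> a0 * L Pbar - a1 * L P + (a1 / 2 * L P + U)"
          unfolding T using e_le[OF P] dev[OF P] by linarith
        \<comment> \<open>Half of the loss of \<open>P\<close> survives the deviation; bounding it
          below by the infimum over the model yields the term \<open>- model_loss\<close>.\<close>
        also have "\<dots> = a0 * L Pbar - a1 / 2 * L P + U" by simp
        also have "\<dots> \<le> a0 * L Pbar - a1 / 2 * (INF P\<in>Model. L P) + U"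
          using le[OF P] a mult_left_mono[of "INF P\<in>Model. L P" "L P" "a1 / 2"] by simp
        finally show "ereal (T_pair t n (obs \<omega>) Pbar P) \<le> ereal (a0 * L Pbar - a1 / 2 * (INF P\<in>Model. L P) + U)"
          by simp
      qed
      finally have "- (e Q + S Q \<omega>) \<le> a0 * L Pbar - a1 / 2 * (INF P\<in>Model. L P) + U + \<epsilon>"
        unfolding anti T by simp
      \<comment> \<open>The deviation at \<open>Q\<close> uses up half of the
        \<open>a1 * L Q\<close> supplied by \<open>e_le\<close>; the other half is the quantity
        being bounded.\<close>
      moreover have "S Q \<omega> \<le> a1 / 2 * L Q + U" using dev[OF Q] by linarith
      ultimately have "a1 / 2 * L Q \<le> 2 * a0 * L Pbar - a1 / 2 * (INF P\<in>Model. L P) + 2 * U + \<epsilon>"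
        using e_le[OF Q] by linarith
      then have "L Q \<le> (2 * a0 * L Pbar - a1 / 2 * (INF P\<in>Model. L P) + 2 * U + \<epsilon>) / (a1 / 2)"
        using a by (simp add: pos_le_divide_eq mult.commute)
      also have "\<dots> = R + 2 * d + R'"
        using a by (simp add: R_def R'_def U_def model_loss_def L_def[symmetric] field_simps)
      finally show ?thesis by (simp add: Q_def)
    qed
    have meas: "?G \<in> sets \<Omega>"
    proof -
      have "(\<lambda>\<omega>. Phat (obs \<omega>)) \<in> measurable \<Omega> (count_space Model)"
        using measurable_compose[OF obs Ph] .
      then have [measurable]: "(\<lambda>\<omega>. L (Phat (obs \<omega>))) \<in> borel_measurable \<Omega>"
        by (rule measurable_compose) simp
      show ?thesis by measurable
    qed
    have "1 - exp (- \<xi>) \<le> measure \<Omega> (space \<Omega> - bad)"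
      using mbad \<Omega>.prob_compl[OF bad] by simp
    also have "\<dots> \<le> measure \<Omega> ?G"
      using good meas real by (intro \<Omega>.finite_measure_mono) auto
    finally show ?thesis .
  qed
  then show ?thesis unfolding L_def R_def R'_def D_def obs_def .
qed

end
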